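(* Let $n\geq 2$ and $K\geq 1$ be integers, and assume (A): all eigenvalues in $S_n$ and in $\tilde S_n$ are simple and $S_n\cap\tilde S_n=\emptyset$. With the notation of the context ($\mathcal C$, $e^{(l)}$, $\lambda_k^{(l)}$, $p_k^{(l)}$, $s_k^{(l)}$, $\theta_k=\cos\frac{\pi k}{K}$, subscripts $e,o$ for even and odd components), the following hold. 1. (Inverse $F_n$-transform.) If $w=\sum_{l=1}^{n-1}w_{0l}s_0^{(l)}+\sum_{k=1}^{K-1}\sum_{l=1}^n w_{kl}s_k^{(l)}\in S_K^{(n)}$ with real coefficients $w_{kl}$, then $$w_j=\sum_{k=1}^{K-1}\Big(\sum_{l=1}^n w_{kl}\Big)\sin\frac{\pi kj}{K},\quad 1\le j\le K-1,$$ $$w_{j-1/2}=(-P)^{j-1}\sum_{l=1}^{n-1}w_{0l}e^{(l)}+2\sum_{k=1}^{K-1}d_{k,e}\cos\frac{\pi k}{2K}\sin\frac{\pi k(j-1/2)}{K}-2\sum_{k=1}^{K-1}d_{k,o}\sin\frac{\pi k}{2K}\cos\frac{\pi k(j-1/2)}{K},\quad 1\le j\le K,$$ where $d_{k,e}$ and $d_{k,o}$ are the even and odd components of $d_k:=\sum_{l=1}^n w_{kl}p_k^{(l)}\in\mathbb R^{n-1}$. Here $(-P)^{j-1}e=e$ for odd $j$ and $(-P)^{j-1}e=-\check e$ for even $j$, for any $e\in\mathbb R^{n-1}$. Consequently the collection $\{w_j\}_{j=1}^{K-1}$ can be computed by one DST-I, and the collection $\{w_{j-1/2}\}_{j=1}^K$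 can be computed by $n-1$ transforms, namely $[n/2]$ DST-III (sines at the element centers) and $[(n-1)/2]$ DCT-III (cosines at the element centers), using the extensions $d_{K,e}:=0$ and $d_{0,o}:=0$. 2. (Direct $FC_n$-transform.) If $y=\sum_{l=1}^{n-1}\widetilde y_{0l}\,\mathcal C s_0^{(l)}+\sum_{k=1}^{K-1}\sum_{l=1}^n\widetilde y_{kl}\,\mathcal C s_k^{(l)}\in S_K^{(n)}$, then $$\widetilde y_{kl}=\big(y,s_k^{(l)}\big)_{S_K^{(n)}}/\|s_k^{(l)}\|_{\mathcal C}^2 .$$ For $k=0$, $1\le l\le n-1$: $$(y,s_0^{(l)})_{S_K^{(n)}}=\Big(\sum_{j=1}^K(-P)^{j-1}y_{j-1/2}\Big)\cdot e^{(l)},\qquad \|s_0^{(l)}\|_{\mathcal C}^2=K.$$ For $1\le k\le K-1$, $1\le l\le n$: $$(y,s_k^{(l)})_{S_K^{(n)}}=\sum_{j=1}^{K-1}y_j\sin\frac{\pi kj}{K}+p_{k,e}^{(l)}\cdot\sum_{j=1}^{K-1}(y_{j-1/2}+y_{j+1/2})_e\sin\frac{\pi kj}{K}+p_{k,o}^{(l)}\cdot\sum_{j=1}^{K-1}(y_{j+1/2}-y_{j-1/2})_o\sin\frac{\pi kj}{K},$$ $$\|s_k^{(l)}\|_{\mathcal C}^2=K\Big\{c_0+\big(\widetilde Cp_k^{(l)}+2c\big)\cdot p_k^{(l)}+\theta_k\big[c_n+\big(\widetilde Cp_k^{(l)}+2c\big)\cdot\check p_k^{(l)}\big]\Big\}.$$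 The sums over $j$ in the formula for $(y,s_k^{(l)})_{S_K^{(n)}}$ are independent of $l$, and the collection of all of them (over $1\le k\le K-1$) can be computed using $n$ DST-I transforms. 3. (Direct $F_n$-transform.) If $w\in S_K^{(n)}$ is expanded as in item 1, then $$w_{kl}=\big(\mathcal Cw,s_k^{(l)}\big)_{S_K^{(n)}}/\|s_k^{(l)}\|_{\mathcal C}^2 .$$ For $k=0$, $1\le l\le n-1$: $$(\mathcal Cw,s_0^{(l)})_{S_K^{(n)}}=\Big(\widetilde C\sum_{j=1}^K(-P)^{j-1}w_{j-1/2}\Big)\cdot e^{(l)}.$$ For $1\le k\le K-1$, $1\le l\le n$, the formula for $(y,s_k^{(l)})_{S_K^{(n)}}$ in item 2 applies with $y:=\mathcal Cw$; alternatively, $$(\mathcal Cw,s_k^{(l)})_{S_K^{(n)}}=2\big[c_0+c\cdot p_k^{(l)}+\theta_k\big(c_n+c\cdot\check p_k^{(l)}\big)\big]\sum_{j=1}^{K-1}w_j\sin\frac{\pi kj}{K}+q_{k,e}^{(l)}\cdot\sum_{j=1}^{K-1}(w_{j-1/2}+w_{j+1/2})_e\sin\frac{\pi kj}{K}+q_{k,o}^{(l)}\cdot\sum_{j=1}^{K-1}(w_{j+1/2}-w_{j-1/2})_o\sin\frac{\pi kj}{K},$$ where $q_{k,e}^{(l)}$ and $q_{k,o}^{(l)}$ are the even and odd components of $q_k^{(l)}:=\widetilde Cp_k^{(l)}+c$. Again, all the sums over $j$ here can be computed using $n$ DST-I transforms.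
   Context: Local matrices. Let $\mathcal P_n$ be the space of real polynomials of degree at most $n$, $n\ge2$, and $\{e_l\}_{l=0}^n$ its Lagrange basis on $[-1,1]$ with $e_l(-1+2k/n)=\delta_{kl}$, $0\le k,l\le n$. Let $A_{kl}=\int_{-1}^1e_k'e_l'\,dx$, $C_{kl}=\int_{-1}^1e_ke_l\,dx$, $0\le k,l\le n$, and $G(\lambda)=A-\lambda C$. For $p\in\mathbb R^{n-1}$ (indices $1,\dots,n-1$) let $\check p=Pp$, $\check p_l=p_{n-l}$. In block form (sizes $1,n-1,1$) $$A=\begin{pmatrix} a_0 & a^T & a_n \\ a & \widetilde A & \check a \\ a_n & \check a^T & a_0 \end{pmatrix},\quad C=\begin{pmatrix} c_0 & c^T & c_n \\ c & \widetilde C & \check c \\ c_n & \check c^T & c_0 \end{pmatrix},$$ and $g_0(\lambda)=a_0-\lambda c_0$, $g_n(\lambda)=a_n-\lambda c_n$, $g(\lambda)=a-\lambda c$, $\widetilde G(\lambda)=\widetilde A-\lambda\widetilde C$. The matrices $C,\widetilde A,\widetilde C$ are symmetric positive definite. The dot $\cdot$ is the Euclidean inner product in $\mathbb R^{n-1}$. A vector $p\in\mathbb R^{n-1}$ is even if $Pp=p$, odd if $Pp=-p$; its even and odd components are $p_e=\frac12(p+\check p)$, $p_o=\frac12(p-\check p)$. Local spectra. $S_n$ is the spectrum of $Ae=\lambda Ce$ in $\mathbb R^{n+1}$, $\tilde S_n$ is the spectrum of $\widetilde Ae=\lambda\widetilde Ce$ in $\mathbb R^{n-1}$, and $\{\lambda_0^{(l)},e^{(l)}\}_{l=1}^{n-1}$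 are the eigenpairs of the latter problem with each $e^{(l)}$ either even or odd, normalized by $\widetilde Ce^{(l)}\cdot e^{(l)}=1$. Global space and operators. $S_K^{(n)}$ is the space of collections $w$ with $w_j\in\mathbb R$, $0\le j\le K$, $w_0=w_K=0$, and $w_{j-1/2}\in\mathbb R^{n-1}$, $1\le j\le K$; its dimension is $nK-1$. The inner product is $(y,v)_{S_K^{(n)}}=\sum_{j=1}^{K-1}y_jv_j+\sum_{j=1}^Ky_{j-1/2}\cdot v_{j-1/2}$. The global mass operator $\mathcal C$ on $S_K^{(n)}$ is $$(\mathcal Cv)_j=c_nv_{j-1}+\check c\cdot v_{j-1/2}+2c_0v_j+c\cdot v_{j+1/2}+c_nv_{j+1},\ 1\le j\le K-1,\qquad(\mathcal Cv)_{j-1/2}=cv_{j-1}+\widetilde Cv_{j-1/2}+\check cv_j,\ 1\le j\le K$$ (with $(\mathcal Cv)_0=(\mathcal Cv)_K=0$); it is symmetric positive definite, and $\|v\|_{\mathcal C}^2=(\mathcal Cv,v)_{S_K^{(n)}}$. The global stiffness operator $\mathcal A$ is defined in the same way from the blocks of $A$. Eigenvectors. For $1\le k\le K-1$ put $\theta_k=\cos\frac{\pi k}K$ and let $\lambda_k^{(1)},\dots,\lambda_k^{(n)}$ be the $n$ distinct (real, positive) solutions $\lambda\notin\tilde S_n$ of $$(g_0-g\cdot\widetilde G^{-1}g)(\lambda)=-\theta_k\,(g_n-\check g\cdot\widetilde G^{-1}g)(\lambda).$$ Let $p_k^{(l)}\in\mathbb R^{n-1}$ be the solution of $\widetilde G(\lambda_k^{(l)})p_k^{(l)}=-g(\lambda_k^{(l)})$.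 Define elements of $S_K^{(n)}$: for $1\le l\le n-1$, $s_{0,j}^{(l)}=0$ $(1\le j\le K-1)$, $s_{0,j-1/2}^{(l)}=(-P)^{j-1}e^{(l)}$ $(1\le j\le K)$; for $1\le k\le K-1$, $1\le l\le n$, $s_{k,j}^{(l)}=\sin\frac{\pi kj}K$ $(1\le j\le K-1)$, $s_{k,j-1/2}^{(l)}=p_k^{(l)}\sin\frac{\pi k(j-1)}K+\check p_k^{(l)}\sin\frac{\pi kj}K$ $(1\le j\le K)$. Under (A) these are $\mathcal C$-orthogonal eigenvectors of $\mathcal Av=\lambda\mathcal Cv$ and form a basis of $S_K^{(n)}$, so the expansions in the claim exist and are unique for every $w,y\in S_K^{(n)}$. Transforms. Up to normalization, DST-I maps $(b_k)_{k=1}^{K-1}$ to $\big(\sum_{k=1}^{K-1}b_k\sin\frac{\pi kj}K\big)_{j=1}^{K-1}$; DST-III maps $(b_k)_{k=1}^{K}$ to $\big(\sum_{k=1}^{K}b_k\sin\frac{\pi k(j-1/2)}K\big)_{j=1}^K$; DCT-III maps $(b_k)_{k=0}^{K-1}$ to $\big(\sum_{k=0}^{K-1}b_k\cos\frac{\pi k(j-1/2)}K\big)_{j=1}^K$ (each computable by a fast Fourier transform algorithm). Even (odd) vectors in $\mathbb R^{n-1}$ form a space of dimension $[n/2]$ (resp. $[(n-1)/2]$), $[\cdot]$ being the integer part; a transform applied to a sequence of vectors is applied componentwise. "Can be computed by" such transforms means up to pre- and post-processing that is elementwise in $k$ or $j$ (linear combinations over $l$, scaling, addition of the explicit $k=0$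 term). *)

theory Defs
  imports
    "HOL-Analysis.Henstock_Kurzweil_Integration"
    "Jordan_Normal_Form.Char_Poly"
    "Jordan_Normal_Form.Gauss_Jordan_Elimination"
begin

text \<open>
  A vector \<open>p\<close> in the space of dimension \<open>n - 1\<close> with components \<open>p\<^sub>1, \<dots>, p\<^bsub>n-1\<^esub>\<close> is a
  member of \<^term>\<open>carrier_vec (n - 1)\<close>; its component \<open>p\<^sub>l\<close> is \<open>p $ (l - 1)\<close>.
\<close>

abbreviation vec_sum :: "nat \<Rightarrow> ('i \<Rightarrow> real vec) \<Rightarrow> 'i set \<Rightarrow> real vec" where
  "vec_sum m f I \<equiv> finsum_vec TYPE(real) m f I"


text \<open>A notation for the Euclidean product of \<^typ>\<open>real vec\<close> distinct from that of \<^const>\<open>inner\<close>.\<close>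

notation scalar_prod (infix "\<bullet>\<^sub>v" 70)


subsection \<open>The reflection and parity\<close>

text \<open>In terms of the components \<open>p\<^sub>1, \<dots>, p\<^bsub>n-1\<^esub>\<close> this is \<open>p\<^sub>l \<mapsto> p\<^bsub>n-l\<^esub>\<close>.\<close>

definition refl_vec :: "real vec \<Rightarrow> real vec" where
  "refl_vec p = vec (dim_vec p) (\<lambda>i. p $ (dim_vec p - 1 - i))"

definition even_vec :: "real vec \<Rightarrow> bool" where
  "even_vec p \<longleftrightarrow> refl_vec p = p"

definition odd_vec :: "real vec \<Rightarrow> bool" where
  "odd_vec p \<longleftrightarrow> refl_vec p = - p"

definition even_part :: "real vec \<Rightarrow> real vec" where
  "even_part p = (1/2) \<cdot>\<^sub>v (p + refl_vec p)"

definition odd_part :: "real vec \<Rightarrow> real vec" where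
  "odd_part p = (1/2) \<cdot>\<^sub>v (p - refl_vec p)"

definition neg_refl_pow :: "nat \<Rightarrow> real vec \<Rightarrow> real vec" where
  "neg_refl_pow m = (\<lambda>p. - refl_vec p) ^^ m"


subsection \<open>Local matrices\<close>

definition lag_node :: "nat \<Rightarrow> nat \<Rightarrow> real" where
  "lag_node n k = - 1 + 2 * real k / real n"

definition lagrange :: "nat \<Rightarrow> nat \<Rightarrow> real poly" where
  "lagrange n l = (THE p. degree p \<le> n \<and>
     (\<forall>k\<le>n. poly p (lag_node n k) = (if k = l then 1 else 0)))"

lemma lagrange_ex1:
  assumes "n \<ge> 1" "l \<le> n"
  shows "\<exists>!p :: real poly. degree p \<le> n \<and>
    (\<forall>k\<le>n. poly p (lag_node n k) = (if k = l then 1 else 0))"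
proof (rule ex_ex1I)
  have inj: "lag_node n i = lag_node n j \<longleftrightarrow> i = j" for i j
    using assms by (simp add: lag_node_def)
  define q where "q = (\<Prod>m\<in>{..n} - {l}. [:- lag_node n m, 1:])"
  have q0: "poly q (lag_node n k) = 0 \<longleftrightarrow> k \<noteq> l" if "k \<le> n" for k
    using that by (auto simp: q_def poly_prod inj)
  have "degree q \<le> (\<Sum>m\<in>{..n} - {l}. degree [:- lag_node n m, 1:])"
    unfolding q_def using degree_prod_sum_le[of "{..n} - {l}" "\<lambda>m. [:- lag_node n m, 1:]"]
    by (simp add: o_def)
  also have "\<dots> = n" using assms by simp
  finally have dq: "degree q \<le> n" .
  show "\<exists>p. degree p \<le> n \<and> (\<forall>k\<le>n. poly p (lag_node n k) = (if k = l then 1 else 0))"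
    by (rule exI[of _ "Polynomial.smult (1 / poly q (lag_node n l)) q"])
       (use dq q0 assms in \<open>auto intro: order_trans[OF degree_smult_le]\<close>)
next
  fix p q :: "real poly"
  assume p: "degree p \<le> n \<and> (\<forall>k\<le>n. poly p (lag_node n k) = (if k = l then 1 else 0))"
    and q: "degree q \<le> n \<and> (\<forall>k\<le>n. poly q (lag_node n k) = (if k = l then 1 else 0))"
  have inj: "inj_on (lag_node n) {..n}"
    using assms by (auto simp: lag_node_def inj_on_def)
  show "p = q"
  proof (rule ccontr)
    assume ne: "p \<noteq> q"
    then have fin: "finite {x. poly (p - q) x = 0}"
      by (intro poly_roots_finite) simp
    have "lag_node n ` {..n} \<subseteq> {x. poly (p - q) x = 0}" using p q by auto
    from card_mono[OF fin this] have "n + 1 \<le> card {x. poly (p - q) x = 0}"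
      using inj by (simp add: card_image)
    also have "\<dots> \<le> degree (p - q)" using ne by (intro card_poly_roots_bound) simp
    also have "\<dots> \<le> n" using p q by (intro degree_diff_le) auto
    finally show False by simp
  qed
qed

definition stiff_mat :: "nat \<Rightarrow> real mat" where
  "stiff_mat n = mat (n + 1) (n + 1) (\<lambda>(k, l).
     integral {-1..1} (\<lambda>x. poly (pderiv (lagrange n k)) x * poly (pderiv (lagrange n l)) x))"

definition mass_mat :: "nat \<Rightarrow> real mat" where
  "mass_mat n = mat (n + 1) (n + 1) (\<lambda>(k, l).
     integral {-1..1} (\<lambda>x. poly (lagrange n k) x * poly (lagrange n l) x))"

text \<open>
  The blocks of an \<open>(n + 1) \<times> (n + 1)\<close> matrix, for \<open>C\<close> in the order \<open>c\<^sub>0\<close>, \<open>c\<^sub>n\<close>, \<open>c\<close> and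
  \<open>C\<close> with tilde; the other blocks arise from these by symmetry and reflection.
\<close>

definition blk_0 :: "real mat \<Rightarrow> real" where
  "blk_0 M = M $$ (0, 0)"

definition blk_n :: "nat \<Rightarrow> real mat \<Rightarrow> real" where
  "blk_n n M = M $$ (0, n)"

definition blk_vec :: "nat \<Rightarrow> real mat \<Rightarrow> real vec" where
  "blk_vec n M = vec (n - 1) (\<lambda>i. M $$ (i + 1, 0))"

definition blk_mat :: "nat \<Rightarrow> real mat \<Rightarrow> real mat" where
  "blk_mat n M = mat (n - 1) (n - 1) (\<lambda>(i, j). M $$ (i + 1, j + 1))"

definition G_0 :: "nat \<Rightarrow> real \<Rightarrow> real" where
  "G_0 n \<mu> = blk_0 (stiff_mat n) - \<mu> * blk_0 (mass_mat n)"

definition G_n :: "nat \<Rightarrow> real \<Rightarrow> real" where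
  "G_n n \<mu> = blk_n n (stiff_mat n) - \<mu> * blk_n n (mass_mat n)"

definition G_vec :: "nat \<Rightarrow> real \<Rightarrow> real vec" where
  "G_vec n \<mu> = blk_vec n (stiff_mat n) - \<mu> \<cdot>\<^sub>v blk_vec n (mass_mat n)"

definition G_mat :: "nat \<Rightarrow> real \<Rightarrow> real mat" where
  "G_mat n \<mu> = blk_mat n (stiff_mat n) - \<mu> \<cdot>\<^sub>m blk_mat n (mass_mat n)"


subsection \<open>Generalized eigenvalue problems\<close>

definition gen_eigenvector :: "real mat \<Rightarrow> real mat \<Rightarrow> real vec \<Rightarrow> real \<Rightarrow> bool" where
  "gen_eigenvector A C v \<mu> \<longleftrightarrow> v \<in> carrier_vec (dim_row A) \<and> v \<noteq> 0\<^sub>v (dim_row A) \<and>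
     A *\<^sub>v v = \<mu> \<cdot>\<^sub>v (C *\<^sub>v v)"

definition gen_spectrum :: "real mat \<Rightarrow> real mat \<Rightarrow> real set" where
  "gen_spectrum A C = {\<mu>. \<exists>v. gen_eigenvector A C v \<mu>}"

text \<open>The polynomial \<open>det (A - \<mu> C)\<close> in \<open>\<mu>\<close>.\<close>

definition gen_char_poly :: "real mat \<Rightarrow> real mat \<Rightarrow> real poly" where
  "gen_char_poly A C =
     det (mat (dim_row A) (dim_col A) (\<lambda>(i, j). [:A $$ (i, j), - C $$ (i, j):]))"

definition simple_gen_eigenvalue :: "real mat \<Rightarrow> real mat \<Rightarrow> real \<Rightarrow> bool" where
  "simple_gen_eigenvalue A C \<mu> \<longleftrightarrow>
     \<mu> \<in> gen_spectrum A C \<and> Polynomial.order \<mu> (gen_char_poly A C) = 1"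

definition spec :: "nat \<Rightarrow> real set" where
  "spec n = gen_spectrum (stiff_mat n) (mass_mat n)"

definition spec_int :: "nat \<Rightarrow> real set" where
  "spec_int n = gen_spectrum (blk_mat n (stiff_mat n)) (blk_mat n (mass_mat n))"

definition cond_A :: "nat \<Rightarrow> bool" where
  "cond_A n \<longleftrightarrow>
     (\<forall>\<mu>\<in>spec n. simple_gen_eigenvalue (stiff_mat n) (mass_mat n) \<mu>) \<and>
     (\<forall>\<mu>\<in>spec_int n.
        simple_gen_eigenvalue (blk_mat n (stiff_mat n)) (blk_mat n (mass_mat n)) \<mu>) \<and>
     spec n \<inter> spec_int n = {}"

text \<open>
  Only meaningful for \<open>\<mu>\<close> outside \<^term>\<open>spec_int n\<close>, where \<^term>\<open>mat_inverse (G_mat n \<mu>)\<close> is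
  not \<^term>\<open>None\<close>.
\<close>

definition disp_eq :: "nat \<Rightarrow> real \<Rightarrow> real \<Rightarrow> bool" where
  "disp_eq n \<theta> \<mu> \<longleftrightarrow>
     (let h = the (mat_inverse (G_mat n \<mu>)) *\<^sub>v G_vec n \<mu>
      in G_0 n \<mu> - G_vec n \<mu> \<bullet>\<^sub>v h = - \<theta> * (G_n n \<mu> - refl_vec (G_vec n \<mu>) \<bullet>\<^sub>v h))"


subsection \<open>The global space and the mass operator\<close>

text \<open>
  An element \<open>w\<close> of the global space is a pair: \<open>node w j\<close> is \<open>w\<^sub>j\<close> and \<open>cell w j\<close> is
  \<open>w\<^bsub>j-1/2\<^esub>\<close>.  Values outside the index ranges are fixed to zero, so that equality of pairs
  is equality of collections.
\<close>

type_synonym gvec = "(nat \<Rightarrow> real) \<times> (nat \<Rightarrow> real vec)"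

abbreviation node :: "gvec \<Rightarrow> nat \<Rightarrow> real" where
  "node \<equiv> fst"

abbreviation cell :: "gvec \<Rightarrow> nat \<Rightarrow> real vec" where
  "cell \<equiv> snd"

definition gspace :: "nat \<Rightarrow> nat \<Rightarrow> gvec set" where
  "gspace n K = {w. (\<forall>j. j \<notin> {1..K - 1} \<longrightarrow> node w j = 0) \<and>
     (\<forall>j\<in>{1..K}. cell w j \<in> carrier_vec (n - 1)) \<and>
     (\<forall>j. j \<notin> {1..K} \<longrightarrow> cell w j = 0\<^sub>v (n - 1))}"

definition ginner :: "nat \<Rightarrow> gvec \<Rightarrow> gvec \<Rightarrow> real" where
  "ginner K y v = (\<Sum>j=1..K - 1. node y j * node v j) + (\<Sum>j=1..K. cell y j \<bullet>\<^sub>v cell v j)"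

definition gmass :: "nat \<Rightarrow> nat \<Rightarrow> gvec \<Rightarrow> gvec" where
  "gmass n K v =
     (let c0 = blk_0 (mass_mat n); cn = blk_n n (mass_mat n);
          c = blk_vec n (mass_mat n); Ct = blk_mat n (mass_mat n)
      in (\<lambda>j. if j \<in> {1..K - 1}
              then cn * node v (j - 1) + refl_vec c \<bullet>\<^sub>v cell v j + 2 * c0 * node v j
                     + c \<bullet>\<^sub>v cell v (j + 1) + cn * node v (j + 1)
              else 0,
          \<lambda>j. if j \<in> {1..K}
              then node v (j - 1) \<cdot>\<^sub>v c + Ct *\<^sub>v cell v j + node v j \<cdot>\<^sub>v refl_vec c
              else 0\<^sub>v (n - 1)))"

definition gmass_norm2 :: "nat \<Rightarrow> nat \<Rightarrow> gvec \<Rightarrow> real" where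
  "gmass_norm2 n K v = ginner K (gmass n K v) v"


subsection \<open>Eigenvectors and expansions\<close>

definition eig_vec_0 :: "nat \<Rightarrow> nat \<Rightarrow> real vec \<Rightarrow> gvec" where
  "eig_vec_0 n K e =
     (\<lambda>j. 0, \<lambda>j. if j \<in> {1..K} then neg_refl_pow (j - 1) e else 0\<^sub>v (n - 1))"

definition eig_vec_k :: "nat \<Rightarrow> nat \<Rightarrow> nat \<Rightarrow> real vec \<Rightarrow> gvec" where
  "eig_vec_k n K k p =
     (\<lambda>j. if j \<in> {1..K - 1} then sin (pi * real k * real j / real K) else 0,
      \<lambda>j. if j \<in> {1..K}
          then sin (pi * real k * (real j - 1) / real K) \<cdot>\<^sub>v p
                 + sin (pi * real k * real j / real K) \<cdot>\<^sub>v refl_vec p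
          else 0\<^sub>v (n - 1))"

definition eig_vec ::
  "nat \<Rightarrow> nat \<Rightarrow> (nat \<Rightarrow> real vec) \<Rightarrow> (nat \<Rightarrow> nat \<Rightarrow> real vec) \<Rightarrow> nat \<Rightarrow> nat \<Rightarrow> gvec" where
  "eig_vec n K e p k l = (if k = 0 then eig_vec_0 n K (e l) else eig_vec_k n K k (p k l))"

definition idx :: "nat \<Rightarrow> nat \<Rightarrow> (nat \<times> nat) set" where
  "idx n K = {0} \<times> {1..n - 1} \<union> {1..K - 1} \<times> {1..n}"

definition gcomb :: "nat \<Rightarrow> nat \<Rightarrow> (nat \<Rightarrow> nat \<Rightarrow> real) \<Rightarrow> (nat \<Rightarrow> nat \<Rightarrow> gvec) \<Rightarrow> gvec" where
  "gcomb n K c b =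
     (\<lambda>j. \<Sum>(k, l)\<in>idx n K. c k l * node (b k l) j,
      \<lambda>j. vec_sum (n - 1) (\<lambda>(k, l). c k l \<cdot>\<^sub>v cell (b k l) j) (idx n K))"


subsection \<open>Sums over the mesh\<close>

definition node_sum :: "nat \<Rightarrow> gvec \<Rightarrow> nat \<Rightarrow> real" where
  "node_sum K y k = (\<Sum>j=1..K - 1. node y j * sin (pi * real k * real j / real K))"

definition even_sum :: "nat \<Rightarrow> nat \<Rightarrow> gvec \<Rightarrow> nat \<Rightarrow> real vec" where
  "even_sum n K y k = vec_sum (n - 1)
     (\<lambda>j. sin (pi * real k * real j / real K) \<cdot>\<^sub>v even_part (cell y j + cell y (j + 1))) {1..K - 1}"

definition odd_sum :: "nat \<Rightarrow> nat \<Rightarrow> gvec \<Rightarrow> nat \<Rightarrow> real vec" where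
  "odd_sum n K y k = vec_sum (n - 1)
     (\<lambda>j. sin (pi * real k * real j / real K) \<cdot>\<^sub>v odd_part (cell y (j + 1) - cell y j)) {1..K - 1}"

definition alt_sum :: "nat \<Rightarrow> nat \<Rightarrow> gvec \<Rightarrow> real vec" where
  "alt_sum n K y = vec_sum (n - 1) (\<lambda>j. neg_refl_pow (j - 1) (cell y j)) {1..K}"


subsection \<open>Trigonometric transforms\<close>

definition dst1 :: "nat \<Rightarrow> (nat \<Rightarrow> real) \<Rightarrow> nat \<Rightarrow> real" where
  "dst1 K b j = (\<Sum>k=1..K - 1. b k * sin (pi * real k * real j / real K))"

definition dst3 :: "nat \<Rightarrow> (nat \<Rightarrow> real) \<Rightarrow> nat \<Rightarrow> real" where
  "dst3 K b j = (\<Sum>k=1..K. b k * sin (pi * real k * (real j - 1/2) / real K))"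

definition dct3 :: "nat \<Rightarrow> (nat \<Rightarrow> real) \<Rightarrow> nat \<Rightarrow> real" where
  "dct3 K b j = (\<Sum>k=0..K - 1. b k * cos (pi * real k * (real j - 1/2) / real K))"

text \<open>
  The quantity \<open>out d i\<close> in dimension \<open>mo\<close> (\<open>i \<in> J\<close>, data \<open>d \<in> D\<close>) is computable from the
  sequence \<open>inp d k\<close> in dimension \<open>mi\<close> (\<open>k \<in> I\<close>) by applying each transform of the list \<open>Ts\<close>
  once.  Before the transforms a matrix \<open>\<alpha> k\<close> is applied elementwise in \<open>k\<close>, each of its
  rows producing the input of one transform (extended by zero outside \<open>I\<close>); after them a
  matrix \<open>\<beta> i\<close> is applied elementwise in \<open>i\<close> and the explicit term \<open>ex d i\<close> is added.  The
  matrices do not depend on the data \<open>d\<close>.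
\<close>

definition computable_by_transforms ::
  "((nat \<Rightarrow> real) \<Rightarrow> nat \<Rightarrow> real) list \<Rightarrow> 'd set \<Rightarrow>
   nat set \<Rightarrow> nat \<Rightarrow> ('d \<Rightarrow> nat \<Rightarrow> real vec) \<Rightarrow>
   nat set \<Rightarrow> nat \<Rightarrow> ('d \<Rightarrow> nat \<Rightarrow> real vec) \<Rightarrow> ('d \<Rightarrow> nat \<Rightarrow> real vec) \<Rightarrow> bool" where
  "computable_by_transforms Ts D I mi inp J mo ex out \<longleftrightarrow>
     (\<exists>\<alpha> \<beta>. (\<forall>k\<in>I. \<alpha> k \<in> carrier_mat (length Ts) mi) \<and>
            (\<forall>i\<in>J. \<beta> i \<in> carrier_mat mo (length Ts)) \<and>
            (\<forall>d\<in>D. \<forall>i\<in>J. out d i = ex d i + \<beta> i *\<^sub>v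
               vec (length Ts) (\<lambda>r.
                 (Ts ! r) (\<lambda>k. if k \<in> I then (\<alpha> k *\<^sub>v inp d k) $ r else 0) i)))"

text \<open>
  The sums over the mesh depend on \<open>y\<^sub>j\<close>, \<open>y\<^bsub>j-1/2\<^esub>\<close>, \<open>y\<^bsub>j+1/2\<^esub>\<close> as the local data at the
  node \<open>j\<close>, a vector of dimension \<open>1 + 2(n - 1)\<close>.
\<close>

definition node_data :: "gvec \<Rightarrow> nat \<Rightarrow> real vec" where
  "node_data y j = vec 1 (\<lambda>_. node y j) @\<^sub>v (cell y j @\<^sub>v cell y (j + 1))"

definition mesh_sums :: "nat \<Rightarrow> nat \<Rightarrow> gvec \<Rightarrow> nat \<Rightarrow> real vec" where
  "mesh_sums n K y k =
     vec 1 (\<lambda>_. node_sum K y k) @\<^sub>v (even_sum n K y k @\<^sub>v odd_sum n K y k)"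

end

theory Submission
  imports Defs "HOL-Analysis.Equivalence_Lebesgue_Henstock_Integration"
begin

text \<open>
  The mass operator maps an eigenvector \<open>s\<^sub>k\<close> to a collection of the same shape, with another
  cell profile and a rescaled nodal part.  Since the mass operator is symmetric, every inner
  product in the theorem therefore reduces to an inner product with a collection of the shape of
  \<open>s\<^sub>0\<close> or \<open>s\<^sub>k\<close>.  Telescoping sums and the discrete orthogonality of sines make such
  collections orthogonal for different \<open>k\<close>; for equal \<open>k\<close> what remains is a bilinear form of the
  cell profiles, in which the dispersion equation expresses that profiles of different eigenvalues
  are orthogonal.  This form is positive since the local mass matrix is, so that the coefficients of an
  expansion can be recovered by division.
\<close>

text \<open>Parity enters through the half-element shift. In cell \<open>j\<close> the vector
  \<open>s_k\<close> is \<open>p\<close> times the sine at \<open>j - 1\<close> plus the reflection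
  of \<open>p\<close> times the sine at \<open>j\<close>, so its even part carries the sum and its
  odd part the difference of the two sines. At the element centre these become a sine with factor 2
  cos (pi k / (2 K)) and, up to sign, a cosine with factor 2 sin (pi k / (2 K)). Regrouped at the
  nodes, where the sines at both ends vanish, they pair with the sum and the difference of the two
  adjacent cells. The transform counts are dimension counts: a cell has \<open>n div 2\<close> even
  and \<open>(n - 1) div 2\<close> odd degrees of freedom, and a nodal value adds one. Reflection is
  compatible with the local matrices because the interpolation nodes are symmetric about 0. The
  dispersion equation is the nodal equation that remains after elimination of the cell unknowns; its
  coefficient \<theta> comes from the three-term recurrence of the sines.\<close>

unbundle no vec_syntax

subsection \<open>Reflection and parity\<close>

lemma refl_vec_carrier [simp, intro]: "p \<in> carrier_vec m \<Longrightarrow> refl_vec p \<in> carrier_vec m"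
  by (auto simp: refl_vec_def)

lemma dim_refl_vec [simp]: "dim_vec (refl_vec p) = dim_vec p"
  by (simp add: refl_vec_def)

lemma index_refl_vec [simp]: "i < dim_vec p \<Longrightarrow> refl_vec p $ i = p $ (dim_vec p - 1 - i)"
  by (simp add: refl_vec_def)

lemma refl_vec_refl_vec [simp]: "refl_vec (refl_vec p) = p"
  by (intro eq_vecI) auto

lemma refl_vec_add:
  "p \<in> carrier_vec m \<Longrightarrow> q \<in> carrier_vec m \<Longrightarrow> refl_vec (p + q) = refl_vec p + refl_vec q"
  by (intro eq_vecI) auto

lemma refl_vec_minus:
  "p \<in> carrier_vec m \<Longrightarrow> q \<in> carrier_vec m \<Longrightarrow> refl_vec (p - q) = refl_vec p - refl_vec q"
  by (intro eq_vecI) auto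

lemma refl_vec_smult: "refl_vec (r \<cdot>\<^sub>v p) = r \<cdot>\<^sub>v refl_vec p"
  by (intro eq_vecI) auto

lemma refl_vec_uminus: "refl_vec (- p) = - refl_vec p"
  by (intro eq_vecI) auto

lemma scalar_prod_sum: "v \<in> carrier_vec m \<Longrightarrow> w \<in> carrier_vec m \<Longrightarrow> v \<bullet>\<^sub>v w = (\<Sum>i<m. v $ i * w $ i)"
  by (auto simp: scalar_prod_def lessThan_atLeast0)

lemma sum_reflect: "(\<Sum>i<m. f (m - 1 - i)) = (\<Sum>i<m. f i)" for f :: "nat \<Rightarrow> real"
  using sum.nat_diff_reindex[of f m] by simp

lemma scalar_prod_refl_refl:
  assumes "v \<in> carrier_vec m" "w \<in> carrier_vec m"
  shows "refl_vec v \<bullet>\<^sub>v refl_vec w = v \<bullet>\<^sub>v w"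
proof -
  have "refl_vec v \<bullet>\<^sub>v refl_vec w = (\<Sum>i<m. v $ (m - 1 - i) * w $ (m - 1 - i))"
    using assms by (subst scalar_prod_sum[of _ m]) auto
  also have "\<dots> = (\<Sum>i<m. v $ i * w $ i)" by (rule sum_reflect)
  finally show ?thesis using assms by (simp add: scalar_prod_sum)
qed

lemma scalar_prod_refl_left:
  "v \<in> carrier_vec m \<Longrightarrow> w \<in> carrier_vec m \<Longrightarrow> refl_vec v \<bullet>\<^sub>v w = v \<bullet>\<^sub>v refl_vec w"
  using scalar_prod_refl_refl[of v m "refl_vec w"] by simp

lemma even_part_carrier [simp, intro]: "p \<in> carrier_vec m \<Longrightarrow> even_part p \<in> carrier_vec m"
  by (simp add: even_part_def)

lemma odd_part_carrier [simp, intro]: "p \<in> carrier_vec m \<Longrightarrow> odd_part p \<in> carrier_vec m"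
  by (simp add: odd_part_def)

lemma index_even_part:
  "p \<in> carrier_vec m \<Longrightarrow> i < m \<Longrightarrow> even_part p $ i = (p $ i + p $ (m - 1 - i)) / 2"
  by (auto simp: even_part_def)

lemma index_odd_part:
  "p \<in> carrier_vec m \<Longrightarrow> i < m \<Longrightarrow> odd_part p $ i = (p $ i - p $ (m - 1 - i)) / 2"
  by (auto simp: odd_part_def)

lemma even_part_scalar_prod:
  assumes "v \<in> carrier_vec m" "w \<in> carrier_vec m"
  shows "even_part v \<bullet>\<^sub>v w = (v \<bullet>\<^sub>v w + v \<bullet>\<^sub>v refl_vec w) / 2"
  using assms
  by (simp add: even_part_def add_scalar_prod_distrib[of _ m] scalar_prod_refl_left[of _ m])

lemma odd_part_scalar_prod:
  assumes "v \<in> carrier_vec m" "w \<in> carrier_vec m"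
  shows "odd_part v \<bullet>\<^sub>v w = (v \<bullet>\<^sub>v w - v \<bullet>\<^sub>v refl_vec w) / 2"
  using assms
  by (simp add: odd_part_def minus_scalar_prod_distrib[of _ m] scalar_prod_refl_left[of _ m])

lemma refl_vec_even_part [simp]: "refl_vec (even_part v) = even_part v"
  by (intro eq_vecI) (auto simp: even_part_def field_simps)

lemma refl_vec_odd_part [simp]: "refl_vec (odd_part v) = - odd_part v"
  by (intro eq_vecI) (auto simp: odd_part_def field_simps)

lemma even_part_scalar_prod_even_part:
  assumes "v \<in> carrier_vec m" "w \<in> carrier_vec m"
  shows "even_part v \<bullet>\<^sub>v even_part w = (v \<bullet>\<^sub>v w + v \<bullet>\<^sub>v refl_vec w) / 2"
  using assms
  by (simp add: even_part_scalar_prod[of _ m])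
     (simp add: even_part_def scalar_prod_add_distrib[of _ m])

lemma odd_part_scalar_prod_odd_part:
  assumes "v \<in> carrier_vec m" "w \<in> carrier_vec m"
  shows "odd_part v \<bullet>\<^sub>v odd_part w = (v \<bullet>\<^sub>v w - v \<bullet>\<^sub>v refl_vec w) / 2"
  using assms
  by (simp add: odd_part_scalar_prod[of _ m])
     (simp add: odd_part_def scalar_prod_minus_distrib[of _ m])

lemma neg_refl_pow_0 [simp]: "neg_refl_pow 0 v = v"
  by (simp add: neg_refl_pow_def)

lemma neg_refl_pow_Suc: "neg_refl_pow (Suc j) v = - refl_vec (neg_refl_pow j v)"
  by (simp add: neg_refl_pow_def)

lemma neg_refl_pow_eq: "neg_refl_pow j v = (if even j then v else - refl_vec v)"
  by (induction j) (auto simp: neg_refl_pow_Suc refl_vec_uminus)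

lemma dim_neg_refl_pow [simp]: "dim_vec (neg_refl_pow j v) = dim_vec v"
  by (simp add: neg_refl_pow_eq)

lemma neg_refl_pow_carrier [simp, intro]:
  "v \<in> carrier_vec m \<Longrightarrow> neg_refl_pow j v \<in> carrier_vec m"
  by (simp add: neg_refl_pow_eq)

text \<open>The map \<open>-P\<close> is symmetric, hence so are its powers. This moves the
  alternating reflections of \<open>s_0\<close> onto the other factor of an inner product.\<close>

lemma scalar_prod_neg_refl_pow:
  assumes "v \<in> carrier_vec m" "w \<in> carrier_vec m"
  shows "v \<bullet>\<^sub>v neg_refl_pow j w = neg_refl_pow j v \<bullet>\<^sub>v w"
  using assms by (auto simp: neg_refl_pow_eq scalar_prod_refl_left)

text \<open>Reflection swaps the two coefficients, so the even part sees their sum and, in the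
  companion lemma, the odd part their difference.\<close>

lemma even_part_wave:
  assumes "q \<in> carrier_vec m"
  shows "even_part (a \<cdot>\<^sub>v q + b \<cdot>\<^sub>v refl_vec q) = (a + b) \<cdot>\<^sub>v even_part q"
proof -
  have "refl_vec (a \<cdot>\<^sub>v q + b \<cdot>\<^sub>v refl_vec q) = a \<cdot>\<^sub>v refl_vec q + b \<cdot>\<^sub>v q"
    using assms by (simp add: refl_vec_add[of _ m] refl_vec_smult)
  then show ?thesis
    unfolding even_part_def by (intro eq_vecI) (auto simp: field_simps)
qed

lemma odd_part_wave:
  assumes "q \<in> carrier_vec m"
  shows "odd_part (a \<cdot>\<^sub>v q + b \<cdot>\<^sub>v refl_vec q) = (a - b) \<cdot>\<^sub>v odd_part q"
proof -
  have "refl_vec (a \<cdot>\<^sub>v q + b \<cdot>\<^sub>v refl_vec q) = a \<cdot>\<^sub>v refl_vec q + b \<cdot>\<^sub>v q"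
    using assms by (simp add: refl_vec_add[of _ m] refl_vec_smult)
  then show ?thesis
    unfolding odd_part_def by (intro eq_vecI) (auto simp: field_simps)
qed

subsection \<open>Symmetric and centrosymmetric matrices\<close>

text \<open>The second condition is commutation with the index reversal. The entrywise form can be
  read off from the integrals that define the local matrices and passes directly to the interior
  block.\<close>

definition bisymmetric :: "nat \<Rightarrow> real mat \<Rightarrow> bool" where
  "bisymmetric m M \<longleftrightarrow> M \<in> carrier_mat m m \<and>
     (\<forall>i<m. \<forall>j<m. M $$ (i, j) = M $$ (j, i) \<and> M $$ (m - 1 - i, m - 1 - j) = M $$ (i, j))"

lemma bisymmetric_carrier: "bisymmetric m M \<Longrightarrow> M \<in> carrier_mat m m"
  by (simp add: bisymmetric_def)

lemma bisymmetric_scalar_prod: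
  assumes "bisymmetric m M" "v \<in> carrier_vec m" "w \<in> carrier_vec m"
  shows "(M *\<^sub>v v) \<bullet>\<^sub>v w = v \<bullet>\<^sub>v (M *\<^sub>v w)"
proof -
  have M: "M \<in> carrier_mat m m" using assms by (simp add: bisymmetric_def)
  have "transpose_mat M = M"
    using assms(1) by (intro eq_matI) (auto simp: bisymmetric_def)
  then show ?thesis
    using transpose_vec_mult_scalar[OF M assms(3,2)] by simp
qed

lemma index_mult_mat_vec_sum:
  "M \<in> carrier_mat m m \<Longrightarrow> v \<in> carrier_vec m \<Longrightarrow> i < m \<Longrightarrow>
    (M *\<^sub>v v) $ i = (\<Sum>j<m. M $$ (i, j) * v $ j)" for M :: "real mat"
  by (simp add: scalar_prod_sum[of _ m])

text \<open>Reversing the order of summation moves the reflection from the vector to the columns of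
  \<open>M\<close>; central symmetry moves it on to the row index.\<close>

lemma bisymmetric_refl:
  assumes "bisymmetric m M" "v \<in> carrier_vec m"
  shows "M *\<^sub>v refl_vec v = refl_vec (M *\<^sub>v v)"
proof (rule eq_vecI)
  have M: "M \<in> carrier_mat m m" using assms by (simp add: bisymmetric_def)
  show "dim_vec (M *\<^sub>v refl_vec v) = dim_vec (refl_vec (M *\<^sub>v v))" by simp
  fix i assume "i < dim_vec (refl_vec (M *\<^sub>v v))"
  then have i: "i < m" using M by simp
  have c: "M $$ (m - 1 - i, m - 1 - j) = M $$ (i, j)" if "j < m" for j
    using assms(1) i that by (auto simp: bisymmetric_def)
  have "(M *\<^sub>v refl_vec v) $ i = (\<Sum>j<m. M $$ (i, j) * v $ (m - 1 - j))"
    using M i assms(2) by (simp add: index_mult_mat_vec_sum del: index_mult_mat_vec)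
  also have "\<dots> = (\<Sum>j<m. M $$ (m - 1 - i, m - 1 - j) * v $ (m - 1 - j))"
    using c by (intro sum.cong) auto
  also have "\<dots> = (\<Sum>j<m. M $$ (m - 1 - i, j) * v $ j)"
    by (rule sum_reflect)
  also have "\<dots> = (M *\<^sub>v v) $ (m - 1 - i)"
    using M i assms(2) by (simp add: index_mult_mat_vec_sum del: index_mult_mat_vec)
  also have "\<dots> = refl_vec (M *\<^sub>v v) $ i" using M i by simp
  finally show "(M *\<^sub>v refl_vec v) $ i = refl_vec (M *\<^sub>v v) $ i" .
qed

lemma bisymmetric_neg_refl_pow:
  assumes "bisymmetric m M" "v \<in> carrier_vec m"
  shows "M *\<^sub>v neg_refl_pow j v = neg_refl_pow j (M *\<^sub>v v)"
proof -
  have "M *\<^sub>v - refl_vec v = - refl_vec (M *\<^sub>v v)"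
    unfolding bisymmetric_refl[OF assms, symmetric]
    using assms bisymmetric_carrier[OF assms(1)] by (intro eq_vecI) auto
  then show ?thesis by (simp add: neg_refl_pow_eq)
qed

text \<open>Deleting the outer rows and columns keeps the centre of symmetry.\<close>

lemma bisymmetric_blk_mat:
  assumes "bisymmetric (n + 1) M"
  shows "bisymmetric (n - 1) (blk_mat n M)"
proof -
  have "M $$ (i + 1, j + 1) = M $$ (j + 1, i + 1) \<and>
        M $$ (n - 1 - 1 - i + 1, n - 1 - 1 - j + 1) = M $$ (i + 1, j + 1)"
    if "i < n - 1" "j < n - 1" for i j
  proof -
    \<comment> \<open>Reversal of the interior indices, shifted by one, is reversal of the full
      index range.\<close>
    have "n - 1 - 1 - i + 1 = n + 1 - 1 - (i + 1)" "n - 1 - 1 - j + 1 = n + 1 - 1 - (j + 1)"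
      using that by auto
    moreover have "i + 1 < n + 1" "j + 1 < n + 1" using that by auto
    ultimately show ?thesis using assms unfolding bisymmetric_def by metis
  qed
  then show ?thesis by (auto simp: bisymmetric_def blk_mat_def)
qed

subsection \<open>The local matrices\<close>

lemma lagrange_props:
  assumes "n \<ge> 1" "l \<le> n"
  shows "degree (lagrange n l) \<le> n"
    and "k \<le> n \<Longrightarrow> poly (lagrange n l) (lag_node n k) = (if k = l then 1 else 0)"
  using theI'[OF lagrange_ex1[OF assms]] unfolding lagrange_def by auto

lemma lag_node_reflect: "n \<ge> 1 \<Longrightarrow> k \<le> n \<Longrightarrow> lag_node n (n - k) = - lag_node n k"
  by (simp add: lag_node_def of_nat_diff field_simps)

text \<open>The nodes are symmetric about 0, so the reflected basis polynomial has the values that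
  determine its mirror image uniquely.\<close>

lemma lagrange_reflect:
  assumes "n \<ge> 1" "l \<le> n"
  shows "lagrange n (n - l) = pcompose (lagrange n l) [:0, -1:]"
proof -
  let ?p = "pcompose (lagrange n l) [:0, -1:]"
  have "degree ?p \<le> n" using lagrange_props(1)[OF assms] by (simp add: degree_pcompose)
  moreover have "poly ?p (lag_node n k) = (if k = n - l then 1 else 0)" if "k \<le> n" for k
  proof -
    have "poly ?p (lag_node n k) = poly (lagrange n l) (lag_node n (n - k))"
      using lag_node_reflect[of n k] assms that by (simp add: poly_pcompose)
    also have "\<dots> = (if n - k = l then 1 else 0)" using lagrange_props(2)[OF assms] by simp
    finally show ?thesis using that assms by auto
  qed
  ultimately show ?thesis
    using lagrange_ex1[of n "n - l"] lagrange_props[of n "n - l"] assms by (metis diff_le_self)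
qed

text \<open>Central symmetry is the substitution of \<open>-x\<close> for \<open>x\<close> on the
  symmetric interval.\<close>

lemma mass_mat_bisymmetric:
  assumes "n \<ge> 1"
  shows "bisymmetric (n + 1) (mass_mat n)"
proof -
  have "integral {-1..1} (\<lambda>x. poly (lagrange n (n - k)) x * poly (lagrange n (n - l)) x) =
        integral {-1..1} (\<lambda>x. poly (lagrange n k) x * poly (lagrange n l) x)"
    if "k \<le> n" "l \<le> n" for k l
    using Henstock_Kurzweil_Integration.integral_reflect_real[of 1 "-1" "\<lambda>x. poly (lagrange n k) x * poly (lagrange n l) x"]
      assms that by (simp add: lagrange_reflect poly_pcompose)
  then show ?thesis by (auto simp: bisymmetric_def mass_mat_def mult.commute)
qed

text \<open>As for the mass matrix; each derivative of a reflected polynomial contributes a factor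
  -1, and the two factors cancel.\<close>

lemma stiff_mat_bisymmetric:
  assumes "n \<ge> 1"
  shows "bisymmetric (n + 1) (stiff_mat n)"
proof -
  have "integral {-1..1} (\<lambda>x. poly (pderiv (lagrange n (n - k))) x * poly (pderiv (lagrange n (n - l))) x) =
        integral {-1..1} (\<lambda>x. poly (pderiv (lagrange n k)) x * poly (pderiv (lagrange n l)) x)"
    if "k \<le> n" "l \<le> n" for k l
    using Henstock_Kurzweil_Integration.integral_reflect_real[of 1 "-1"
        "\<lambda>x. poly (pderiv (lagrange n k)) x * poly (pderiv (lagrange n l)) x"]
      assms that by (simp add: lagrange_reflect pderiv_pcompose poly_pcompose pderiv_pCons)
  then show ?thesis by (auto simp: bisymmetric_def stiff_mat_def mult.commute)
qed

text \<open>The mass matrix is a Gram matrix: its quadratic form is the integral of the square of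
  the polynomial \<open>r\<close> with nodal values \<open>x\<close>. At the left end
  \<open>r\<close> equals \<open>x 0\<close>, so the continuous nonnegative integrand does not
  vanish identically. The vectors to which this is applied have first entry 1.\<close>

lemma mass_mat_pos:
  fixes x :: "nat \<Rightarrow> real"
  assumes "n \<ge> 1" "x 0 \<noteq> 0"
  shows "(\<Sum>k\<le>n. \<Sum>l\<le>n. x k * x l * mass_mat n $$ (k, l)) > 0"
proof -
  define r where "r = (\<Sum>k\<le>n. Polynomial.smult (x k) (lagrange n k))"
  have pr: "poly r t = (\<Sum>k\<le>n. x k * poly (lagrange n k) t)" for t
    by (simp add: r_def poly_sum)
  have "(\<Sum>k\<le>n. \<Sum>l\<le>n. x k * x l * mass_mat n $$ (k, l)) =
    (\<Sum>k\<le>n. \<Sum>l\<le>n. integral {-1..1} (\<lambda>t. x k * x l * (poly (lagrange n k) t * poly (lagrange n l) t)))"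
    by (intro sum.cong refl) (simp add: mass_mat_def)
  also have "\<dots> = integral {-1..1} (\<lambda>t. \<Sum>k\<le>n. \<Sum>l\<le>n. x k * x l * (poly (lagrange n k) t * poly (lagrange n l) t))"
    by (subst integral_sum; (subst integral_sum)?)
       (auto intro!: integrable_sum integrable_continuous_real continuous_intros)
  also have "(\<lambda>t. \<Sum>k\<le>n. \<Sum>l\<le>n. x k * x l * (poly (lagrange n k) t * poly (lagrange n l) t)) =
      (\<lambda>t. (poly r t)\<^sup>2)"
    by (simp add: pr power2_eq_square sum_product algebra_simps)
  finally have eq: "(\<Sum>k\<le>n. \<Sum>l\<le>n. x k * x l * mass_mat n $$ (k, l)) =
      integral {-1..1} (\<lambda>t. (poly r t)\<^sup>2)" .
  have ir: "(\<lambda>t. (poly r t)\<^sup>2) integrable_on {-1..1}"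
    by (intro integrable_continuous_real continuous_intros)
  \<comment> \<open>The point -1 is node 0, where only the basis polynomial of index 0 is
    nonzero.\<close>
  have "poly r (-1) = (\<Sum>k\<le>n. x k * (if k = 0 then 1 else 0))"
    unfolding pr using assms lagrange_props(2)[of n _ 0]
    by (intro sum.cong refl) (auto simp: lag_node_def)
  then have "poly r (-1) \<noteq> 0" using assms by (simp add: if_distrib cong: if_cong)
  moreover have "poly r (-1) = 0" if "integral {-1..1} (\<lambda>t. (poly r t)\<^sup>2) = 0"
  proof -
    have "((\<lambda>t. (poly r t)\<^sup>2) has_integral 0) (cbox (-1) 1)"
      using ir that by (metis box_real(2) has_integral_integral)
    then have "(poly r (-1))\<^sup>2 = 0"
      by (rule has_integral_0_cbox_imp_0[rotated 2]) (auto intro!: continuous_intros)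
    then show ?thesis by simp
  qed
  moreover have "integral {-1..1} (\<lambda>t. (poly r t)\<^sup>2) \<ge> 0"
    by (intro integral_nonneg ir) auto
  ultimately show ?thesis unfolding eq by linarith
qed

declare One_nat_def [simp del]

lemma blk_vec_carrier [simp, intro]: "blk_vec n M \<in> carrier_vec (n - 1)"
  by (simp add: blk_vec_def)

lemma blk_mat_carrier [simp, intro]: "blk_mat n M \<in> carrier_mat (n - 1) (n - 1)"
  by (simp add: blk_mat_def)

lemma dim_blk [simp]:
  "dim_vec (blk_vec n M) = n - 1" "dim_row (blk_mat n M) = n - 1" "dim_col (blk_mat n M) = n - 1"
  by (simp_all add: blk_vec_def blk_mat_def)

section \<open>Block expansion of local quadratic forms\<close>

lemma sum_atMost_ends:
  fixes f :: "nat \<Rightarrow> real"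
  assumes "n \<ge> 1"
  shows "(\<Sum>k\<le>n. f k) = f 0 + (\<Sum>i<n - 1. f (Suc i)) + f n"
proof -
  obtain m where m: "n = Suc m" using assms by (cases n) auto
  have "(\<Sum>k\<le>n. f k) = f 0 + (\<Sum>i\<le>m. f (Suc i))"
    unfolding m by (rule sum.atMost_Suc_shift)
  then show ?thesis by (simp add: m lessThan_Suc_atMost[symmetric])
qed

text \<open>The vector is \<open>(u, z, v)\<close>. By central symmetry the last column of
  \<open>M\<close> is the first one reversed, so the blocks \<open>c\<close>, its reflection, and
  the interior matrix account for all entries.\<close>

lemma block_quadratic_form:
  assumes n: "n \<ge> 1" and M: "bisymmetric (n + 1) M" and z: "z \<in> carrier_vec (n - 1)"
    and x: "x 0 = u" "x n = v" "\<And>i. i < n - 1 \<Longrightarrow> x (Suc i) = z $ i"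
  defines "c \<equiv> blk_vec n M"
  shows "(\<Sum>k\<le>n. \<Sum>l\<le>n. x k * x l * M $$ (k, l)) =
    (u\<^sup>2 + v\<^sup>2) * blk_0 M + 2 * u * v * blk_n n M + 2 * u * (c \<bullet>\<^sub>v z)
      + 2 * v * (refl_vec c \<bullet>\<^sub>v z) + (blk_mat n M *\<^sub>v z) \<bullet>\<^sub>v z"
proof -
  have sym: "M $$ (k, l) = M $$ (l, k)" if "k \<le> n" "l \<le> n" for k l
    using M that by (auto simp: bisymmetric_def)
  have cen: "M $$ (n - k, n - l) = M $$ (k, l)" if "k \<le> n" "l \<le> n" for k l
    using M that by (auto simp: bisymmetric_def)
  have c: "c \<in> carrier_vec (n - 1)" by (simp add: c_def)
  have c_ind: "c $ i = M $$ (Suc i, 0)" if "i < n - 1" for i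
    using that by (simp add: c_def blk_vec_def Suc_eq_plus1)
  have rc_ind: "refl_vec c $ i = M $$ (Suc i, n)" if "i < n - 1" for i
  proof -
    have "refl_vec c $ i = M $$ (n - Suc i, n - n)"
      using that c by (simp add: c_ind)
        (metis Suc_diff_Suc diff_diff_left diff_is_0_eq nat_le_linear not_less plus_1_eq_Suc)
    also have "\<dots> = M $$ (Suc i, n)" using that by (intro cen) auto
    finally show ?thesis .
  qed
  \<comment> \<open>\<open>R k\<close> is component \<open>k\<close> of the product of
    \<open>M\<close> with \<open>x\<close>; the two end components and the interior ones are
    computed separately.\<close>
  define R where "R k = (\<Sum>l\<le>n. x l * M $$ (k, l))" for k
  have R: "R k = u * M $$ (k, 0) + (\<Sum>i<n - 1. z $ i * M $$ (k, Suc i)) + v * M $$ (k, n)" for k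
    unfolding R_def using sum_atMost_ends[OF n, of "\<lambda>l. x l * M $$ (k, l)"] x by simp
  have s1: "(\<Sum>i<n - 1. z $ i * M $$ (0, Suc i)) = c \<bullet>\<^sub>v z"
    unfolding scalar_prod_sum[OF c z]
    by (intro sum.cong refl) (use sym[of 0] in \<open>auto simp: c_ind\<close>)
  have s2: "(\<Sum>i<n - 1. z $ i * M $$ (n, Suc i)) = refl_vec c \<bullet>\<^sub>v z"
    unfolding scalar_prod_sum[OF refl_vec_carrier[OF c] z]
    by (intro sum.cong refl) (use sym[of n] in \<open>auto simp: rc_ind\<close>)
  have s3: "(\<Sum>j<n - 1. z $ j * M $$ (Suc i, Suc j)) = (blk_mat n M *\<^sub>v z) $ i" if "i < n - 1" for i
    using that z by (subst index_mult_mat_vec_sum[of _ "n - 1"]) (auto simp: blk_mat_def Suc_eq_plus1 mult.commute)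
  have R0: "R 0 = u * blk_0 M + c \<bullet>\<^sub>v z + v * blk_n n M"
    by (simp add: R s1 blk_0_def blk_n_def)
  have Rn: "R n = u * blk_n n M + refl_vec c \<bullet>\<^sub>v z + v * blk_0 M"
    using sym[of n 0] cen[of 0 0] by (simp add: R s2 blk_0_def blk_n_def)
  have Ri: "R (Suc i) = u * c $ i + (blk_mat n M *\<^sub>v z) $ i + v * refl_vec c $ i" if "i < n - 1" for i
    using that by (simp add: R s3 c_ind rc_ind)
  have "(\<Sum>k\<le>n. \<Sum>l\<le>n. x k * x l * M $$ (k, l)) = (\<Sum>k\<le>n. x k * R k)"
    by (simp add: R_def sum_distrib_left mult.assoc)
  also have "\<dots> = u * R 0 + (\<Sum>i<n - 1. z $ i * R (Suc i)) + v * R n"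
    using sum_atMost_ends[OF n, of "\<lambda>k. x k * R k"] x by simp
  also have "(\<Sum>i<n - 1. z $ i * R (Suc i)) =
      (\<Sum>i<n - 1. u * (c $ i * z $ i) + (blk_mat n M *\<^sub>v z) $ i * z $ i + v * (refl_vec c $ i * z $ i))"
    by (intro sum.cong refl) (simp add: Ri algebra_simps)
  also have "\<dots> = u * (c \<bullet>\<^sub>v z) + (blk_mat n M *\<^sub>v z) \<bullet>\<^sub>v z + v * (refl_vec c \<bullet>\<^sub>v z)"
    using c z mult_mat_vec_carrier[OF blk_mat_carrier z, of M]
    by (simp add: sum.distrib sum_distrib_left[symmetric] scalar_prod_sum[of _ "n - 1"]
        del: index_mult_mat_vec index_refl_vec)
  finally show ?thesis unfolding R0 Rn by (simp add: algebra_simps power2_eq_square)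
qed

text \<open>
  Up to the factor \<open>K\<close>, the value of the global bilinear form built from \<open>M\<close> at two vectors
  of type \<open>s\<^sub>k\<close> with the same \<open>k\<close> and with cell profiles \<open>p\<close> and \<open>q\<close>, where \<open>\<theta> = \<theta>\<^sub>k\<close>.
\<close>

definition bloch_form :: "nat \<Rightarrow> real mat \<Rightarrow> real \<Rightarrow> real vec \<Rightarrow> real vec \<Rightarrow> real" where
  "bloch_form n M \<theta> p q =
     blk_0 M + blk_vec n M \<bullet>\<^sub>v p + blk_vec n M \<bullet>\<^sub>v q + (blk_mat n M *\<^sub>v p) \<bullet>\<^sub>v q
     + \<theta> * (blk_n n M + blk_vec n M \<bullet>\<^sub>v refl_vec p + blk_vec n M \<bullet>\<^sub>v refl_vec q
            + (blk_mat n M *\<^sub>v p) \<bullet>\<^sub>v refl_vec q)"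

text \<open>The term with \<theta> is where central symmetry is used: the reflection on
  \<open>q\<close> commutes with the interior matrix and can then be moved to
  \<open>p\<close>.\<close>

lemma bloch_form_sym:
  assumes M: "bisymmetric (n + 1) M" and p: "p \<in> carrier_vec (n - 1)" and q: "q \<in> carrier_vec (n - 1)"
  shows "bloch_form n M \<theta> p q = bloch_form n M \<theta> q p"
proof -
  note B = bisymmetric_blk_mat[OF M]
  have "(blk_mat n M *\<^sub>v p) \<bullet>\<^sub>v q' = (blk_mat n M *\<^sub>v q') \<bullet>\<^sub>v p" if "q' \<in> carrier_vec (n - 1)" for q'
    using bisymmetric_scalar_prod[OF B p that] comm_scalar_prod[OF p, of "blk_mat n M *\<^sub>v q'"] that
    by (metis blk_mat_carrier mult_mat_vec_carrier)
  then have "(blk_mat n M *\<^sub>v p) \<bullet>\<^sub>v q = (blk_mat n M *\<^sub>v q) \<bullet>\<^sub>v p"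
    "(blk_mat n M *\<^sub>v p) \<bullet>\<^sub>v refl_vec q = (blk_mat n M *\<^sub>v refl_vec q) \<bullet>\<^sub>v p"
    using q by auto
  moreover have "(blk_mat n M *\<^sub>v refl_vec q) \<bullet>\<^sub>v p = (blk_mat n M *\<^sub>v q) \<bullet>\<^sub>v refl_vec p"
    using bisymmetric_refl[OF B q] p q
    by (simp add: scalar_prod_refl_left[of _ "n - 1"] mult_mat_vec_carrier[OF blk_mat_carrier])
  ultimately show ?thesis by (simp add: bloch_form_def algebra_simps)
qed

text \<open>
  The form is affine in \<open>\<theta>\<close>, and for \<open>\<theta> = \<plusminus>1\<close> it is half the value of the local mass form at
  the vector \<open>(1, p \<plusminus> Pp, \<plusminus>1)\<close>.
\<close>

lemma bloch_form_mass_pos: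
  assumes n: "n \<ge> 1" and p: "p \<in> carrier_vec (n - 1)" and \<theta>: "\<bar>\<theta>\<bar> \<le> 1"
  shows "bloch_form n (mass_mat n) \<theta> p p > 0"
proof -
  define c where "c = blk_vec n (mass_mat n)"
  define Ct where "Ct = blk_mat n (mass_mat n)"
  \<comment> \<open>The form at \<open>p, p\<close> is \<open>X + \<theta> * Y\<close>; the sign
    \<sigma> below stands for the two extreme values of \<theta>.\<close>
  define X where "X = blk_0 (mass_mat n) + 2 * (c \<bullet>\<^sub>v p) + (Ct *\<^sub>v p) \<bullet>\<^sub>v p"
  define Y where "Y = blk_n n (mass_mat n) + 2 * (c \<bullet>\<^sub>v refl_vec p) + (Ct *\<^sub>v p) \<bullet>\<^sub>v refl_vec p"
  note M = mass_mat_bisymmetric[OF n]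
  note B = bisymmetric_blk_mat[OF M]
  have c: "c \<in> carrier_vec (n - 1)" by (simp add: c_def)
  have Ct: "Ct \<in> carrier_mat (n - 1) (n - 1)" by (simp add: Ct_def)
  have Cp: "Ct *\<^sub>v p \<in> carrier_vec (n - 1)" using mult_mat_vec_carrier[OF Ct p] .
  have CP: "Ct *\<^sub>v refl_vec p = refl_vec (Ct *\<^sub>v p)"
    unfolding Ct_def by (rule bisymmetric_refl[OF B p])
  have pos: "X + \<sigma> * Y > 0" if \<sigma>: "\<sigma>\<^sup>2 = 1" for \<sigma> :: real
  proof -
    define z where "z = p + \<sigma> \<cdot>\<^sub>v refl_vec p"
    have z: "z \<in> carrier_vec (n - 1)" using p by (simp add: z_def)
    define x where "x k = (if k = 0 then 1 else if k = n then \<sigma> else z $ (k - 1))" for k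
    have x: "x 0 = 1" "x n = \<sigma>" "\<And>i. i < n - 1 \<Longrightarrow> x (Suc i) = z $ i"
      using n by (auto simp: x_def)
    have ss: "\<sigma> * \<sigma> = 1" "\<And>y. \<sigma> * (\<sigma> * y) = y"
      using \<sigma> by (auto simp: power2_eq_square mult.assoc[symmetric])
    have "0 < (\<Sum>k\<le>n. \<Sum>l\<le>n. x k * x l * mass_mat n $$ (k, l))"
      using x by (intro mass_mat_pos n) auto
    also have "\<dots> = (1\<^sup>2 + \<sigma>\<^sup>2) * blk_0 (mass_mat n) + 2 * 1 * \<sigma> * blk_n n (mass_mat n)
        + 2 * 1 * (c \<bullet>\<^sub>v z) + 2 * \<sigma> * (refl_vec c \<bullet>\<^sub>v z) + (Ct *\<^sub>v z) \<bullet>\<^sub>v z"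
      unfolding c_def Ct_def by (rule block_quadratic_form[OF n M z x])
    also have "c \<bullet>\<^sub>v z = c \<bullet>\<^sub>v p + \<sigma> * (c \<bullet>\<^sub>v refl_vec p)"
      using c p by (simp add: z_def scalar_prod_add_distrib[of _ "n - 1"])
    also have "refl_vec c \<bullet>\<^sub>v z = c \<bullet>\<^sub>v refl_vec p + \<sigma> * (c \<bullet>\<^sub>v p)"
      using c p by (simp add: z_def scalar_prod_add_distrib[of _ "n - 1"] scalar_prod_refl_left[of _ "n - 1"])
    also have "Ct *\<^sub>v z = Ct *\<^sub>v p + \<sigma> \<cdot>\<^sub>v refl_vec (Ct *\<^sub>v p)"
      using p CP by (simp add: z_def mult_add_distrib_mat_vec[OF Ct] mult_mat_vec[OF Ct])
    also have "(Ct *\<^sub>v p + \<sigma> \<cdot>\<^sub>v refl_vec (Ct *\<^sub>v p)) \<bullet>\<^sub>v z =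
        2 * ((Ct *\<^sub>v p) \<bullet>\<^sub>v p) + 2 * \<sigma> * ((Ct *\<^sub>v p) \<bullet>\<^sub>v refl_vec p)"
      using p Cp ss by (simp add: z_def smult_scalar_prod_distrib[of _ "n - 1"]
          scalar_prod_smult_distrib[of _ "n - 1"] scalar_prod_add_distrib[of _ "n - 1"]
          add_scalar_prod_distrib[of _ "n - 1"] scalar_prod_refl_left[of _ "n - 1"] algebra_simps)
    finally show ?thesis using ss \<sigma> by (simp add: X_def Y_def algebra_simps)
  qed
  have "X + Y > 0" "X - Y > 0" using pos[of 1] pos[of "-1"] by auto
  then have "X > \<bar>Y\<bar>" by linarith
  moreover have "\<bar>\<theta> * Y\<bar> \<le> \<bar>Y\<bar>" using \<theta> by (simp add: abs_mult mult_left_le_one_le)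
  ultimately have "X + \<theta> * Y > 0" by linarith
  then show ?thesis by (simp add: bloch_form_def X_def Y_def c_def Ct_def add_ac)
qed

section \<open>Solving the cell equations; the dispersion equation\<close>

lemma mat_inverse_mult_vec:
  fixes G :: "real mat"
  assumes G: "G \<in> carrier_mat m m" and inj: "\<And>v. v \<in> carrier_vec m \<Longrightarrow> G *\<^sub>v v = 0\<^sub>v m \<Longrightarrow> v = 0\<^sub>v m"
    and g: "g \<in> carrier_vec m"
  shows "the (mat_inverse G) *\<^sub>v g \<in> carrier_vec m" "G *\<^sub>v (the (mat_inverse G) *\<^sub>v g) = g"
proof -
  \<comment> \<open>A trivial kernel gives a nonzero determinant, which guarantees that
    \<open>mat_inverse\<close> returns \<open>Some\<close> matrix.\<close>
  have "det G \<noteq> 0" using det_0_iff_vec_prod_zero_field[OF G] inj by auto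
  then have "G \<in> Units (ring_mat TYPE(real) m undefined)" by (rule det_non_zero_imp_unit[OF G])
  then obtain B where B: "mat_inverse G = Some B"
    using mat_inverse(1)[OF G, where b = undefined] by (cases "mat_inverse G") auto
  note B' = mat_inverse(2)[OF G B]
  show "the (mat_inverse G) *\<^sub>v g \<in> carrier_vec m"
    using B B' g by (auto intro: mult_mat_vec_carrier)
  show "G *\<^sub>v (the (mat_inverse G) *\<^sub>v g) = g"
    using B B' g G by (simp add: assoc_mult_mat_vec[symmetric, of _ m m _ m])
qed

lemma pencil_mult_vec:
  fixes A C :: "real mat"
  assumes "A \<in> carrier_mat m m" "C \<in> carrier_mat m m" "v \<in> carrier_vec m"
  shows "(A - \<mu> \<cdot>\<^sub>m C) *\<^sub>v v = A *\<^sub>v v - \<mu> \<cdot>\<^sub>v (C *\<^sub>v v)"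
proof -
  have "(\<mu> \<cdot>\<^sub>m C) *\<^sub>v v = \<mu> \<cdot>\<^sub>v (C *\<^sub>v v)"
    using assms by (intro eq_vecI) auto
  then show ?thesis
    using assms by (simp add: minus_mult_distrib_mat_vec[of _ m m])
qed

text \<open>A nonzero kernel vector would be an eigenvector of the interior problem with eigenvalue
  \<mu>.\<close>

lemma G_mat_kernel:
  assumes \<mu>: "\<mu> \<notin> spec_int n" and v: "v \<in> carrier_vec (n - 1)" and 0: "G_mat n \<mu> *\<^sub>v v = 0\<^sub>v (n - 1)"
  shows "v = 0\<^sub>v (n - 1)"
proof (rule ccontr)
  assume "v \<noteq> 0\<^sub>v (n - 1)"
  let ?A = "blk_mat n (stiff_mat n)" and ?C = "blk_mat n (mass_mat n)"
  have Av: "?A *\<^sub>v v \<in> carrier_vec (n - 1)" and Cv: "?C *\<^sub>v v \<in> carrier_vec (n - 1)"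
    using v by (auto intro: mult_mat_vec_carrier)
  have "G_mat n \<mu> *\<^sub>v v = ?A *\<^sub>v v - \<mu> \<cdot>\<^sub>v (?C *\<^sub>v v)"
    unfolding G_mat_def using v by (intro pencil_mult_vec[of _ "n - 1"]) auto
  then have eq: "?A *\<^sub>v v - \<mu> \<cdot>\<^sub>v (?C *\<^sub>v v) = 0\<^sub>v (n - 1)" using 0 by simp
  have "?A *\<^sub>v v = \<mu> \<cdot>\<^sub>v (?C *\<^sub>v v)"
  proof (rule eq_vecI)
    fix i assume "i < dim_vec (\<mu> \<cdot>\<^sub>v (?C *\<^sub>v v))"
    then have "i < n - 1" using Cv by simp
    then show "(?A *\<^sub>v v) $ i = (\<mu> \<cdot>\<^sub>v (?C *\<^sub>v v)) $ i"
      using arg_cong[OF eq, of "\<lambda>x. x $ i"] Av Cv by (simp del: index_mult_mat_vec)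
  qed (use Av Cv in simp)
  then have "\<mu> \<in> spec_int n"
    using \<open>v \<noteq> _\<close> v
    unfolding spec_int_def gen_spectrum_def gen_eigenvector_def
    by (intro CollectI exI[of _ v]) (simp add: blk_mat_def)
  then show False using \<mu> by simp
qed

text \<open>A weak eigenvalue equation, tested with an arbitrary profile \<open>q\<close>. Since
  \<open>p\<close> solves the cell equations, every term containing \<open>q\<close> cancels. What
  remains is the nodal equation with the cell unknowns eliminated, and this is the dispersion
  equation.\<close>

lemma bloch_form_dispersion:
  assumes \<mu>: "\<mu> \<notin> spec_int n" and disp: "disp_eq n \<theta> \<mu>"
    and p: "p \<in> carrier_vec (n - 1)" and peq: "G_mat n \<mu> *\<^sub>v p = - G_vec n \<mu>"
    and q: "q \<in> carrier_vec (n - 1)"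
  shows "bloch_form n (stiff_mat n) \<theta> p q = \<mu> * bloch_form n (mass_mat n) \<theta> p q"
proof -
  let ?G = "G_mat n \<mu>" and ?g = "G_vec n \<mu>"
  have G: "?G \<in> carrier_mat (n - 1) (n - 1)"
    unfolding G_mat_def by (intro minus_carrier_mat smult_carrier_mat blk_mat_carrier)
  have g: "?g \<in> carrier_vec (n - 1)" by (simp add: G_vec_def)
  \<comment> \<open>The vector inside \<open>disp_eq\<close>. Both \<open>p\<close> and
    \<open>- h\<close> solve the cell equations, so they coincide by triviality of the
    kernel.\<close>
  define h where "h = the (mat_inverse ?G) *\<^sub>v ?g"
  have h: "h \<in> carrier_vec (n - 1)" "?G *\<^sub>v h = ?g"
    unfolding h_def by (rule mat_inverse_mult_vec[OF G G_mat_kernel[OF \<mu>] g]; assumption)+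
  have "?G *\<^sub>v (p + h) = 0\<^sub>v (n - 1)"
    using p h g by (simp add: mult_add_distrib_mat_vec[OF G] peq)
  moreover have "p + h \<in> carrier_vec (n - 1)" using p h(1) by simp
  ultimately have "p + h = 0\<^sub>v (n - 1)" using G_mat_kernel[OF \<mu>] by blast
  then have "(p + h) $ i = 0" if "i < n - 1" for i using that by simp
  then have ph: "p = - h"
    using p h(1) by (intro eq_vecI) (auto simp: add_eq_0_iff2)
  have lin: "G_vec n \<mu> \<bullet>\<^sub>v r =
      blk_vec n (stiff_mat n) \<bullet>\<^sub>v r - \<mu> * (blk_vec n (mass_mat n) \<bullet>\<^sub>v r)"
    if "r \<in> carrier_vec (n - 1)" for r
    using that by (simp add: G_vec_def minus_scalar_prod_distrib[of _ "n - 1"])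
  have linG: "(?G *\<^sub>v p) \<bullet>\<^sub>v r = (blk_mat n (stiff_mat n) *\<^sub>v p) \<bullet>\<^sub>v r
      - \<mu> * ((blk_mat n (mass_mat n) *\<^sub>v p) \<bullet>\<^sub>v r)"
    if "r \<in> carrier_vec (n - 1)" for r
  proof -
    have "?G *\<^sub>v p = blk_mat n (stiff_mat n) *\<^sub>v p - \<mu> \<cdot>\<^sub>v (blk_mat n (mass_mat n) *\<^sub>v p)"
      unfolding G_mat_def using p by (intro pencil_mult_vec[of _ "n - 1"]) auto
    then show ?thesis using that p
      by (simp add: minus_scalar_prod_distrib[of _ "n - 1"] mult_mat_vec_carrier[OF blk_mat_carrier])
  qed
  have Gp: "(?G *\<^sub>v p) \<bullet>\<^sub>v r = - (?g \<bullet>\<^sub>v r)" if "r \<in> carrier_vec (n - 1)" for r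
    using that g by (simp add: peq)
  have "bloch_form n (stiff_mat n) \<theta> p q - \<mu> * bloch_form n (mass_mat n) \<theta> p q =
      G_0 n \<mu> + ?g \<bullet>\<^sub>v p + ?g \<bullet>\<^sub>v q + (?G *\<^sub>v p) \<bullet>\<^sub>v q
      + \<theta> * (G_n n \<mu> + ?g \<bullet>\<^sub>v refl_vec p + ?g \<bullet>\<^sub>v refl_vec q + (?G *\<^sub>v p) \<bullet>\<^sub>v refl_vec q)"
    using p q by (simp add: bloch_form_def lin linG G_0_def G_n_def algebra_simps)
  \<comment> \<open>\<open>Gp\<close> is applied with \<open>q\<close> and with its
    reflection.\<close>
  also have "\<dots> = G_0 n \<mu> + ?g \<bullet>\<^sub>v p + \<theta> * (G_n n \<mu> + ?g \<bullet>\<^sub>v refl_vec p)"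
    using q by (simp add: Gp)
  also have "\<dots> = G_0 n \<mu> - ?g \<bullet>\<^sub>v h + \<theta> * (G_n n \<mu> - refl_vec ?g \<bullet>\<^sub>v h)"
    using h g by (simp add: ph refl_vec_uminus scalar_prod_refl_left[of _ "n - 1"])
  also have "\<dots> = 0" using disp by (simp add: disp_eq_def Let_def h_def)
  finally show ?thesis by simp
qed

text \<open>The usual argument for a symmetric pencil, with the Bloch forms of the stiffness and
  mass matrices at the same \<theta>: the stiffness value equals \<mu> and also \<nu> times the mass
  value.\<close>

lemma bloch_form_mass_orthogonal:
  assumes n: "n \<ge> 1" and ne: "\<mu> \<noteq> \<nu>"
    and \<mu>: "\<mu> \<notin> spec_int n" "disp_eq n \<theta> \<mu>" "p \<in> carrier_vec (n - 1)" "G_mat n \<mu> *\<^sub>v p = - G_vec n \<mu>"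
    and \<nu>: "\<nu> \<notin> spec_int n" "disp_eq n \<theta> \<nu>" "q \<in> carrier_vec (n - 1)" "G_mat n \<nu> *\<^sub>v q = - G_vec n \<nu>"
  shows "bloch_form n (mass_mat n) \<theta> p q = 0"
proof -
  have "\<mu> * bloch_form n (mass_mat n) \<theta> p q = \<nu> * bloch_form n (mass_mat n) \<theta> p q"
    using bloch_form_dispersion[OF \<mu> \<nu>(3)] bloch_form_dispersion[OF \<nu> \<mu>(3)]
      bloch_form_sym[OF stiff_mat_bisymmetric[OF n] \<mu>(3) \<nu>(3)]
      bloch_form_sym[OF mass_mat_bisymmetric[OF n] \<mu>(3) \<nu>(3)] by metis
  then show ?thesis using ne by auto
qed

subsection \<open>Discrete orthogonality of sines\<close>

text \<open>The Dirichlet kernel: multiplication by \<open>2 * sin (\<phi> / 2)\<close> makes the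
  sum telescope. The upper end contributes the sine of pi r - \<phi> / 2, whose sign depends on the
  parity of \<open>r\<close>.\<close>

lemma sum_cos_mesh:
  assumes "0 < r" "r < 2 * K"
  shows "(\<Sum>j<K. cos (pi * real r * real j / real K)) = (if even r then 0 else 1)"
proof -
  define \<phi> where "\<phi> = pi * real r / real K"
  have K: "K > 0" using assms by auto
  \<comment> \<open>The bound \<open>r < 2 * K\<close> keeps the half angle strictly between 0 and
    pi, so that its sine can be divided out.\<close>
  have "\<phi> / 2 < pi" using assms by (simp add: \<phi>_def field_simps)
  moreover have "\<phi> / 2 > 0" using assms K by (simp add: \<phi>_def)
  ultimately have sp: "sin (\<phi> / 2) > 0" by (intro sin_gt_zero)
  have "2 * sin (\<phi> / 2) * (\<Sum>j<N. cos (\<phi> * real j)) = sin (\<phi> * real N - \<phi> / 2) + sin (\<phi> / 2)" for N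
  proof (induction N)
    case (Suc N)
    have "sin (\<phi> * real (Suc N) - \<phi> / 2) = sin (\<phi> * real N + \<phi> / 2)" by (simp add: algebra_simps)
    then have "sin (\<phi> * real (Suc N) - \<phi> / 2) - sin (\<phi> * real N - \<phi> / 2) =
        2 * sin (\<phi> / 2) * cos (\<phi> * real N)" by (simp add: sin_add sin_diff)
    then show ?case using Suc.IH by (simp add: distrib_left)
  qed simp
  from this[of K] have "2 * sin (\<phi> / 2) * (\<Sum>j<K. cos (\<phi> * real j)) =
      sin (pi * real r - \<phi> / 2) + sin (\<phi> / 2)" using K by (simp add: \<phi>_def)
  also have "sin (pi * real r - \<phi> / 2) = - ((- 1) ^ r * sin (\<phi> / 2))"
    by (simp add: sin_diff mult.commute[of pi])
  finally have "sin (\<phi> / 2) * (2 * (\<Sum>j<K. cos (\<phi> * real j))) = sin (\<phi> / 2) * (1 - (- 1) ^ r)"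
    by (simp add: algebra_simps)
  then have "2 * (\<Sum>j<K. cos (\<phi> * real j)) = 1 - (- 1) ^ r" using sp by simp
  then show ?thesis by (auto simp: \<phi>_def)
qed

text \<open>The product formula leaves cosine sums at \<open>l - k\<close> and \<open>l + k\<close>.
  These numbers have the same parity, so for distinct \<open>k\<close>, \<open>l\<close> the two
  sums agree and cancel; for \<open>k = l\<close> the one at 0 equals \<open>K\<close> and the other
  vanishes.\<close>

lemma sum_sin_sin_mesh:
  assumes k: "k \<in> {1..K - 1}" and l: "l \<in> {1..K - 1}"
  shows "(\<Sum>j=1..K - 1. sin (pi * real k * real j / real K) * sin (pi * real l * real j / real K))
    = (if k = l then real K / 2 else 0)"
  using assms
proof (induction k l rule: linorder_wlog)
  case (le k l)
  let ?C = "\<lambda>r. \<Sum>j<K. cos (pi * real r * real j / real K)"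
  have "(\<Sum>j=1..K - 1. sin (pi * real k * real j / real K) * sin (pi * real l * real j / real K))
      = (\<Sum>j<K. sin (pi * real k * real j / real K) * sin (pi * real l * real j / real K))"
    \<comment> \<open>The added term at \<open>j = 0\<close> is zero.\<close>
    by (rule sum.mono_neutral_left) (use le in \<open>auto simp: not_le\<close>)
  also have "\<dots> = (\<Sum>j<K. (cos (pi * real (l - k) * real j / real K) - cos (pi * real (l + k) * real j / real K)) / 2)"
  proof (intro sum.cong refl)
    fix j
    have "pi * real (l - k) * real j / real K = pi * real l * real j / real K - pi * real k * real j / real K"
      "pi * real (l + k) * real j / real K = pi * real l * real j / real K + pi * real k * real j / real K"
      using le(1) by (simp_all add: of_nat_diff algebra_simps add_divide_distrib diff_divide_distrib)
    then show "sin (pi * real k * real j / real K) * sin (pi * real l * real j / real K) =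
      (cos (pi * real (l - k) * real j / real K) - cos (pi * real (l + k) * real j / real K)) / 2"
      by (simp only: cos_add cos_diff) simp
  qed
  also have "\<dots> = (?C (l - k) - ?C (l + k)) / 2"
    by (simp only: sum_divide_distrib[symmetric] sum_subtractf)
  finally have *: "(\<Sum>j=1..K - 1. sin (pi * real k * real j / real K) * sin (pi * real l * real j / real K))
      = (?C (l - k) - ?C (l + k)) / 2" .
  have p: "?C (l + k) = (if even (l + k) then 0 else 1)" using le by (intro sum_cos_mesh) auto
  show ?case
  proof (cases "k = l")
    case True
    then show ?thesis unfolding * p by simp
  next
    case False
    have "?C (l - k) = (if even (l - k) then 0 else 1)" using le False by (intro sum_cos_mesh) auto
    then show ?thesis unfolding * p using le False by auto
  qed
next
  case (sym k l)
  have "(\<Sum>j=1..K - 1. sin (pi * real l * real j / real K) * sin (pi * real k * real j / real K))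
      = (\<Sum>j=1..K - 1. sin (pi * real k * real j / real K) * sin (pi * real l * real j / real K))"
    by (intro sum.cong refl mult.commute)
  then show ?case using sym by presburger
qed

subsection \<open>The global space\<close>

lemma scalar_prod_vec_sum:
  assumes "finite I" "\<And>i. i \<in> I \<Longrightarrow> f i \<in> carrier_vec m" "x \<in> carrier_vec m"
  shows "x \<bullet>\<^sub>v vec_sum m f I = (\<Sum>i\<in>I. x \<bullet>\<^sub>v f i)"
proof -
  have f: "f \<in> I \<rightarrow> carrier_vec m" using assms by auto
  have "x \<bullet>\<^sub>v vec_sum m f I = (\<Sum>a<m. \<Sum>i\<in>I. x $ a * f i $ a)"
    using assms f
    by (simp add: scalar_prod_sum[OF _ finsum_vec_closed[OF f]] index_finsum_vec sum_distrib_left)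
  also have "\<dots> = (\<Sum>i\<in>I. \<Sum>a<m. x $ a * f i $ a)" by (rule sum.swap)
  also have "\<dots> = (\<Sum>i\<in>I. x \<bullet>\<^sub>v f i)"
    using assms by (intro sum.cong refl) (simp add: scalar_prod_sum)
  finally show ?thesis .
qed

lemma vec_sum_carrier:
  "(\<And>i. i \<in> I \<Longrightarrow> f i \<in> carrier_vec m) \<Longrightarrow> vec_sum m f I \<in> carrier_vec m"
  by (rule finsum_vec_closed) auto

text \<open>Turns a sum over interior nodes into a sum over elements, each node being the left end
  of its element. The next lemma uses right ends instead. The boundary value that is added is
  zero.\<close>

lemma sum_mesh_left:
  fixes f :: "nat \<Rightarrow> real"
  assumes "f 0 = 0" "K \<ge> 1"
  shows "(\<Sum>j=1..K - 1. f j) = (\<Sum>j=1..K. f (j - 1))"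
proof -
  have "(\<Sum>j=1..K. f (j - 1)) = (\<Sum>j=0..K - 1. f j)"
    using assms by (intro sum.reindex_bij_witness[of _ Suc "\<lambda>j. j - 1"]) auto
  also have "\<dots> = (\<Sum>j=1..K - 1. f j)"
    using assms by (intro sum.mono_neutral_right) (auto simp: not_le less_one)
  finally show ?thesis by simp
qed

lemma sum_mesh_right:
  fixes f :: "nat \<Rightarrow> real"
  assumes "f K = 0" "K \<ge> 1"
  shows "(\<Sum>j=1..K - 1. f j) = (\<Sum>j=1..K. f j)"
proof -
  have "{1..K} = insert K {1..K - 1}" using assms by auto
  then show ?thesis using assms by simp
qed

lemma sum_mesh_telescope:
  fixes f :: "nat \<Rightarrow> real"
  shows "(\<Sum>j=1..K. f (j - 1) - f j) = f 0 - f K"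
  by (induction K) auto

lemma gspace_node: "w \<in> gspace n K \<Longrightarrow> j = 0 \<or> j \<ge> K \<Longrightarrow> node w j = 0"
  by (cases "j = 0") (auto simp: gspace_def)

lemma gspace_cell: "w \<in> gspace n K \<Longrightarrow> cell w j \<in> carrier_vec (n - 1)"
  by (cases "j \<in> {1..K}") (auto simp: gspace_def)

lemma gspace_eqI:
  assumes "u \<in> gspace n K" "v \<in> gspace n K"
    and "\<And>j. j \<in> {1..K - 1} \<Longrightarrow> node u j = node v j"
    and "\<And>j. j \<in> {1..K} \<Longrightarrow> cell u j = cell v j"
  shows "u = v"
proof (intro prod_eqI ext)
  show "node u j = node v j" for j
    using assms by (cases "j \<in> {1..K - 1}") (simp_all add: gspace_def)
  show "cell u j = cell v j" for j
    using assms by (cases "j \<in> {1..K}") (simp_all add: gspace_def)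
qed

lemma ginner_comm:
  assumes "y \<in> gspace n K" "v \<in> gspace n K"
  shows "ginner K y v = ginner K v y"
  unfolding ginner_def
  using comm_scalar_prod[OF gspace_cell[OF assms(1)] gspace_cell[OF assms(2)]]
  by (simp add: mult.commute)

lemma gmass_in_gspace [intro]:
  assumes "v \<in> gspace n K"
  shows "gmass n K v \<in> gspace n K"
  using gspace_cell[OF assms]
  by (auto simp: gspace_def gmass_def Let_def intro!: add_carrier_vec mult_mat_vec_carrier[of _ "n - 1" "n - 1"])

text \<open>Writes the assembled mass form element by element, in a shape where exchanging
  \<open>w\<close> and \<open>v\<close> only permutes terms, apart from the interior block. The
  regrouping uses that \<open>v\<close> vanishes at both ends of the mesh.\<close>

lemma ginner_gmass:
  assumes K: "K \<ge> 1" and w: "w \<in> gspace n K" and v: "v \<in> gspace n K"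
  defines "c0 \<equiv> blk_0 (mass_mat n)" and "cn \<equiv> blk_n n (mass_mat n)"
    and "c \<equiv> blk_vec n (mass_mat n)" and "Ct \<equiv> blk_mat n (mass_mat n)"
  shows "ginner K (gmass n K w) v = (\<Sum>j=1..K.
    cn * (node w (j - 1) * node v j + node w j * node v (j - 1)) + 2 * c0 * node w j * node v j
    + (c \<bullet>\<^sub>v cell w j * node v (j - 1) + node w (j - 1) * (c \<bullet>\<^sub>v cell v j))
    + (refl_vec c \<bullet>\<^sub>v cell w j * node v j + node w j * (refl_vec c \<bullet>\<^sub>v cell v j))
    + (Ct *\<^sub>v cell w j) \<bullet>\<^sub>v cell v j)"
proof -
  note W = gspace_cell[OF w] and V = gspace_cell[OF v]
  have c: "c \<in> carrier_vec (n - 1)" and Ct: "Ct \<in> carrier_mat (n - 1) (n - 1)"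
    by (simp_all add: c_def Ct_def)
  have v0: "node v 0 = 0" "node v K = 0" using gspace_node[OF v] by auto
  have "(\<Sum>j=1..K - 1. node (gmass n K w) j * node v j) =
      (\<Sum>j=1..K - 1. (cn * node w (j - 1) + refl_vec c \<bullet>\<^sub>v cell w j + 2 * c0 * node w j) * node v j)
      + (\<Sum>j=1..K - 1. (c \<bullet>\<^sub>v cell w (j + 1) + cn * node w (j + 1)) * node v j)"
    unfolding sum.distrib[symmetric]
    by (intro sum.cong refl)
       (simp add: gmass_def Let_def c0_def cn_def c_def algebra_simps)
  \<comment> \<open>Couplings to the right of node \<open>j\<close> belong to element
    \<open>j + 1\<close>, of which \<open>j\<close> is the left end; all other terms, including the
    whole diagonal term, go to element \<open>j\<close>.\<close>
  also have "(\<Sum>j=1..K - 1. (c \<bullet>\<^sub>v cell w (j + 1) + cn * node w (j + 1)) * node v j)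
      = (\<Sum>j=1..K. (c \<bullet>\<^sub>v cell w j + cn * node w j) * node v (j - 1))"
    by (subst sum_mesh_left) (use v0 K in auto)
  also have "(\<Sum>j=1..K - 1. (cn * node w (j - 1) + refl_vec c \<bullet>\<^sub>v cell w j + 2 * c0 * node w j) * node v j)
      = (\<Sum>j=1..K. (cn * node w (j - 1) + refl_vec c \<bullet>\<^sub>v cell w j + 2 * c0 * node w j) * node v j)"
    by (subst sum_mesh_right) (use v0 K in auto)
  finally have nodes: "(\<Sum>j=1..K - 1. node (gmass n K w) j * node v j) =
     (\<Sum>j=1..K. (cn * node w (j - 1) + refl_vec c \<bullet>\<^sub>v cell w j + 2 * c0 * node w j) * node v j) +
     (\<Sum>j=1..K. (c \<bullet>\<^sub>v cell w j + cn * node w j) * node v (j - 1))" .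
  have cells: "(\<Sum>j=1..K. cell (gmass n K w) j \<bullet>\<^sub>v cell v j) =
     (\<Sum>j=1..K. node w (j - 1) * (c \<bullet>\<^sub>v cell v j) + (Ct *\<^sub>v cell w j) \<bullet>\<^sub>v cell v j
        + node w j * (refl_vec c \<bullet>\<^sub>v cell v j))"
  proof (intro sum.cong refl)
    fix j assume "j \<in> {1..K}"
    then have "cell (gmass n K w) j = node w (j - 1) \<cdot>\<^sub>v c + Ct *\<^sub>v cell w j + node w j \<cdot>\<^sub>v refl_vec c"
      by (simp add: gmass_def Let_def c_def Ct_def)
    then show "cell (gmass n K w) j \<bullet>\<^sub>v cell v j = node w (j - 1) * (c \<bullet>\<^sub>v cell v j)
        + (Ct *\<^sub>v cell w j) \<bullet>\<^sub>v cell v j + node w j * (refl_vec c \<bullet>\<^sub>v cell v j)"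
      using c V[of j] mult_mat_vec_carrier[OF Ct W[of j]]
      by (simp add: add_scalar_prod_distrib[of _ "n - 1"] smult_scalar_prod_distrib[of _ "n - 1"])
  qed
  show ?thesis unfolding ginner_def nodes cells sum.distrib[symmetric]
    by (intro sum.cong refl) (simp add: algebra_simps)
qed

lemma ginner_gmass_sym:
  assumes n: "n \<ge> 1" and K: "K \<ge> 1" and w: "w \<in> gspace n K" and v: "v \<in> gspace n K"
  shows "ginner K (gmass n K w) v = ginner K (gmass n K v) w"
proof -
  let ?Ct = "blk_mat n (mass_mat n)"
  have "(?Ct *\<^sub>v cell w j) \<bullet>\<^sub>v cell v j = (?Ct *\<^sub>v cell v j) \<bullet>\<^sub>v cell w j" for j
    using bisymmetric_scalar_prod[OF bisymmetric_blk_mat[OF mass_mat_bisymmetric[OF n]]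
        gspace_cell[OF w] gspace_cell[OF v]]
      comm_scalar_prod[OF gspace_cell[OF w] mult_mat_vec_carrier[OF blk_mat_carrier gspace_cell[OF v]]]
    by metis
  then show ?thesis
    unfolding ginner_gmass[OF K w v] ginner_gmass[OF K v w]
    by (intro sum.cong refl) (simp add: algebra_simps)
qed

lemma finite_idx [simp]: "finite (idx n K)"
  by (simp add: idx_def)

lemma ginner_gcomb:
  assumes v: "v \<in> gspace n K" and b: "\<And>k l. (k, l) \<in> idx n K \<Longrightarrow> b k l \<in> gspace n K"
  shows "ginner K v (gcomb n K a b) = (\<Sum>(k, l)\<in>idx n K. a k l * ginner K v (b k l))"
proof -
  have "cell v j \<bullet>\<^sub>v cell (gcomb n K a b) j =
      (\<Sum>(k, l)\<in>idx n K. a k l * (cell v j \<bullet>\<^sub>v cell (b k l) j))" for j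
  proof -
    have "cell v j \<bullet>\<^sub>v cell (gcomb n K a b) j =
      (\<Sum>i\<in>idx n K. cell v j \<bullet>\<^sub>v (case i of (k, l) \<Rightarrow> a k l \<cdot>\<^sub>v cell (b k l) j))"
      unfolding gcomb_def snd_conv
      by (rule scalar_prod_vec_sum) (use gspace_cell[OF v] gspace_cell[OF b] in auto)
    also have "\<dots> = (\<Sum>(k, l)\<in>idx n K. a k l * (cell v j \<bullet>\<^sub>v cell (b k l) j))"
      using gspace_cell[OF v] gspace_cell[OF b]
      by (intro sum.cong refl) (auto simp: scalar_prod_smult_distrib[of _ "n - 1"])
    finally show ?thesis .
  qed
  then have "ginner K v (gcomb n K a b) =
      (\<Sum>j=1..K - 1. \<Sum>(k, l)\<in>idx n K. a k l * (node v j * node (b k l) j))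
      + (\<Sum>j=1..K. \<Sum>(k, l)\<in>idx n K. a k l * (cell v j \<bullet>\<^sub>v cell (b k l) j))"
    by (simp add: ginner_def gcomb_def sum_distrib_left case_prod_unfold mult_ac)
  also have "\<dots> = (\<Sum>(k, l)\<in>idx n K. a k l * ginner K v (b k l))"
    by (subst (1 2) sum.swap)
       (simp add: ginner_def sum_distrib_left case_prod_unfold distrib_left sum.distrib)
  finally show ?thesis .
qed

subsection \<open>The eigenvectors\<close>

text \<open>The zeros prescribed outside \<open>{1..K - 1}\<close> agree with the sine at
  \<open>j = 0\<close> and \<open>j = K\<close>, so the formula also serves for the neighbours of
  the outermost nodes.\<close>

lemma eig_vec_k_node:
  "K \<ge> 1 \<Longrightarrow> j \<le> K \<Longrightarrow> node (eig_vec_k n K k p) j = sin (pi * real k * real j / real K)"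
  by (cases "j = 0"; cases "j = K") (auto simp: eig_vec_k_def mult.commute[of pi])

lemma eig_vec_k_cell:
  "j \<in> {1..K} \<Longrightarrow> cell (eig_vec_k n K k p) j =
    sin (pi * real k * real (j - 1) / real K) \<cdot>\<^sub>v p + sin (pi * real k * real j / real K) \<cdot>\<^sub>v refl_vec p"
  by (simp add: eig_vec_k_def of_nat_diff)

text \<open>
  The mass operator maps an eigenvector \<open>s\<^sub>k\<close> to a collection of the same shape, except that
  its nodal part is scaled by a factor \<open>\<kappa>\<close>.
\<close>

definition wave_vec :: "nat \<Rightarrow> nat \<Rightarrow> nat \<Rightarrow> real \<Rightarrow> real vec \<Rightarrow> gvec" where
  "wave_vec n K k \<kappa> q = (\<lambda>j. \<kappa> * node (eig_vec_k n K k q) j, cell (eig_vec_k n K k q))"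

lemma wave_vec_1: "wave_vec n K k 1 q = eig_vec_k n K k q"
  by (simp add: wave_vec_def)

lemma wave_vec_in_gspace [intro]: "q \<in> carrier_vec (n - 1) \<Longrightarrow> wave_vec n K k \<kappa> q \<in> gspace n K"
  by (auto simp: wave_vec_def gspace_def eig_vec_k_def)

lemma eig_vec_k_in_gspace [intro]: "q \<in> carrier_vec (n - 1) \<Longrightarrow> eig_vec_k n K k q \<in> gspace n K"
  using wave_vec_in_gspace[of q n K k 1] by (simp add: wave_vec_1)

lemma eig_vec_0_in_gspace [intro]: "e \<in> carrier_vec (n - 1) \<Longrightarrow> eig_vec_0 n K e \<in> gspace n K"
  by (auto simp: gspace_def eig_vec_0_def)

text \<open>The source of \<theta>: the sines are eigenvectors of the sum of the two shifts, with
  eigenvalue 2 cos (pi k / K).\<close>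

lemma sin_mesh_recurrence:
  assumes "j \<ge> 1"
  shows "sin (pi * real k * real (j - 1) / real K) + sin (pi * real k * real (j + 1) / real K)
    = 2 * cos (pi * real k / real K) * sin (pi * real k * real j / real K)"
proof -
  have "pi * real k * real (j - 1) / real K = pi * real k * real j / real K - pi * real k / real K"
    "pi * real k * real (j + 1) / real K = pi * real k * real j / real K + pi * real k / real K"
    using assms by (simp_all add: of_nat_diff algebra_simps add_divide_distrib diff_divide_distrib)
  then show ?thesis by (simp only: sin_add sin_diff) simp
qed

text \<open>At a node, the terms with the sines at \<open>j - 1\<close> and \<open>j + 1\<close>
  share the coefficient \<open>cn + c \<bullet>\<^sub>v refl_vec p\<close>, so the recurrence turns
  them into a multiple of the sine at \<open>j\<close>; the remaining terms have coefficient
  \<open>2 * (c0 + c \<bullet>\<^sub>v p)\<close>. In a cell, the interior matrix commutes with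
  reflection, so \<open>c\<close> and its reflection simply join the two halves of the
  profile.\<close>

lemma gmass_eig_vec_k:
  fixes k :: nat
  assumes n: "n \<ge> 1" and K: "K \<ge> 1" and p: "p \<in> carrier_vec (n - 1)"
  defines "c0 \<equiv> blk_0 (mass_mat n)" and "cn \<equiv> blk_n n (mass_mat n)"
    and "c \<equiv> blk_vec n (mass_mat n)" and "Ct \<equiv> blk_mat n (mass_mat n)"
    and "\<theta> \<equiv> cos (pi * real k / real K)"
  shows "gmass n K (eig_vec_k n K k p) =
    wave_vec n K k (2 * (c0 + c \<bullet>\<^sub>v p + \<theta> * (cn + c \<bullet>\<^sub>v refl_vec p))) (Ct *\<^sub>v p + c)"
    (is "?L = ?R")
proof -
  let ?s = "\<lambda>j. sin (pi * real k * real j / real K)"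
  let ?v = "eig_vec_k n K k p"
  have c: "c \<in> carrier_vec (n - 1)" and Ct: "Ct \<in> carrier_mat (n - 1) (n - 1)"
    by (simp_all add: c_def Ct_def)
  have Cp: "Ct *\<^sub>v p \<in> carrier_vec (n - 1)" using mult_mat_vec_carrier[OF Ct p] .
  have CP: "Ct *\<^sub>v refl_vec p = refl_vec (Ct *\<^sub>v p)"
    unfolding Ct_def by (rule bisymmetric_refl[OF bisymmetric_blk_mat[OF mass_mat_bisymmetric[OF n]] p])
  show ?thesis
  proof (rule gspace_eqI)
    show "?L \<in> gspace n K" "?R \<in> gspace n K" using p c Cp by auto
  next
    fix j assume True: "j \<in> {1..K - 1}"
    then have j: "j \<ge> 1" "j \<le> K" "j - 1 \<le> K" "j + 1 \<le> K" "j \<in> {1..K}" "j + 1 \<in> {1..K}"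
      using K by auto
    have sc: "x \<bullet>\<^sub>v (a \<cdot>\<^sub>v p + b \<cdot>\<^sub>v refl_vec p) = a * (x \<bullet>\<^sub>v p) + b * (x \<bullet>\<^sub>v refl_vec p)"
      if "x \<in> carrier_vec (n - 1)" for x a b
      using that p by (simp add: scalar_prod_add_distrib[of _ "n - 1"] scalar_prod_smult_distrib[of _ "n - 1"])
    have "node ?L j = cn * ?s (j - 1) + refl_vec c \<bullet>\<^sub>v (?s (j - 1) \<cdot>\<^sub>v p + ?s j \<cdot>\<^sub>v refl_vec p)
        + 2 * c0 * ?s j + c \<bullet>\<^sub>v (?s j \<cdot>\<^sub>v p + ?s (j + 1) \<cdot>\<^sub>v refl_vec p) + cn * ?s (j + 1)"
      using True eig_vec_k_node[OF K j(2), of n k p] eig_vec_k_node[OF K j(3), of n k p]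
        eig_vec_k_node[OF K j(4), of n k p] eig_vec_k_cell[OF j(5), of n k p]
        eig_vec_k_cell[OF j(6), of n k p]
      by (simp add: gmass_def Let_def c0_def cn_def c_def)
    also have "\<dots> = (cn + c \<bullet>\<^sub>v refl_vec p) * (?s (j - 1) + ?s (j + 1)) + 2 * (c0 + c \<bullet>\<^sub>v p) * ?s j"
      using c p by (simp only: sc refl_vec_carrier scalar_prod_refl_left[of _ "n - 1"] refl_vec_refl_vec)
        (simp add: algebra_simps)
    also have "\<dots> = 2 * (c0 + c \<bullet>\<^sub>v p + \<theta> * (cn + c \<bullet>\<^sub>v refl_vec p)) * ?s j"
      unfolding sin_mesh_recurrence[OF j(1)] \<theta>_def by (simp add: algebra_simps)
    also have "\<dots> = node ?R j"
      using eig_vec_k_node[OF K j(2)] by (simp add: wave_vec_def)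
    finally show "node ?L j = node ?R j" .
  next
    fix j assume True: "j \<in> {1..K}"
    then have j: "j \<le> K" "j - 1 \<le> K" by auto
    have shape: "?s (j - 1) \<cdot>\<^sub>v c + (?s (j - 1) \<cdot>\<^sub>v x + ?s j \<cdot>\<^sub>v refl_vec x) + ?s j \<cdot>\<^sub>v refl_vec c
      = ?s (j - 1) \<cdot>\<^sub>v (x + c) + ?s j \<cdot>\<^sub>v refl_vec (x + c)" if "x \<in> carrier_vec (n - 1)" for x
      using that c by (intro eq_vecI) (auto simp: algebra_simps)
    have "cell ?L j = ?s (j - 1) \<cdot>\<^sub>v c + Ct *\<^sub>v (?s (j - 1) \<cdot>\<^sub>v p + ?s j \<cdot>\<^sub>v refl_vec p) + ?s j \<cdot>\<^sub>v refl_vec c"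
      using True eig_vec_k_node[OF K j(1), of n k p] eig_vec_k_node[OF K j(2), of n k p]
        eig_vec_k_cell[OF True, of n k p]
      by (simp add: gmass_def Let_def c_def Ct_def)
    also have "Ct *\<^sub>v (?s (j - 1) \<cdot>\<^sub>v p + ?s j \<cdot>\<^sub>v refl_vec p) =
        ?s (j - 1) \<cdot>\<^sub>v (Ct *\<^sub>v p) + ?s j \<cdot>\<^sub>v refl_vec (Ct *\<^sub>v p)"
      using p by (simp add: mult_add_distrib_mat_vec[OF Ct] mult_mat_vec[OF Ct] CP)
    also have "?s (j - 1) \<cdot>\<^sub>v c + (?s (j - 1) \<cdot>\<^sub>v (Ct *\<^sub>v p) + ?s j \<cdot>\<^sub>v refl_vec (Ct *\<^sub>v p))
        + ?s j \<cdot>\<^sub>v refl_vec c = cell ?R j"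
      using eig_vec_k_cell[OF True] shape[OF Cp] by (simp add: wave_vec_def)
    finally show "cell ?L j = cell ?R j" .
  qed
qed

text \<open>At a node the two adjacent cells cancel, since the right one is minus the reflection of
  the left one. In the cells the interior matrix commutes with \<open>-P\<close>.\<close>

lemma gmass_eig_vec_0:
  assumes n: "n \<ge> 1" and e: "e \<in> carrier_vec (n - 1)"
  shows "gmass n K (eig_vec_0 n K e) = eig_vec_0 n K (blk_mat n (mass_mat n) *\<^sub>v e)"
    (is "?L = ?R")
proof -
  let ?c = "blk_vec n (mass_mat n)" and ?Ct = "blk_mat n (mass_mat n)"
  show ?thesis
  proof (rule gspace_eqI)
    show "?L \<in> gspace n K" "?R \<in> gspace n K"
      using e by (auto intro: mult_mat_vec_carrier)
  next
    fix j assume True: "j \<in> {1..K - 1}"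
    then obtain i where i: "j = Suc i" by (cases j) auto
    have "refl_vec ?c \<bullet>\<^sub>v neg_refl_pow i e + ?c \<bullet>\<^sub>v neg_refl_pow (Suc i) e = 0"
      using carrier_vecD[OF e] scalar_prod_refl_left[of ?c "n - 1" "neg_refl_pow i e"]
        neg_refl_pow_carrier[OF e, of i] by (simp add: neg_refl_pow_Suc)
    moreover have "cell (eig_vec_0 n K e) j = neg_refl_pow i e"
      "cell (eig_vec_0 n K e) (j + 1) = neg_refl_pow (Suc i) e"
      using True i by (auto simp: eig_vec_0_def Suc_eq_plus1)
    moreover have "node (eig_vec_0 n K e) = (\<lambda>j. 0)" "node ?R j = 0"
      by (simp_all add: eig_vec_0_def)
    ultimately show "node ?L j = node ?R j" using True
      by (simp add: gmass_def Let_def)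
  next
    fix j assume True: "j \<in> {1..K}"
    have "?Ct *\<^sub>v neg_refl_pow (j - 1) e = neg_refl_pow (j - 1) (?Ct *\<^sub>v e)"
      by (rule bisymmetric_neg_refl_pow[OF bisymmetric_blk_mat[OF mass_mat_bisymmetric[OF n]] e])
    moreover have "neg_refl_pow (j - 1) (?Ct *\<^sub>v e) \<in> carrier_vec (n - 1)"
      using e by (auto intro: mult_mat_vec_carrier)
    moreover have "0 \<cdot>\<^sub>v ?c = 0\<^sub>v (n - 1)" "0 \<cdot>\<^sub>v refl_vec ?c = 0\<^sub>v (n - 1)"
      by (intro eq_vecI; simp)+
    ultimately show "cell ?L j = cell ?R j" using True
      by (simp add: gmass_def Let_def eig_vec_0_def)
  qed
qed

subsection \<open>Inner products with the eigenvectors\<close>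

lemma alt_sum_carrier: "y \<in> gspace n K \<Longrightarrow> alt_sum n K y \<in> carrier_vec (n - 1)"
  unfolding alt_sum_def by (intro vec_sum_carrier neg_refl_pow_carrier gspace_cell)

lemma ginner_eig_vec_0:
  assumes y: "y \<in> gspace n K" and e: "e \<in> carrier_vec (n - 1)"
  shows "ginner K y (eig_vec_0 n K e) = alt_sum n K y \<bullet>\<^sub>v e"
proof -
  note Y = gspace_cell[OF y]
  have "ginner K y (eig_vec_0 n K e) = (\<Sum>j=1..K. cell y j \<bullet>\<^sub>v neg_refl_pow (j - 1) e)"
    by (simp add: ginner_def eig_vec_0_def)
  also have "\<dots> = (\<Sum>j=1..K. e \<bullet>\<^sub>v neg_refl_pow (j - 1) (cell y j))"
    by (intro sum.cong refl)
       (simp add: scalar_prod_neg_refl_pow[OF Y e] comm_scalar_prod[OF e neg_refl_pow_carrier[OF Y]])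
  also have "\<dots> = e \<bullet>\<^sub>v alt_sum n K y"
    unfolding alt_sum_def by (rule scalar_prod_vec_sum[symmetric]) (use Y e in auto)
  also have "\<dots> = alt_sum n K y \<bullet>\<^sub>v e" by (rule comm_scalar_prod[OF e alt_sum_carrier[OF y]])
  finally show ?thesis .
qed

lemma scalar_prod_even_sum:
  assumes "y \<in> gspace n K" "x \<in> carrier_vec (n - 1)"
  shows "x \<bullet>\<^sub>v even_sum n K y k = (\<Sum>j=1..K - 1. sin (pi * real k * real j / real K) *
    (x \<bullet>\<^sub>v even_part (cell y j + cell y (j + 1))))"
  unfolding even_sum_def using gspace_cell[OF assms(1)] assms(2)
  by (subst scalar_prod_vec_sum)
     (auto intro!: sum.cong smult_carrier_vec even_part_carrier add_carrier_vec scalar_prod_smult_distrib)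

lemma scalar_prod_odd_sum:
  assumes "y \<in> gspace n K" "x \<in> carrier_vec (n - 1)"
  shows "x \<bullet>\<^sub>v odd_sum n K y k = (\<Sum>j=1..K - 1. sin (pi * real k * real j / real K) *
    (x \<bullet>\<^sub>v odd_part (cell y (j + 1) - cell y j)))"
  unfolding odd_sum_def using gspace_cell[OF assms(1)] assms(2)
  by (subst scalar_prod_vec_sum)
     (auto intro!: sum.cong smult_carrier_vec odd_part_carrier minus_carrier_vec scalar_prod_smult_distrib)

text \<open>Here \<open>u\<close> and \<open>v\<close> are the cells to the left and right of a
  node. Expanded in products with \<open>q\<close> and its reflection, the even and odd
  contributions cancel in the pairings of \<open>u\<close> with \<open>q\<close> and of
  \<open>v\<close> with the reflection of \<open>q\<close>.\<close>

lemma parity_split: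
  assumes "q \<in> carrier_vec m" "u \<in> carrier_vec m" "v \<in> carrier_vec m"
  shows "even_part q \<bullet>\<^sub>v even_part (u + v) + odd_part q \<bullet>\<^sub>v odd_part (v - u) = v \<bullet>\<^sub>v q + u \<bullet>\<^sub>v refl_vec q"
  using assms comm_scalar_prod[of q m v] comm_scalar_prod[of "refl_vec q" m u]
  by (simp add: even_part_scalar_prod_even_part[of _ m] odd_part_scalar_prod_odd_part[of _ m]
      refl_vec_add[of _ m] refl_vec_minus[of _ m] scalar_prod_add_distrib[of _ m]
      scalar_prod_minus_distrib[of _ m] scalar_prod_refl_left[of _ m]) (simp add: field_simps)

text \<open>The general \<kappa> allows two uses: \<kappa> = 1 for the eigenvectors themselves, and
  the factor of \<open>gmass_eig_vec_k\<close> for their images under the mass operator.\<close>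

lemma ginner_wave_vec:
  assumes K: "K \<ge> 1" and y: "y \<in> gspace n K" and q: "q \<in> carrier_vec (n - 1)"
  shows "ginner K y (wave_vec n K k \<kappa> q) =
    \<kappa> * node_sum K y k + even_part q \<bullet>\<^sub>v even_sum n K y k + odd_part q \<bullet>\<^sub>v odd_sum n K y k"
proof -
  let ?s = "\<lambda>j. sin (pi * real k * real j / real K)"
  note Y = gspace_cell[OF y]
  have sK: "?s K = 0" using K by (simp add: mult.commute[of pi])
  have "(\<Sum>j=1..K. cell y j \<bullet>\<^sub>v cell (wave_vec n K k \<kappa> q) j) =
      (\<Sum>j=1..K. ?s (j - 1) * (cell y j \<bullet>\<^sub>v q) + ?s j * (cell y j \<bullet>\<^sub>v refl_vec q))"
  proof (intro sum.cong refl)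
    fix j assume j: "j \<in> {1..K}"
    then show "cell y j \<bullet>\<^sub>v cell (wave_vec n K k \<kappa> q) j =
        ?s (j - 1) * (cell y j \<bullet>\<^sub>v q) + ?s j * (cell y j \<bullet>\<^sub>v refl_vec q)"
      using Y[of j] q eig_vec_k_cell[OF j, of n k q]
      by (simp add: wave_vec_def scalar_prod_add_distrib[of _ "n - 1"] scalar_prod_smult_distrib[of _ "n - 1"])
  qed
  also have "\<dots> = (\<Sum>j=1..K. ?s (j - 1) * (cell y (j - 1 + 1) \<bullet>\<^sub>v q)) + (\<Sum>j=1..K. ?s j * (cell y j \<bullet>\<^sub>v refl_vec q))"
    by (simp add: sum.distrib)
  \<comment> \<open>Regrouping from elements to nodes: the left sum is shifted by one and loses its
    term at node 0, the right sum loses its term at node \<open>K\<close>; both sines are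
    zero.\<close>
  also have "\<dots> = (\<Sum>j=1..K - 1. ?s j * (cell y (j + 1) \<bullet>\<^sub>v q)) + (\<Sum>j=1..K - 1. ?s j * (cell y j \<bullet>\<^sub>v refl_vec q))"
    using sum_mesh_left[of "\<lambda>j. ?s j * (cell y (j + 1) \<bullet>\<^sub>v q)" K]
      sum_mesh_right[of "\<lambda>j. ?s j * (cell y j \<bullet>\<^sub>v refl_vec q)" K] K sK by simp
  also have "\<dots> = (\<Sum>j=1..K - 1. ?s j * (cell y (j + 1) \<bullet>\<^sub>v q + cell y j \<bullet>\<^sub>v refl_vec q))"
    by (simp add: sum.distrib[symmetric] distrib_left)
  also have "\<dots> = even_part q \<bullet>\<^sub>v even_sum n K y k + odd_part q \<bullet>\<^sub>v odd_sum n K y k"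
    using q Y by (simp add: scalar_prod_even_sum[OF y] scalar_prod_odd_sum[OF y] sum.distrib[symmetric]
        distrib_left[symmetric] parity_split[of _ "n - 1"])
  finally have cells: "(\<Sum>j=1..K. cell y j \<bullet>\<^sub>v cell (wave_vec n K k \<kappa> q) j) =
    even_part q \<bullet>\<^sub>v even_sum n K y k + odd_part q \<bullet>\<^sub>v odd_sum n K y k" .
  have "(\<Sum>j=1..K - 1. node y j * node (wave_vec n K k \<kappa> q) j) = \<kappa> * node_sum K y k"
    unfolding node_sum_def sum_distrib_left
    by (intro sum.cong refl) (simp add: wave_vec_def eig_vec_k_def)
  then show ?thesis unfolding ginner_def cells by simp
qed

lemma ginner_eig_vec_0_eig_vec_0:
  assumes "a \<in> carrier_vec (n - 1)" "b \<in> carrier_vec (n - 1)"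
  shows "ginner K (eig_vec_0 n K a) (eig_vec_0 n K b) = real K * (a \<bullet>\<^sub>v b)"
proof -
  have "neg_refl_pow i a \<bullet>\<^sub>v neg_refl_pow i b = a \<bullet>\<^sub>v b" for i
    using assms by (auto simp: neg_refl_pow_eq scalar_prod_refl_refl)
  then show ?thesis by (simp add: ginner_def eig_vec_0_def)
qed

text \<open>Each cell contributes a difference of consecutive values of \<open>f\<close>, which
  vanishes at both ends of the mesh together with the sine.\<close>

lemma ginner_wave_vec_eig_vec_0:
  assumes K: "K \<ge> 1" and q: "q \<in> carrier_vec (n - 1)" and e: "e \<in> carrier_vec (n - 1)"
  shows "ginner K (wave_vec n K k \<kappa> q) (eig_vec_0 n K e) = 0"
proof -
  let ?s = "\<lambda>j. sin (pi * real k * real j / real K)"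
  define f where "f j = ?s j * (neg_refl_pow j q \<bullet>\<^sub>v e)" for j
  have "ginner K (wave_vec n K k \<kappa> q) (eig_vec_0 n K e) = (\<Sum>j=1..K. f (j - 1) - f j)"
  proof -
    have "cell (wave_vec n K k \<kappa> q) j \<bullet>\<^sub>v neg_refl_pow (j - 1) e = f (j - 1) - f j" if "j \<in> {1..K}" for j
    proof -
      obtain i where i: "j = Suc i" using \<open>j \<in> {1..K}\<close> by (cases j) auto
      \<comment> \<open>A reflection is minus one further power of \<open>-P\<close>; this supplies
        the minus sign of the telescoping difference.\<close>
      have *: "neg_refl_pow i (refl_vec q) = - neg_refl_pow (Suc i) q"
        by (auto simp: neg_refl_pow_eq)
      have "cell (wave_vec n K k \<kappa> q) j \<bullet>\<^sub>v neg_refl_pow i e =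
          ?s i * (q \<bullet>\<^sub>v neg_refl_pow i e) + ?s j * (refl_vec q \<bullet>\<^sub>v neg_refl_pow i e)"
        using eig_vec_k_cell[OF that, of n k q] q e i
        by (simp add: wave_vec_def add_scalar_prod_distrib[of _ "n - 1"] smult_scalar_prod_distrib[of _ "n - 1"])
      also have "\<dots> = f i - f j"
        using q e i neg_refl_pow_carrier[OF q, of "Suc i"]
        by (simp add: f_def scalar_prod_neg_refl_pow[of _ "n - 1"] *)
      finally show ?thesis using i by simp
    qed
    then show ?thesis by (simp add: ginner_def eig_vec_0_def)
  qed
  also have "\<dots> = 0"
    unfolding sum_mesh_telescope using K by (simp add: f_def mult.commute[of pi])
  finally show ?thesis .
qed

text \<open>The mesh data of a wave are multiples of its own sine: sums of adjacent cells give the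
  factor 2 (1 + \<theta>) on the even part, differences give 2 (1 - \<theta>) on the odd part. Every
  mesh sum thus reduces to the sine sum \<open>S\<close>, and recombining the parities leaves the
  products of \<open>q\<close> with \<open>r\<close> and, weighted by \<theta>, with its
  reflection.\<close>

lemma ginner_wave_vec_wave_vec:
  assumes k: "k \<in> {1..K - 1}" and l: "l \<in> {1..K - 1}"
    and q: "q \<in> carrier_vec (n - 1)" and r: "r \<in> carrier_vec (n - 1)"
  shows "ginner K (wave_vec n K k \<kappa> q) (wave_vec n K l \<kappa>' r) =
    (if k = l then real K * (\<kappa> * \<kappa>' / 2 + q \<bullet>\<^sub>v r + cos (pi * real k / real K) * (q \<bullet>\<^sub>v refl_vec r)) else 0)"
proof -
  let ?s = "\<lambda>k j. sin (pi * real k * real j / real K)"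
  let ?\<theta> = "cos (pi * real k / real K)"
  define S where "S = (\<Sum>j=1..K - 1. ?s l j * ?s k j)"
  have S: "S = (if k = l then real K / 2 else 0)"
    unfolding S_def using sum_sin_sin_mesh[OF l k] by auto
  have K: "K \<ge> 1" using k by auto
  let ?w = "wave_vec n K k \<kappa> q"
  have w: "?w \<in> gspace n K" using q by auto
  have cell: "cell ?w j = ?s k (j - 1) \<cdot>\<^sub>v q + ?s k j \<cdot>\<^sub>v refl_vec q"
    "cell ?w (j + 1) = ?s k j \<cdot>\<^sub>v q + ?s k (j + 1) \<cdot>\<^sub>v refl_vec q" if "j \<in> {1..K - 1}" for j
    using that eig_vec_k_cell[of j K n k q] eig_vec_k_cell[of "j + 1" K n k q] by (auto simp: wave_vec_def)
  have rec: "?s k (j - 1) + ?s k (j + 1) = 2 * ?\<theta> * ?s k j" if "j \<in> {1..K - 1}" for j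
    using that by (intro sin_mesh_recurrence) auto
  have even: "even_part (cell ?w j + cell ?w (j + 1)) = (2 * (1 + ?\<theta>) * ?s k j) \<cdot>\<^sub>v even_part q"
    if j: "j \<in> {1..K - 1}" for j
  proof -
    have "cell ?w j + cell ?w (j + 1) =
        (?s k (j - 1) + ?s k j) \<cdot>\<^sub>v q + (?s k j + ?s k (j + 1)) \<cdot>\<^sub>v refl_vec q"
      unfolding cell[OF j] using q by (intro eq_vecI) (auto simp: algebra_simps)
    moreover have "?s k (j - 1) + ?s k j + (?s k j + ?s k (j + 1)) = 2 * (1 + ?\<theta>) * ?s k j"
      using rec[OF j] by (simp only: distrib_right distrib_left)
    ultimately show ?thesis by (simp only: even_part_wave[OF q])
  qed
  have odd: "odd_part (cell ?w (j + 1) - cell ?w j) = (2 * (1 - ?\<theta>) * ?s k j) \<cdot>\<^sub>v odd_part q"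
    if j: "j \<in> {1..K - 1}" for j
  proof -
    have "cell ?w (j + 1) - cell ?w j =
        (?s k j - ?s k (j - 1)) \<cdot>\<^sub>v q + (?s k (j + 1) - ?s k j) \<cdot>\<^sub>v refl_vec q"
      unfolding cell[OF j] using q by (intro eq_vecI) (auto simp: algebra_simps)
    moreover have "?s k j - ?s k (j - 1) - (?s k (j + 1) - ?s k j) = 2 * (1 - ?\<theta>) * ?s k j"
      using rec[OF j] by (simp only: left_diff_distrib right_diff_distrib)
    ultimately show ?thesis by (simp only: odd_part_wave[OF q])
  qed
  have ns: "node_sum K ?w l = \<kappa> * S"
    unfolding node_sum_def S_def sum_distrib_left
    by (intro sum.cong refl) (simp add: wave_vec_def eig_vec_k_def)
  have es: "even_part r \<bullet>\<^sub>v even_sum n K ?w l = 2 * (1 + ?\<theta>) * (even_part r \<bullet>\<^sub>v even_part q) * S"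
    unfolding scalar_prod_even_sum[OF w even_part_carrier[OF r]] S_def sum_distrib_left
    using q r by (intro sum.cong refl) (simp add: even scalar_prod_smult_distrib[of _ "n - 1"])
  have os: "odd_part r \<bullet>\<^sub>v odd_sum n K ?w l = 2 * (1 - ?\<theta>) * (odd_part r \<bullet>\<^sub>v odd_part q) * S"
    unfolding scalar_prod_odd_sum[OF w odd_part_carrier[OF r]] S_def sum_distrib_left
    using q r by (intro sum.cong refl) (simp add: odd scalar_prod_smult_distrib[of _ "n - 1"])
  have "ginner K ?w (wave_vec n K l \<kappa>' r) =
      (\<kappa> * \<kappa>' + 2 * (q \<bullet>\<^sub>v r) + 2 * ?\<theta> * (q \<bullet>\<^sub>v refl_vec r)) * S"
    unfolding ginner_wave_vec[OF K w r] ns es os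
    using q r comm_scalar_prod[of r "n - 1" q] comm_scalar_prod[of "refl_vec r" "n - 1" q]
    by (simp add: even_part_scalar_prod_even_part[of _ "n - 1"] odd_part_scalar_prod_odd_part[of _ "n - 1"]
        scalar_prod_refl_left[of r "n - 1" q, symmetric] field_simps)
  then show ?thesis unfolding S by (simp add: field_simps)
qed

text \<open>The Bloch form arises as half the nodal factor of the image of \<open>p\<close> plus the
  products of the profile \<open>Ct p + c\<close> with \<open>q\<close> and its reflection.\<close>

lemma ginner_gmass_eig_vec_k:
  assumes n: "n \<ge> 1" and k: "k \<in> {1..K - 1}" and l: "l \<in> {1..K - 1}"
    and p: "p \<in> carrier_vec (n - 1)" and q: "q \<in> carrier_vec (n - 1)"
  shows "ginner K (gmass n K (eig_vec_k n K k p)) (eig_vec_k n K l q) =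
    (if k = l then real K * bloch_form n (mass_mat n) (cos (pi * real k / real K)) p q else 0)"
proof -
  have K: "K \<ge> 1" using k by auto
  let ?Ct = "blk_mat n (mass_mat n)" and ?c = "blk_vec n (mass_mat n)"
  have Cp: "?Ct *\<^sub>v p \<in> carrier_vec (n - 1)" using mult_mat_vec_carrier[OF blk_mat_carrier p] .
  show ?thesis
    unfolding gmass_eig_vec_k[OF n K p] wave_vec_1[symmetric, of n K l q]
    using Cp q by (subst ginner_wave_vec_wave_vec[OF k l])
      (auto simp: bloch_form_def add_scalar_prod_distrib[of _ "n - 1"] algebra_simps)
qed

lemma gen_eigenvector_carrier:
  "A \<in> carrier_mat m m \<Longrightarrow> gen_eigenvector A C v \<mu> \<Longrightarrow> v \<in> carrier_vec m"
  by (auto simp: gen_eigenvector_def)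

text \<open>Supplies the orthogonality among the vectors with \<open>k = 0\<close>, whose profiles
  are eigenvectors of the interior problem.\<close>

lemma gen_eigenvector_orthogonal:
  assumes A: "bisymmetric m A" and C: "bisymmetric m C"
    and v: "gen_eigenvector A C v \<mu>" and w: "gen_eigenvector A C w \<nu>" and ne: "\<mu> \<noteq> \<nu>"
  shows "(C *\<^sub>v v) \<bullet>\<^sub>v w = 0"
proof -
  note Ac = bisymmetric_carrier[OF A] and Cc = bisymmetric_carrier[OF C]
  have v': "v \<in> carrier_vec m" and w': "w \<in> carrier_vec m"
    using v w Ac by (auto intro: gen_eigenvector_carrier)
  have "\<mu> * ((C *\<^sub>v v) \<bullet>\<^sub>v w) = (A *\<^sub>v v) \<bullet>\<^sub>v w"
    using v v' w' Cc by (simp add: gen_eigenvector_def)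
  also have "\<dots> = v \<bullet>\<^sub>v (A *\<^sub>v w)" by (rule bisymmetric_scalar_prod[OF A v' w'])
  also have "\<dots> = \<nu> * (v \<bullet>\<^sub>v (C *\<^sub>v w))"
    using w v' w' Cc by (simp add: gen_eigenvector_def)
  also have "\<dots> = \<nu> * ((C *\<^sub>v v) \<bullet>\<^sub>v w)" by (simp add: bisymmetric_scalar_prod[OF C v' w'])
  finally show ?thesis using ne by simp
qed

subsection \<open>Expansions in the eigenvectors\<close>

lemma sum_idx:
  fixes f :: "nat \<Rightarrow> nat \<Rightarrow> real"
  shows "(\<Sum>(k, l)\<in>idx n K. f k l) = (\<Sum>l=1..n - 1. f 0 l) + (\<Sum>k=1..K - 1. \<Sum>l=1..n. f k l)"
proof -
  have "(\<Sum>(k, l)\<in>idx n K. f k l) =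
      (\<Sum>(k, l)\<in>{0} \<times> {1..n - 1}. f k l) + (\<Sum>(k, l)\<in>{1..K - 1} \<times> {1..n}. f k l)"
    unfolding idx_def by (rule sum.union_disjoint) auto
  then show ?thesis by (simp add: sum.cartesian_product[symmetric])
qed

lemma index_vec_sum_smult:
  assumes "finite I" "\<And>i. i \<in> I \<Longrightarrow> f i \<in> carrier_vec m" "r < m"
  shows "vec_sum m (\<lambda>i. a i \<cdot>\<^sub>v f i) I $ r = (\<Sum>i\<in>I. a i * f i $ r)"
proof -
  have "vec_sum m (\<lambda>i. a i \<cdot>\<^sub>v f i) I $ r = (\<Sum>i\<in>I. (a i \<cdot>\<^sub>v f i) $ r)"
    using assms by (intro index_finsum_vec) auto
  also have "\<dots> = (\<Sum>i\<in>I. a i * f i $ r)"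
    using assms(3) by (intro sum.cong refl index_smult_vec(1)) (simp add: carrier_vecD[OF assms(2)])
  finally show ?thesis .
qed

lemma reflect_less:
  fixes i m :: nat
  shows "i < m \<Longrightarrow> m - 1 - i < m"
  by auto

lemma index_neg_refl_pow:
  "v \<in> carrier_vec m \<Longrightarrow> i < m \<Longrightarrow>
    neg_refl_pow j v $ i = (if even j then v $ i else - v $ (m - 1 - i))"
  by (auto simp: neg_refl_pow_eq)

lemma node_gcomb_eig_vec:
  assumes "j \<in> {1..K - 1}"
  shows "node (gcomb n K a (eig_vec n K e p)) j =
    (\<Sum>k=1..K - 1. (\<Sum>l=1..n. a k l) * sin (pi * real k * real j / real K))"
proof -
  have "node (gcomb n K a (eig_vec n K e p)) j = (\<Sum>l=1..n - 1. 0) +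
      (\<Sum>k=1..K - 1. \<Sum>l=1..n. a k l * sin (pi * real k * real j / real K))"
    unfolding gcomb_def fst_conv sum_idx using assms
    by (intro arg_cong2[of _ _ _ _ "(+)"] sum.cong refl) (auto simp: eig_vec_def eig_vec_0_def eig_vec_k_def)
  then show ?thesis by (simp add: sum_distrib_right)
qed

text \<open>The nodes \<open>j - 1\<close> and \<open>j\<close> lie half a step on either side of
  the element centre; \<phi> is the phase at the centre and \<open>h\<close> the phase of half a
  step.\<close>

lemma sin_mesh_center:
  fixes k :: nat
  assumes "j \<ge> 1" "K \<ge> 1"
  defines "h \<equiv> pi * real k / (2 * real K)" and "\<phi> \<equiv> pi * real k * (real j - 1/2) / real K"
  shows "sin (pi * real k * real (j - 1) / real K) = cos h * sin \<phi> - sin h * cos \<phi>"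
    and "sin (pi * real k * real j / real K) = cos h * sin \<phi> + sin h * cos \<phi>"
proof -
  have "pi * real k * real (j - 1) / real K = \<phi> - h" "pi * real k * real j / real K = \<phi> + h"
    using assms(1,2) by (simp_all add: h_def \<phi>_def field_simps of_nat_diff)
  then show "sin (pi * real k * real (j - 1) / real K) = cos h * sin \<phi> - sin h * cos \<phi>"
    and "sin (pi * real k * real j / real K) = cos h * sin \<phi> + sin h * cos \<phi>"
    by (simp_all only: sin_add sin_diff) (simp_all add: algebra_simps)
qed

lemma eig_vec_in_gspace:
  assumes "\<And>l. l \<in> {1..n - 1} \<Longrightarrow> e l \<in> carrier_vec (n - 1)"
    and "\<And>k l. k \<in> {1..K - 1} \<Longrightarrow> l \<in> {1..n} \<Longrightarrow> p k l \<in> carrier_vec (n - 1)"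
    and "(k, l) \<in> idx n K"
  shows "eig_vec n K e p k l \<in> gspace n K"
  using assms by (auto simp: idx_def eig_vec_def)

lemma cell_gcomb_carrier:
  assumes "\<And>k l. (k, l) \<in> idx n K \<Longrightarrow> b k l \<in> gspace n K"
  shows "cell (gcomb n K a b) j \<in> carrier_vec (n - 1)"
  unfolding gcomb_def snd_conv using gspace_cell[OF assms] by (intro vec_sum_carrier) auto

lemma index_cell_gcomb:
  assumes "\<And>k l. (k, l) \<in> idx n K \<Longrightarrow> b k l \<in> gspace n K" and i: "i < n - 1"
  shows "cell (gcomb n K a b) j $ i = (\<Sum>(k, l)\<in>idx n K. a k l * cell (b k l) j $ i)"
proof -
  have "cell (gcomb n K a b) j =
      vec_sum (n - 1) (\<lambda>x. a (fst x) (snd x) \<cdot>\<^sub>v cell (b (fst x) (snd x)) j) (idx n K)"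
    by (simp add: gcomb_def case_prod_unfold)
  also have "\<dots> $ i = (\<Sum>x\<in>idx n K. a (fst x) (snd x) * cell (b (fst x) (snd x)) j $ i)"
    using gspace_cell[OF assms(1)] i by (intro index_vec_sum_smult) auto
  finally show ?thesis by (simp add: case_prod_unfold)
qed

lemma index_cell_gcomb_eig_vec:
  fixes a :: "nat \<Rightarrow> nat \<Rightarrow> real"
  assumes j: "j \<in> {1..K}" and i: "i < n - 1"
    and e: "\<And>l. l \<in> {1..n - 1} \<Longrightarrow> e l \<in> carrier_vec (n - 1)"
    and p: "\<And>k l. k \<in> {1..K - 1} \<Longrightarrow> l \<in> {1..n} \<Longrightarrow> p k l \<in> carrier_vec (n - 1)"
  defines "d \<equiv> \<lambda>k. vec_sum (n - 1) (\<lambda>l. a k l \<cdot>\<^sub>v p k l) {1..n}"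
  shows "cell (gcomb n K a (eig_vec n K e p)) j $ i =
    neg_refl_pow (j - 1) (vec_sum (n - 1) (\<lambda>l. a 0 l \<cdot>\<^sub>v e l) {1..n - 1}) $ i
    + 2 * (\<Sum>k=1..K - 1. cos (pi * real k / (2 * real K))
        * sin (pi * real k * (real j - 1/2) / real K) * even_part (d k) $ i)
    - 2 * (\<Sum>k=1..K - 1. sin (pi * real k / (2 * real K))
        * cos (pi * real k * (real j - 1/2) / real K) * odd_part (d k) $ i)"
proof -
  let ?v = "vec_sum (n - 1) (\<lambda>l. a 0 l \<cdot>\<^sub>v e l) {1..n - 1}"
  let ?h = "\<lambda>k. pi * real k / (2 * real K)" and ?\<phi> = "\<lambda>k. pi * real k * (real j - 1/2) / real K"
  let ?b = "eig_vec n K e p"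
  note i' = reflect_less[OF i]
  have j1: "j \<ge> 1" "K \<ge> 1" using j by auto
  have v: "?v \<in> carrier_vec (n - 1)" using e by (intro vec_sum_carrier) auto
  have v_ind: "?v $ r = (\<Sum>l=1..n - 1. a 0 l * e l $ r)" if "r < n - 1" for r
    using e that by (intro index_vec_sum_smult) auto
  have d: "d k \<in> carrier_vec (n - 1)" if "k \<in> {1..K - 1}" for k
    unfolding d_def using p[OF that] by (intro vec_sum_carrier) auto
  have d_ind: "d k $ r = (\<Sum>l=1..n. a k l * p k l $ r)" if "k \<in> {1..K - 1}" "r < n - 1" for k r
    unfolding d_def using p[OF that(1)] that by (intro index_vec_sum_smult) auto
  \<comment> \<open>\<open>x\<close> and \<open>y\<close> will be a component of \<open>d k\<close>
    and its mirror component, so the halves are components of the even and odd parts.\<close>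
  have split: "(S - C) * x + (S + C) * y = 2 * (S * ((x + y) / 2)) - 2 * (C * ((x - y) / 2))"
    for S C x y :: real by (simp add: field_simps)
  have b: "?b k l \<in> gspace n K" if "(k, l) \<in> idx n K" for k l
    using eig_vec_in_gspace[where e = e and p = p and n = n and K = K] e p that by blast
  have "cell (gcomb n K a ?b) j $ i = (\<Sum>(k, l)\<in>idx n K. a k l * cell (?b k l) j $ i)"
    using b i by (rule index_cell_gcomb)
  also have "\<dots> = (\<Sum>l=1..n - 1. a 0 l * cell (?b 0 l) j $ i)
      + (\<Sum>k=1..K - 1. \<Sum>l=1..n. a k l * cell (?b k l) j $ i)"
    by (rule sum_idx)
  also have "(\<Sum>l=1..n - 1. a 0 l * cell (?b 0 l) j $ i) =
      (\<Sum>l=1..n - 1. a 0 l * neg_refl_pow (j - 1) (e l) $ i)"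
    using j by (intro sum.cong refl) (simp add: eig_vec_def eig_vec_0_def)
  also have "\<dots> = neg_refl_pow (j - 1) ?v $ i"
    using e i i' v by (simp add: index_neg_refl_pow[of _ "n - 1"] v_ind sum_negf)
  also have "(\<Sum>k=1..K - 1. \<Sum>l=1..n. a k l * cell (?b k l) j $ i) =
      (\<Sum>k=1..K - 1. 2 * (cos (?h k) * sin (?\<phi> k) * even_part (d k) $ i)
        - 2 * (sin (?h k) * cos (?\<phi> k) * odd_part (d k) $ i))"
  proof (intro sum.cong refl)
    fix k assume k: "k \<in> {1..K - 1}"
    let ?S = "cos (?h k) * sin (?\<phi> k)" and ?C = "sin (?h k) * cos (?\<phi> k)"
    have "(\<Sum>l=1..n. a k l * cell (?b k l) j $ i) =
        (\<Sum>l=1..n. (?S - ?C) * (a k l * p k l $ i) + (?S + ?C) * (a k l * p k l $ (n - 1 - 1 - i)))"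
    proof (intro sum.cong refl)
      fix l assume l: "l \<in> {1..n}"
      have "cell (?b k l) j = (?S - ?C) \<cdot>\<^sub>v p k l + (?S + ?C) \<cdot>\<^sub>v refl_vec (p k l)"
        using k eig_vec_k_cell[OF j] sin_mesh_center[OF j1] by (simp add: eig_vec_def)
      then have *: "cell (?b k l) j $ i = (?S - ?C) * p k l $ i + (?S + ?C) * p k l $ (n - 1 - 1 - i)"
        using carrier_vecD[OF p[OF k l]] i by simp
      show "a k l * cell (?b k l) j $ i =
          (?S - ?C) * (a k l * p k l $ i) + (?S + ?C) * (a k l * p k l $ (n - 1 - 1 - i))"
        unfolding * by (simp only: distrib_left mult.left_commute)
    qed
    also have "\<dots> = (?S - ?C) * d k $ i + (?S + ?C) * d k $ (n - 1 - 1 - i)"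
      by (simp only: d_ind[OF k i] d_ind[OF k i'] sum.distrib sum_distrib_left)
    also have "\<dots> = 2 * (?S * even_part (d k) $ i) - 2 * (?C * odd_part (d k) $ i)"
      by (simp only: index_even_part[OF d[OF k] i] index_odd_part[OF d[OF k] i] split)
    finally show "(\<Sum>l=1..n. a k l * cell (?b k l) j $ i) =
        2 * (?S * even_part (d k) $ i) - 2 * (?C * odd_part (d k) $ i)" .
  qed
  finally show ?thesis by (simp add: sum_subtractf sum_distrib_left)
qed

lemma cell_gcomb_eig_vec:
  fixes a :: "nat \<Rightarrow> nat \<Rightarrow> real"
  assumes j: "j \<in> {1..K}"
    and e: "\<And>l. l \<in> {1..n - 1} \<Longrightarrow> e l \<in> carrier_vec (n - 1)"
    and p: "\<And>k l. k \<in> {1..K - 1} \<Longrightarrow> l \<in> {1..n} \<Longrightarrow> p k l \<in> carrier_vec (n - 1)"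
  defines "d \<equiv> \<lambda>k. vec_sum (n - 1) (\<lambda>l. a k l \<cdot>\<^sub>v p k l) {1..n}"
  shows "cell (gcomb n K a (eig_vec n K e p)) j =
    neg_refl_pow (j - 1) (vec_sum (n - 1) (\<lambda>l. a 0 l \<cdot>\<^sub>v e l) {1..n - 1})
    + 2 \<cdot>\<^sub>v vec_sum (n - 1) (\<lambda>k. (cos (pi * real k / (2 * real K))
        * sin (pi * real k * (real j - 1/2) / real K)) \<cdot>\<^sub>v even_part (d k)) {1..K - 1}
    - 2 \<cdot>\<^sub>v vec_sum (n - 1) (\<lambda>k. (sin (pi * real k / (2 * real K))
        * cos (pi * real k * (real j - 1/2) / real K)) \<cdot>\<^sub>v odd_part (d k)) {1..K - 1}"
    (is "?L = ?A + 2 \<cdot>\<^sub>v ?B - 2 \<cdot>\<^sub>v ?C")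
proof (rule eq_vecI)
  have d: "d k \<in> carrier_vec (n - 1)" if "k \<in> {1..K - 1}" for k
    unfolding d_def using p[OF that] by (intro vec_sum_carrier) auto
  have "?A \<in> carrier_vec (n - 1)" "?B \<in> carrier_vec (n - 1)" "?C \<in> carrier_vec (n - 1)"
    using e d by (auto intro!: vec_sum_carrier neg_refl_pow_carrier)
  then have dims: "dim_vec ?A = n - 1" "dim_vec ?B = n - 1" "dim_vec ?C = n - 1"
    by - (rule carrier_vecD, assumption)+
  have "?L \<in> carrier_vec (n - 1)"
    using e p by (intro cell_gcomb_carrier eig_vec_in_gspace)
  then show "dim_vec ?L = dim_vec (?A + 2 \<cdot>\<^sub>v ?B - 2 \<cdot>\<^sub>v ?C)" using dims by simp
  fix i assume "i < dim_vec (?A + 2 \<cdot>\<^sub>v ?B - 2 \<cdot>\<^sub>v ?C)"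
  then have i: "i < n - 1" using dims by simp
  have "(?A + 2 \<cdot>\<^sub>v ?B - 2 \<cdot>\<^sub>v ?C) $ i = ?A $ i + 2 * ?B $ i - 2 * ?C $ i"
    using dims i by simp
  moreover have "?B $ i = (\<Sum>k=1..K - 1. cos (pi * real k / (2 * real K))
        * sin (pi * real k * (real j - 1/2) / real K) * even_part (d k) $ i)"
    using d i by (intro index_vec_sum_smult) auto
  moreover have "?C $ i = (\<Sum>k=1..K - 1. sin (pi * real k / (2 * real K))
        * cos (pi * real k * (real j - 1/2) / real K) * odd_part (d k) $ i)"
    using d i by (intro index_vec_sum_smult) auto
  ultimately show "?L $ i = (?A + 2 \<cdot>\<^sub>v ?B - 2 \<cdot>\<^sub>v ?C) $ i"
    using index_cell_gcomb_eig_vec[where a = a and e = e and p = p, OF j i e p]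
    unfolding d_def by (simp only:)
qed

subsection \<open>Computability by transforms\<close>

text \<open>Summation over \<open>l\<close> is a row of ones applied to the coefficients at
  \<open>k\<close>; the postprocessing is the identity.\<close>

lemma node_gcomb_computable:
  "computable_by_transforms [dst1 K] UNIV
    {1..K - 1} n (\<lambda>a k. vec n (\<lambda>i. a k (i + 1)))
    {1..K - 1} 1 (\<lambda>a j. 0\<^sub>v 1) (\<lambda>a j. vec 1 (\<lambda>_. node (gcomb n K a (eig_vec n K e p)) j))"
proof -
  let ?\<alpha> = "\<lambda>k :: nat. mat 1 n (\<lambda>_. 1) :: real mat"
  have \<alpha>: "(?\<alpha> k *\<^sub>v vec n (\<lambda>i. a k (i + 1))) $ 0 = (\<Sum>l=1..n. a k l)" for a :: "nat \<Rightarrow> nat \<Rightarrow> real" and k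
  proof -
    have "(?\<alpha> k *\<^sub>v vec n (\<lambda>i. a k (i + 1))) $ 0 = (\<Sum>i<n. a k (i + 1))"
      by (simp add: scalar_prod_sum[of _ n])
    also have "\<dots> = (\<Sum>l=1..n. a k l)"
      by (rule sum.reindex_bij_witness[of _ "\<lambda>l. l - 1" "\<lambda>i. i + 1"]) auto
    finally show ?thesis .
  qed
  have "vec 1 (\<lambda>_. node (gcomb n K a (eig_vec n K e p)) j) = 0\<^sub>v 1 + 1\<^sub>m 1 *\<^sub>v
      vec (length [dst1 K]) (\<lambda>r. ([dst1 K] ! r)
        (\<lambda>k. if k \<in> {1..K - 1} then (?\<alpha> k *\<^sub>v vec n (\<lambda>i. a k (i + 1))) $ r else 0) j)"
    if "j \<in> {1..K - 1}" for a j
    by (intro eq_vecI)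
       (auto simp: node_gcomb_eig_vec[OF that] dst1_def \<alpha> simp del: index_mult_mat_vec intro!: sum.cong)
  then show ?thesis
    unfolding computable_by_transforms_def
    by (intro exI[of _ ?\<alpha>] exI[of _ "\<lambda>_. 1\<^sub>m 1"]) auto
qed

text \<open>
  An even vector is determined by its first \<open>(m + 1) div 2\<close> components and an odd vector by its
  first \<open>m div 2\<close> components; the sign vanishes at the middle component of an odd vector.
\<close>

definition fold_pos :: "nat \<Rightarrow> nat \<Rightarrow> nat" where
  "fold_pos m i = min i (m - 1 - i)"

definition fold_sgn :: "nat \<Rightarrow> nat \<Rightarrow> real" where
  "fold_sgn m i = (if i < m - 1 - i then 1 else if i = m - 1 - i then 0 else - 1)"

text \<open>For odd \<open>m\<close> the middle index is its own folded position, equal to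
  \<open>m div 2\<close>. It is a free component of an even vector but lies beyond the stored ones
  of an odd vector, hence the condition on the sign.\<close>

lemma fold_pos_less: "i < m \<Longrightarrow> fold_pos m i < (m + 1) div 2"
  "i < m \<Longrightarrow> fold_sgn m i \<noteq> 0 \<Longrightarrow> fold_pos m i < m div 2"
  by (auto simp: fold_pos_def fold_sgn_def min_def split: if_splits)

lemma index_even_part_fold:
  "v \<in> carrier_vec m \<Longrightarrow> i < m \<Longrightarrow> even_part v $ i = even_part v $ fold_pos m i"
  by (auto simp: fold_pos_def min_def index_even_part)

lemma index_odd_part_fold:
  "v \<in> carrier_vec m \<Longrightarrow> i < m \<Longrightarrow> odd_part v $ i = fold_sgn m i * odd_part v $ fold_pos m i"
  by (auto simp: fold_pos_def fold_sgn_def min_def index_odd_part)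

text \<open>Expresses a component of the even part as a product with a fixed row, as a preprocessing
  matrix independent of the data demands.\<close>

lemma even_part_unit_vec: "v \<in> carrier_vec m \<Longrightarrow> i < m \<Longrightarrow> even_part (unit_vec m i) \<bullet>\<^sub>v v = even_part v $ i"
  by (simp add: even_part_scalar_prod[of _ m] index_even_part[of _ m] scalar_prod_left_unit[of _ m])

lemma odd_part_unit_vec: "v \<in> carrier_vec m \<Longrightarrow> i < m \<Longrightarrow> odd_part (unit_vec m i) \<bullet>\<^sub>v v = odd_part v $ i"
  by (simp add: odd_part_scalar_prod[of _ m] index_odd_part[of _ m] scalar_prod_left_unit[of _ m])

text \<open>Covers the middle component of an odd part, where the sign is 0 and the selected
  position may lie outside the vector.\<close>

lemma smult_unit_scalar_prod:
  fixes s :: real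
  assumes "x \<in> carrier_vec N" "s \<noteq> 0 \<Longrightarrow> i < N"
  shows "(s \<cdot>\<^sub>v unit_vec N i) \<bullet>\<^sub>v x = s * x $ i"
proof (cases "s = 0")
  case True
  then show ?thesis using assms(1) by (simp add: scalar_prod_sum[of _ N])
next
  case False
  then show ?thesis using assms by (simp add: smult_scalar_prod_distrib[of _ N] scalar_prod_left_unit[of _ N])
qed

lemma mult_cong_nonzero:
  fixes s x y :: real
  shows "(s \<noteq> 0 \<Longrightarrow> x = y) \<Longrightarrow> s * x = s * y"
  by auto

lemma half_add_half:
  fixes n :: nat
  shows "n \<ge> 1 \<Longrightarrow> n div 2 + (n - 1) div 2 = n - 1"
  by presburger

text \<open>Only one component of each mirror pair is transformed, and the postprocessing unfolds
  the result by parity. The zero extension of the inputs outside \<open>{1..K - 1}\<close> provides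
  the values at \<open>k = K\<close> for \<open>dst3\<close> and at \<open>k = 0\<close> for
  \<open>dct3\<close>.\<close>

lemma cell_gcomb_computable:
  assumes n: "n \<ge> 1"
    and e: "\<And>l. l \<in> {1..n - 1} \<Longrightarrow> e l \<in> carrier_vec (n - 1)"
    and p: "\<And>k l. k \<in> {1..K - 1} \<Longrightarrow> l \<in> {1..n} \<Longrightarrow> p k l \<in> carrier_vec (n - 1)"
  shows "computable_by_transforms
    (replicate (n div 2) (dst3 K) @ replicate ((n - 1) div 2) (dct3 K)) UNIV
    {1..K - 1} n (\<lambda>a k. vec n (\<lambda>i. a k (i + 1)))
    {1..K} (n - 1)
    (\<lambda>a j. neg_refl_pow (j - 1) (vec_sum (n - 1) (\<lambda>l. a 0 l \<cdot>\<^sub>v e l) {1..n - 1}))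
    (\<lambda>a j. cell (gcomb n K a (eig_vec n K e p)) j)"
proof -
  let ?m = "n - 1" and ?ne = "n div 2"
  let ?Ts = "replicate (n div 2) (dst3 K) @ replicate ((n - 1) div 2) (dct3 K)"
  have len: "length ?Ts = ?m" using half_add_half[OF n] by simp
  have ne: "?ne = (?m + 1) div 2" using n by simp
  let ?h = "\<lambda>k. pi * real k / (2 * real K)"
  \<comment> \<open>The first \<open>n div 2\<close> rows form the stored even components of
    \<open>d\<close>, the remaining rows the stored odd ones, with the half-step factors included.
    Column \<open>i\<close> belongs to \<open>l = i + 1\<close>.\<close>
  define \<alpha> where "\<alpha> k = mat ?m n (\<lambda>(r, i). if r < ?ne then 2 * cos (?h k) * even_part (p k (i + 1)) $ r
    else - 2 * sin (?h k) * odd_part (p k (i + 1)) $ (r - ?ne))" for k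
  \<comment> \<open>Unfolding: each component is its stored even value plus the signed stored odd
    value, the latter offset by the number of even transforms.\<close>
  define \<beta> where "\<beta> = mat\<^sub>r ?m ?m (\<lambda>r. unit_vec ?m (fold_pos ?m r)
      + fold_sgn ?m r \<cdot>\<^sub>v unit_vec ?m (?ne + fold_pos ?m r))"
  define d where "d a k = vec_sum ?m (\<lambda>l. a k l \<cdot>\<^sub>v p k l) {1..n}" for a :: "nat \<Rightarrow> nat \<Rightarrow> real" and k
  have d: "d a k \<in> carrier_vec ?m" if "k \<in> {1..K - 1}" for a k
    unfolding d_def using p[OF that] by (intro vec_sum_carrier) auto
  have d_ind: "d a k $ r = (\<Sum>l=1..n. a k l * p k l $ r)" if "k \<in> {1..K - 1}" "r < ?m" for a k r
    unfolding d_def using p[OF that(1)] that by (intro index_vec_sum_smult) auto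
  have \<alpha>: "(\<alpha> k *\<^sub>v vec n (\<lambda>i. a k (i + 1))) $ r =
      (if r < ?ne then 2 * cos (?h k) * even_part (d a k) $ r
       else - 2 * sin (?h k) * odd_part (d a k) $ (r - ?ne))"
    if k: "k \<in> {1..K - 1}" and r: "r < ?m" for a :: "nat \<Rightarrow> nat \<Rightarrow> real" and k r
  proof -
    have "(\<alpha> k *\<^sub>v vec n (\<lambda>i. a k (i + 1))) $ r = (\<Sum>i<n. \<alpha> k $$ (r, i) * a k (i + 1))"
      using r by (simp add: \<alpha>_def scalar_prod_sum[of _ n])
    also have "\<dots> = (\<Sum>l=1..n. \<alpha> k $$ (r, l - 1) * a k l)"
      by (rule sum.reindex_bij_witness[of _ "\<lambda>l. l - 1" "\<lambda>i. i + 1"]) auto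
    also have "\<dots> = (if r < ?ne then 2 * cos (?h k) * even_part (d a k) $ r
       else - 2 * sin (?h k) * odd_part (d a k) $ (r - ?ne))"
    proof (cases "r < ?ne")
      case True
      note r' = reflect_less[OF r]
      have "(\<Sum>l=1..n. \<alpha> k $$ (r, l - 1) * a k l) =
          (\<Sum>l=1..n. cos (?h k) * (a k l * p k l $ r) + cos (?h k) * (a k l * p k l $ (?m - 1 - r)))"
        using r True p[OF k] by (intro sum.cong refl) (auto simp: \<alpha>_def index_even_part[of _ ?m] algebra_simps)
      also have "\<dots> = cos (?h k) * (d a k $ r + d a k $ (?m - 1 - r))"
        using d_ind[OF k r] d_ind[OF k r'] by (simp add: sum.distrib sum_distrib_left distrib_left)
      finally show ?thesis unfolding index_even_part[OF d[OF k] r] using True by simp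
    next
      case False
      have r1: "r - ?ne < ?m" by (rule less_imp_diff_less[OF r])
      note r' = reflect_less[OF r1]
      have "(\<Sum>l=1..n. \<alpha> k $$ (r, l - 1) * a k l) =
          (\<Sum>l=1..n. sin (?h k) * (a k l * p k l $ (?m - 1 - (r - ?ne))) - sin (?h k) * (a k l * p k l $ (r - ?ne)))"
        using r r1 False p[OF k]
        by (intro sum.cong refl) (auto simp: \<alpha>_def index_odd_part[of _ ?m] field_simps)
      also have "\<dots> = sin (?h k) * (d a k $ (?m - 1 - (r - ?ne)) - d a k $ (r - ?ne))"
        using d_ind[OF k r1] d_ind[OF k r'] by (simp add: sum_subtractf sum_distrib_left right_diff_distrib)
      finally show ?thesis
        unfolding index_odd_part[OF d[OF k] r1] using False by (simp add: right_diff_distrib)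
    qed
    finally show ?thesis .
  qed
  have "cell (gcomb n K a (eig_vec n K e p)) j =
      neg_refl_pow (j - 1) (vec_sum ?m (\<lambda>l. a 0 l \<cdot>\<^sub>v e l) {1..n - 1}) + \<beta> *\<^sub>v
      vec (length ?Ts) (\<lambda>r. (?Ts ! r)
        (\<lambda>k. if k \<in> {1..K - 1} then (\<alpha> k *\<^sub>v vec n (\<lambda>i. a k (i + 1))) $ r else 0) j)"
    (is "?L = ?A + \<beta> *\<^sub>v ?x") if j: "j \<in> {1..K}" for a j
  proof (rule eq_vecI)
    let ?\<phi> = "\<lambda>k. pi * real k * (real j - 1/2) / real K"
    have x: "?x \<in> carrier_vec ?m" using len by simp
    have xe: "?x $ r = (\<Sum>k=1..K - 1. 2 * cos (?h k) * even_part (d a k) $ r * sin (?\<phi> k))" if "r < ?ne" for r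
    proof -
      have r: "r < ?m" using that len by simp
      have "?x $ r = (\<Sum>k=1..K. (if k \<in> {1..K - 1} then (\<alpha> k *\<^sub>v vec n (\<lambda>i. a k (i + 1))) $ r else 0) * sin (?\<phi> k))"
        using that r len by (simp add: nth_append dst3_def)
      also have "\<dots> = (\<Sum>k=1..K - 1. 2 * cos (?h k) * even_part (d a k) $ r * sin (?\<phi> k))"
        using \<alpha>[OF _ r] that
        by (intro sum.mono_neutral_cong_right) (auto simp del: index_mult_mat_vec)
      finally show ?thesis .
    qed
    have xo: "?x $ (?ne + r) = (\<Sum>k=1..K - 1. - 2 * sin (?h k) * odd_part (d a k) $ r * cos (?\<phi> k))" if "r < ?m div 2" for r
    proof -
      have r: "?ne + r < ?m" using that half_add_half[OF n] by simp
      have "?x $ (?ne + r) = (\<Sum>k=0..K - 1. (if k \<in> {1..K - 1} then (\<alpha> k *\<^sub>v vec n (\<lambda>i. a k (i + 1))) $ (?ne + r) else 0) * cos (?\<phi> k))"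
        using that r len by (simp add: nth_append dct3_def)
      also have "\<dots> = (\<Sum>k=1..K - 1. - 2 * sin (?h k) * odd_part (d a k) $ r * cos (?\<phi> k))"
        using \<alpha>[OF _ r] that
        by (intro sum.mono_neutral_cong_right) (auto simp del: index_mult_mat_vec)
      finally show ?thesis .
    qed
    have A: "?A \<in> carrier_vec ?m" using e by (auto intro!: vec_sum_carrier neg_refl_pow_carrier)
    have bd: "dim_row \<beta> = ?m" by (simp add: \<beta>_def)
    have "?L \<in> carrier_vec ?m"
      using e p by (intro cell_gcomb_carrier eig_vec_in_gspace)
    then show "dim_vec ?L = dim_vec (?A + \<beta> *\<^sub>v ?x)" using A bd by simp
    fix i assume "i < dim_vec (?A + \<beta> *\<^sub>v ?x)"
    then have i: "i < ?m" using bd by simp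
    note fp = fold_pos_less[OF i, folded ne]
    have fpm: "fold_pos ?m i < ?m" using i by (auto simp: fold_pos_def)
    have "(\<beta> *\<^sub>v ?x) $ i = row \<beta> i \<bullet>\<^sub>v ?x" using i bd by simp
    also have "row \<beta> i = unit_vec ?m (fold_pos ?m i) + fold_sgn ?m i \<cdot>\<^sub>v unit_vec ?m (?ne + fold_pos ?m i)"
      using i by (simp add: \<beta>_def)
    also have "\<dots> \<bullet>\<^sub>v ?x = unit_vec ?m (fold_pos ?m i) \<bullet>\<^sub>v ?x
        + (fold_sgn ?m i \<cdot>\<^sub>v unit_vec ?m (?ne + fold_pos ?m i)) \<bullet>\<^sub>v ?x"
      by (rule add_scalar_prod_distrib) (use x in auto)
    also have "unit_vec ?m (fold_pos ?m i) \<bullet>\<^sub>v ?x = ?x $ fold_pos ?m i"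
      by (rule scalar_prod_left_unit[OF x fpm])
    also have "(fold_sgn ?m i \<cdot>\<^sub>v unit_vec ?m (?ne + fold_pos ?m i)) \<bullet>\<^sub>v ?x
        = fold_sgn ?m i * ?x $ (?ne + fold_pos ?m i)"
      by (rule smult_unit_scalar_prod[OF x]) (use fp(2) half_add_half[OF n] in linarith)
    also have "\<dots> = fold_sgn ?m i *
        (\<Sum>k=1..K - 1. - 2 * sin (?h k) * odd_part (d a k) $ fold_pos ?m i * cos (?\<phi> k))"
      by (rule mult_cong_nonzero[OF xo[OF fp(2)]])
    also have "?x $ fold_pos ?m i =
        (\<Sum>k=1..K - 1. 2 * cos (?h k) * even_part (d a k) $ fold_pos ?m i * sin (?\<phi> k))"
      by (rule xe[OF fp(1)])
    finally have "(\<beta> *\<^sub>v ?x) $ i =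
        (\<Sum>k=1..K - 1. 2 * cos (?h k) * even_part (d a k) $ fold_pos ?m i * sin (?\<phi> k))
        + fold_sgn ?m i * (\<Sum>k=1..K - 1. - 2 * sin (?h k) * odd_part (d a k) $ fold_pos ?m i * cos (?\<phi> k))" .
    also have "\<dots> = 2 * (\<Sum>k=1..K - 1. cos (?h k) * sin (?\<phi> k) * even_part (d a k) $ i)
        - 2 * (\<Sum>k=1..K - 1. sin (?h k) * cos (?\<phi> k) * odd_part (d a k) $ i)"
      unfolding sum_distrib_left sum_subtractf[symmetric] sum.distrib[symmetric]
      by (intro sum.cong refl)
         (simp add: index_even_part_fold[OF d i] index_odd_part_fold[OF d i] algebra_simps)
    finally have \<beta>x: "(\<beta> *\<^sub>v ?x) $ i = 2 * (\<Sum>k=1..K - 1. cos (?h k) * sin (?\<phi> k) * even_part (d a k) $ i)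
        - 2 * (\<Sum>k=1..K - 1. sin (?h k) * cos (?\<phi> k) * odd_part (d a k) $ i)" .
    have "(?A + \<beta> *\<^sub>v ?x) $ i = ?A $ i + (\<beta> *\<^sub>v ?x) $ i" using i bd by (intro index_add_vec) simp
    then show "?L $ i = (?A + \<beta> *\<^sub>v ?x) $ i"
      unfolding \<beta>x using index_cell_gcomb_eig_vec[where a = a and e = e and p = p, OF j i e p]
      unfolding d_def by (simp only:)
  qed
  moreover have "\<alpha> k \<in> carrier_mat (length ?Ts) n" for k unfolding len by (simp add: \<alpha>_def)
  moreover have "\<beta> \<in> carrier_mat ?m (length ?Ts)" unfolding len by (simp add: \<beta>_def)
  ultimately show ?thesis
    unfolding computable_by_transforms_def by (intro exI[of _ \<alpha>] exI[of _ "\<lambda>_. \<beta>"]) blast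
qed

text \<open>The \<open>n\<close> transforms are one for the nodal values, \<open>n div 2\<close> for
  stored even components and \<open>(n - 1) div 2\<close> for stored odd ones; mirror components of
  the two vector sums are recovered by parity.\<close>

lemma mesh_sums_computable:
  assumes n: "n \<ge> 1"
  shows "computable_by_transforms (replicate n (dst1 K)) (gspace n K)
    {1..K - 1} (1 + 2 * (n - 1)) node_data
    {1..K - 1} (1 + 2 * (n - 1)) (\<lambda>y k. 0\<^sub>v (1 + 2 * (n - 1))) (mesh_sums n K)"
proof -
  let ?m = "n - 1" and ?ne = "n div 2" and ?N = "1 + (n - 1 + (n - 1))"
  have N: "1 + 2 * (n - 1) = ?N" by simp
  have ne: "?ne = (?m + 1) div 2" using n by simp
  \<comment> \<open>Rows act on the node value, the left cell and the right cell. Equal cell blocks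
    give the even part of the sum; opposite signs give the odd part of right minus left.\<close>
  define R where "R r = (if r = 0 then unit_vec 1 0 @\<^sub>v (0\<^sub>v ?m @\<^sub>v 0\<^sub>v ?m)
    else if r \<le> ?ne then 0\<^sub>v 1 @\<^sub>v (even_part (unit_vec ?m (r - 1)) @\<^sub>v even_part (unit_vec ?m (r - 1)))
    else 0\<^sub>v 1 @\<^sub>v (- odd_part (unit_vec ?m (r - 1 - ?ne)) @\<^sub>v odd_part (unit_vec ?m (r - 1 - ?ne))))"
    for r
  define \<alpha> where "\<alpha> = mat\<^sub>r n ?N R"
  define Q where "Q i = (if i = 0 then unit_vec n 0 else if i \<le> ?m then unit_vec n (1 + fold_pos ?m (i - 1))
    else fold_sgn ?m (i - n) \<cdot>\<^sub>v unit_vec n (1 + ?ne + fold_pos ?m (i - n)))" for i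
  define \<beta> where "\<beta> = mat\<^sub>r ?N n Q"
  have R: "dim_vec (R r) = ?N" for r by (simp add: R_def even_part_def odd_part_def)
  have Q: "dim_vec (Q i) = n" for i by (simp add: Q_def)
  have eq: "mesh_sums n K y k = 0\<^sub>v ?N + \<beta> *\<^sub>v vec (length (replicate n (dst1 K)))
      (\<lambda>r. (replicate n (dst1 K) ! r) (\<lambda>j. if j \<in> {1..K - 1} then (\<alpha> *\<^sub>v node_data y j) $ r else 0) k)"
    (is "_ = 0\<^sub>v ?N + \<beta> *\<^sub>v ?x") if y: "y \<in> gspace n K" for y k
  proof -
    let ?s = "\<lambda>j. sin (pi * real k * real j / real K)"
    note Y = gspace_cell[OF y]
    have x: "?x \<in> carrier_vec n" by simp
    have \<alpha>y: "(\<alpha> *\<^sub>v node_data y j) $ r = R r \<bullet>\<^sub>v node_data y j" if "r < n" for r j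
      using that R by (simp add: \<alpha>_def)
    have app: "(u @\<^sub>v (v @\<^sub>v w)) \<bullet>\<^sub>v node_data y j = u \<bullet>\<^sub>v vec 1 (\<lambda>_. node y j) + (v \<bullet>\<^sub>v cell y j + w \<bullet>\<^sub>v cell y (j + 1))"
      if "u \<in> carrier_vec 1" "v \<in> carrier_vec ?m" "w \<in> carrier_vec ?m" for u v w j
      unfolding node_data_def using that Y
      by (subst scalar_prod_append[of _ 1 _ "?m + ?m"]; (subst scalar_prod_append[of _ ?m _ ?m])?) auto
    have xr: "?x $ r = (\<Sum>j=1..K - 1. ?s j * (R r \<bullet>\<^sub>v node_data y j))" if "r < n" for r
    proof -
      \<comment> \<open>Here the transform runs from \<open>j\<close> to \<open>k\<close>; the
        kernel of \<open>dst1\<close> is symmetric in the two indices.\<close>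
      have "?x $ r = (\<Sum>j=1..K - 1. (if j \<in> {1..K - 1} then (\<alpha> *\<^sub>v node_data y j) $ r else 0) * sin (pi * real j * real k / real K))"
        using that by (simp add: dst1_def)
      also have "\<dots> = (\<Sum>j=1..K - 1. ?s j * (R r \<bullet>\<^sub>v node_data y j))"
        by (intro sum.cong refl) (simp add: \<alpha>y[OF that] mult_ac del: index_mult_mat_vec)
      finally show ?thesis .
    qed
    have R0: "R 0 \<bullet>\<^sub>v node_data y j = node y j" for j
      using Y by (simp add: R_def app scalar_prod_left_unit[of _ 1] scalar_prod_left_zero[of _ ?m])
    have Re: "R (1 + r) \<bullet>\<^sub>v node_data y j = even_part (cell y j + cell y (j + 1)) $ r" if "r < ?ne" "r < ?m" for r j
    proof -
      have "R (1 + r) \<bullet>\<^sub>v node_data y j = even_part (unit_vec ?m r) \<bullet>\<^sub>v cell y j + even_part (unit_vec ?m r) \<bullet>\<^sub>v cell y (j + 1)"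
        using that by (simp add: R_def app scalar_prod_left_zero[of _ 1])
      also have "\<dots> = even_part (unit_vec ?m r) \<bullet>\<^sub>v (cell y j + cell y (j + 1))"
        using Y by (intro scalar_prod_add_distrib[symmetric, of _ ?m]) auto
      finally show ?thesis using Y that by (simp add: even_part_unit_vec)
    qed
    have Ro: "R (1 + ?ne + r) \<bullet>\<^sub>v node_data y j = odd_part (cell y (j + 1) - cell y j) $ r" if "r < ?m" for r j
    proof -
      have "R (1 + ?ne + r) \<bullet>\<^sub>v node_data y j = - odd_part (unit_vec ?m r) \<bullet>\<^sub>v cell y j + odd_part (unit_vec ?m r) \<bullet>\<^sub>v cell y (j + 1)"
        using that by (simp add: R_def app scalar_prod_left_zero[of _ 1])
      also have "\<dots> = odd_part (unit_vec ?m r) \<bullet>\<^sub>v (cell y (j + 1) - cell y j)"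
        using Y uminus_scalar_prod[of "odd_part (unit_vec ?m r)" ?m "cell y j"]
        by (simp add: scalar_prod_minus_distrib[of _ ?m])
      finally show ?thesis using Y that by (simp add: odd_part_unit_vec)
    qed
    have es_c: "even_sum n K y k \<in> carrier_vec ?m" and os_c: "odd_sum n K y k \<in> carrier_vec ?m"
      unfolding even_sum_def odd_sum_def using Y
      by (auto intro!: vec_sum_carrier smult_carrier_vec even_part_carrier odd_part_carrier add_carrier_vec minus_carrier_vec)
    have dims: "dim_vec (even_sum n K y k) = ?m" "dim_vec (odd_sum n K y k) = ?m"
      using carrier_vecD[OF es_c] carrier_vecD[OF os_c] by simp_all
    have es: "even_sum n K y k $ r = (\<Sum>j=1..K - 1. ?s j * even_part (cell y j + cell y (j + 1)) $ r)" if "r < ?m" for r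
      unfolding even_sum_def using Y that by (intro index_vec_sum_smult) auto
    have os: "odd_sum n K y k $ r = (\<Sum>j=1..K - 1. ?s j * odd_part (cell y (j + 1) - cell y j) $ r)" if "r < ?m" for r
      unfolding odd_sum_def using Y that by (intro index_vec_sum_smult) auto
    have Qx: "Q i \<bullet>\<^sub>v ?x = mesh_sums n K y k $ i" if i: "i < ?N" for i
    proof -
      \<comment> \<open>The three output blocks: nodal sum, even sum and odd sum; the last one
        starts at 1 + (n - 1) = n.\<close>
      consider "i = 0" | r where "i = 1 + r" "r < ?m" | r where "i = n + r" "r < ?m"
      proof (cases "i = 0 \<or> i < n")
        case True
        then show ?thesis using that(1) that(2)[of "i - 1"] by fastforce
      next
        case False
        then show ?thesis using that(3)[of "i - n"] i n by fastforce
      qed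
      then show ?thesis
      proof cases
        case 1
        then have "Q i \<bullet>\<^sub>v ?x = ?x $ 0" using n x by (simp add: Q_def scalar_prod_left_unit[OF x])
        also have "\<dots> = node_sum K y k" using xr[of 0] n by (simp add: R0 node_sum_def mult.commute)
        finally show ?thesis using 1 by (simp add: mesh_sums_def)
      next
        case 2
        note fp = fold_pos_less(1)[OF 2(2), folded ne]
        have fpm: "fold_pos ?m r < ?m" using 2 by (auto simp: fold_pos_def)
        have lt: "1 + fold_pos ?m r < n" using fpm by simp
        have "Q i \<bullet>\<^sub>v ?x = ?x $ (1 + fold_pos ?m r)"
          using 2 lt by (simp add: Q_def scalar_prod_left_unit[OF x])
        also have "\<dots> = (\<Sum>j=1..K - 1. ?s j * even_part (cell y j + cell y (j + 1)) $ fold_pos ?m r)"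
          unfolding xr[OF lt] by (simp only: Re[OF fp fpm])
        also have "\<dots> = even_sum n K y k $ r"
          unfolding es[OF 2(2)] using Y 2(2)
          by (intro sum.cong refl) (simp add: index_even_part_fold[of _ ?m r])
        finally show ?thesis using 2 dims by (simp add: mesh_sums_def)
      next
        case 3
        note fp = fold_pos_less(2)[OF 3(2)]
        have fpm: "fold_pos ?m r < ?m" using 3 by (auto simp: fold_pos_def)
        have lt: "1 + ?ne + fold_pos ?m r < n" if "fold_sgn ?m r \<noteq> 0"
          using fp[OF that] half_add_half[OF n] n by linarith
        have xr_odd: "?x $ (1 + ?ne + fold_pos ?m r) =
            (\<Sum>j=1..K - 1. ?s j * odd_part (cell y (j + 1) - cell y j) $ fold_pos ?m r)"
          if "fold_sgn ?m r \<noteq> 0"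
          unfolding xr[OF lt[OF that]] by (simp only: Ro[OF fpm])
        have i0: "i \<noteq> 0" "\<not> i \<le> ?m" using 3 n by linarith+
        have Qi: "Q i = fold_sgn ?m r \<cdot>\<^sub>v unit_vec n (1 + ?ne + fold_pos ?m r)"
          using i0 3 by (simp add: Q_def)
        have "Q i \<bullet>\<^sub>v ?x = fold_sgn ?m r * ?x $ (1 + ?ne + fold_pos ?m r)"
          unfolding Qi by (rule smult_unit_scalar_prod[OF x lt])
        also have "\<dots> = fold_sgn ?m r * (\<Sum>j=1..K - 1. ?s j * odd_part (cell y (j + 1) - cell y j) $ fold_pos ?m r)"
          by (rule mult_cong_nonzero[OF xr_odd])
        also have "\<dots> = odd_sum n K y k $ r"
          unfolding os[OF 3(2)] sum_distrib_left using Y 3(2)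
          by (intro sum.cong refl) (simp add: index_odd_part_fold[of _ ?m r] mult.left_commute)
        finally have "Q i \<bullet>\<^sub>v ?x = odd_sum n K y k $ r" .
        moreover have "\<not> n + r - 1 < n - 1" "n + r - 1 - (n - 1) = r" using n by linarith+
        ultimately show ?thesis using 3 n dims by (simp add: mesh_sums_def)
      qed
    qed
    have \<beta>c: "\<beta> \<in> carrier_mat ?N n" by (simp add: \<beta>_def)
    show ?thesis
    proof (rule eq_vecI)
      show "dim_vec (mesh_sums n K y k) = dim_vec (0\<^sub>v ?N + \<beta> *\<^sub>v ?x)"
        using \<beta>c dims by (simp add: mesh_sums_def)
      fix i assume "i < dim_vec (0\<^sub>v ?N + \<beta> *\<^sub>v ?x)"
      then have i: "i < ?N" using \<beta>c by auto
      have "row \<beta> i = Q i" using i Q by (simp add: \<beta>_def)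
      then have "(\<beta> *\<^sub>v ?x) $ i = mesh_sums n K y k $ i" using i \<beta>c Qx[OF i] by auto
      then show "mesh_sums n K y k $ i = (0\<^sub>v ?N + \<beta> *\<^sub>v ?x) $ i"
        using i \<beta>c by (simp del: index_mult_mat_vec)
    qed
  qed
  have \<alpha>c: "\<alpha> \<in> carrier_mat (length (replicate n (dst1 K))) ?N" by (simp add: \<alpha>_def)
  have \<beta>c: "\<beta> \<in> carrier_mat ?N (length (replicate n (dst1 K)))" by (simp add: \<beta>_def)
  show ?thesis
    unfolding computable_by_transforms_def N
    by (intro exI[of _ "\<lambda>_. \<alpha>"] exI[of _ "\<lambda>_. \<beta>"] conjI ballI \<alpha>c \<beta>c eq)
qed

theorem theorem2:
  fixes n K :: nat
    and lam0 :: "nat \<Rightarrow> real" and e :: "nat \<Rightarrow> real vec"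
    and lam :: "nat \<Rightarrow> nat \<Rightarrow> real" and p :: "nat \<Rightarrow> nat \<Rightarrow> real vec"
    and c0 cn :: real and c :: "real vec" and Ct :: "real mat"
    and \<theta> :: "nat \<Rightarrow> real" and s :: "nat \<Rightarrow> nat \<Rightarrow> gvec"
    and q :: "nat \<Rightarrow> nat \<Rightarrow> real vec"
    and d :: "(nat \<Rightarrow> nat \<Rightarrow> real) \<Rightarrow> nat \<Rightarrow> real vec"
  defines "c0 \<equiv> blk_0 (mass_mat n)" and "cn \<equiv> blk_n n (mass_mat n)"
    and "c \<equiv> blk_vec n (mass_mat n)" and "Ct \<equiv> blk_mat n (mass_mat n)"
    and "\<theta> \<equiv> (\<lambda>k. cos (pi * real k / real K))"
    and "s \<equiv> eig_vec n K e p"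
    and "q \<equiv> (\<lambda>k l. Ct *\<^sub>v p k l + c)"
    and "d \<equiv> (\<lambda>w k. vec_sum (n - 1) (\<lambda>l. w k l \<cdot>\<^sub>v p k l) {1..n})"
  assumes n: "n \<ge> 2" and K: "K \<ge> 1" and A: "cond_A n"
    and lam0: "bij_betw lam0 {1..n - 1} (spec_int n)"
    and e_eig: "\<And>l. l \<in> {1..n - 1} \<Longrightarrow>
      gen_eigenvector (blk_mat n (stiff_mat n)) (blk_mat n (mass_mat n)) (e l) (lam0 l)"
    and e_parity: "\<And>l. l \<in> {1..n - 1} \<Longrightarrow> even_vec (e l) \<or> odd_vec (e l)"
    and e_norm: "\<And>l. l \<in> {1..n - 1} \<Longrightarrow> (Ct *\<^sub>v e l) \<bullet>\<^sub>v e l = 1"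
    and lam: "\<And>k. k \<in> {1..K - 1} \<Longrightarrow>
      bij_betw (lam k) {1..n} {\<mu>. \<mu> \<notin> spec_int n \<and> disp_eq n (\<theta> k) \<mu>}"
    and p_dim: "\<And>k l. k \<in> {1..K - 1} \<Longrightarrow> l \<in> {1..n} \<Longrightarrow> p k l \<in> carrier_vec (n - 1)"
    and p_eq: "\<And>k l. k \<in> {1..K - 1} \<Longrightarrow> l \<in> {1..n} \<Longrightarrow>
      G_mat n (lam k l) *\<^sub>v p k l = - G_vec n (lam k l)"
  shows
    \<comment> \<open>inverse \<open>F\<^sub>n\<close>-transform; then direct \<open>FC\<^sub>n\<close>-transform; then direct \<open>F\<^sub>n\<close>-transform\<close>
    "((\<forall>w \<in> gspace n K. \<forall>a. w = gcomb n K a s \<longrightarrow>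
        (\<forall>j\<in>{1..K - 1}. node w j =
           (\<Sum>k=1..K - 1. (\<Sum>l=1..n. a k l) * sin (pi * real k * real j / real K))) \<and>
        (\<forall>j\<in>{1..K}. cell w j =
           neg_refl_pow (j - 1) (vec_sum (n - 1) (\<lambda>l. a 0 l \<cdot>\<^sub>v e l) {1..n - 1})
           + 2 \<cdot>\<^sub>v vec_sum (n - 1) (\<lambda>k. (cos (pi * real k / (2 * real K))
                 * sin (pi * real k * (real j - 1/2) / real K)) \<cdot>\<^sub>v even_part (d a k)) {1..K - 1}
           - 2 \<cdot>\<^sub>v vec_sum (n - 1) (\<lambda>k. (sin (pi * real k / (2 * real K))
                 * cos (pi * real k * (real j - 1/2) / real K)) \<cdot>\<^sub>v odd_part (d a k)) {1..K - 1}))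
     \<and> (\<forall>v \<in> carrier_vec (n - 1). \<forall>j\<ge>1.
          neg_refl_pow (j - 1) v = (if odd j then v else - refl_vec v))
     \<and> computable_by_transforms [dst1 K] UNIV
          {1..K - 1} n (\<lambda>a k. vec n (\<lambda>i. a k (i + 1)))
          {1..K - 1} 1 (\<lambda>a j. 0\<^sub>v 1) (\<lambda>a j. vec 1 (\<lambda>_. node (gcomb n K a s) j))
     \<and> n div 2 + (n - 1) div 2 = n - 1
     \<and> computable_by_transforms
          (replicate (n div 2) (dst3 K) @ replicate ((n - 1) div 2) (dct3 K)) UNIV
          {1..K - 1} n (\<lambda>a k. vec n (\<lambda>i. a k (i + 1)))
          {1..K} (n - 1)
          (\<lambda>a j. neg_refl_pow (j - 1) (vec_sum (n - 1) (\<lambda>l. a 0 l \<cdot>\<^sub>v e l) {1..n - 1}))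
          (\<lambda>a j. cell (gcomb n K a s) j))
     \<and>
     ((\<forall>y \<in> gspace n K. \<forall>b. y = gcomb n K b (\<lambda>k l. gmass n K (s k l)) \<longrightarrow>
        (\<forall>(k, l) \<in> idx n K. b k l = ginner K y (s k l) / gmass_norm2 n K (s k l)))
     \<and> (\<forall>y \<in> gspace n K. \<forall>l\<in>{1..n - 1}. ginner K y (s 0 l) = alt_sum n K y \<bullet>\<^sub>v e l)
     \<and> (\<forall>l\<in>{1..n - 1}. gmass_norm2 n K (s 0 l) = real K)
     \<and> (\<forall>y \<in> gspace n K. \<forall>k\<in>{1..K - 1}. \<forall>l\<in>{1..n}. ginner K y (s k l) =
          node_sum K y k + even_part (p k l) \<bullet>\<^sub>v even_sum n K y k
            + odd_part (p k l) \<bullet>\<^sub>v odd_sum n K y k)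
     \<and> (\<forall>k\<in>{1..K - 1}. \<forall>l\<in>{1..n}. gmass_norm2 n K (s k l) =
          real K * (c0 + (Ct *\<^sub>v p k l + 2 \<cdot>\<^sub>v c) \<bullet>\<^sub>v p k l
            + \<theta> k * (cn + (Ct *\<^sub>v p k l + 2 \<cdot>\<^sub>v c) \<bullet>\<^sub>v refl_vec (p k l))))
     \<and> computable_by_transforms (replicate n (dst1 K)) (gspace n K)
          {1..K - 1} (1 + 2 * (n - 1)) node_data
          {1..K - 1} (1 + 2 * (n - 1)) (\<lambda>y k. 0\<^sub>v (1 + 2 * (n - 1))) (mesh_sums n K))
     \<and>
     ((\<forall>w \<in> gspace n K. \<forall>a. w = gcomb n K a s \<longrightarrow>
        (\<forall>(k, l) \<in> idx n K. a k l = ginner K (gmass n K w) (s k l) / gmass_norm2 n K (s k l)))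
     \<and> (\<forall>w \<in> gspace n K. \<forall>l\<in>{1..n - 1}.
          ginner K (gmass n K w) (s 0 l) = (Ct *\<^sub>v alt_sum n K w) \<bullet>\<^sub>v e l)
     \<and> (\<forall>w \<in> gspace n K. \<forall>k\<in>{1..K - 1}. \<forall>l\<in>{1..n}.
          ginner K (gmass n K w) (s k l) =
            node_sum K (gmass n K w) k + even_part (p k l) \<bullet>\<^sub>v even_sum n K (gmass n K w) k
              + odd_part (p k l) \<bullet>\<^sub>v odd_sum n K (gmass n K w) k \<and>
          ginner K (gmass n K w) (s k l) =
            2 * (c0 + c \<bullet>\<^sub>v p k l + \<theta> k * (cn + c \<bullet>\<^sub>v refl_vec (p k l))) * node_sum K w k
              + even_part (q k l) \<bullet>\<^sub>v even_sum n K w k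
              + odd_part (q k l) \<bullet>\<^sub>v odd_sum n K w k)
     \<and> computable_by_transforms (replicate n (dst1 K)) (gspace n K)
          {1..K - 1} (1 + 2 * (n - 1)) node_data
          {1..K - 1} (1 + 2 * (n - 1)) (\<lambda>w k. 0\<^sub>v (1 + 2 * (n - 1))) (mesh_sums n K))"
proof -
  have n1: "n \<ge> 1" using n by simp
  note M = mass_mat_bisymmetric[OF n1]
  note B = bisymmetric_blk_mat[OF M]
  have Ct: "Ct \<in> carrier_mat (n - 1) (n - 1)" and c: "c \<in> carrier_vec (n - 1)"
    by (simp_all add: Ct_def c_def)
  have e: "e l \<in> carrier_vec (n - 1)" if "l \<in> {1..n - 1}" for l
    by (rule gen_eigenvector_carrier[OF blk_mat_carrier e_eig[OF that]])
  have s0: "s 0 l = eig_vec_0 n K (e l)" for l by (simp add: s_def eig_vec_def)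
  have sk: "s k l = eig_vec_k n K k (p k l)" if "k \<in> {1..K - 1}" for k l
    using that by (simp add: s_def eig_vec_def)
  have s_in: "s k l \<in> gspace n K" if "(k, l) \<in> idx n K" for k l
    unfolding s_def using e p_dim that by (intro eig_vec_in_gspace)
  have Ce: "Ct *\<^sub>v e l \<in> carrier_vec (n - 1)" if "l \<in> {1..n - 1}" for l
    by (rule mult_mat_vec_carrier[OF Ct e[OF that]])
  have gs0: "gmass n K (s 0 l) = eig_vec_0 n K (Ct *\<^sub>v e l)" if "l \<in> {1..n - 1}" for l
    unfolding s0 Ct_def by (rule gmass_eig_vec_0[OF n1 e[OF that]])
  have gsk: "gmass n K (s k l) =
      wave_vec n K k (2 * (c0 + c \<bullet>\<^sub>v p k l + \<theta> k * (cn + c \<bullet>\<^sub>v refl_vec (p k l)))) (q k l)"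
    if "k \<in> {1..K - 1}" "l \<in> {1..n}" for k l
    unfolding sk[OF that(1)] c0_def cn_def c_def Ct_def \<theta>_def q_def
    by (rule gmass_eig_vec_k[OF n1 K p_dim[OF that]])
  have q: "q k l \<in> carrier_vec (n - 1)" if "k \<in> {1..K - 1}" "l \<in> {1..n}" for k l
    unfolding q_def using mult_mat_vec_carrier[OF Ct p_dim[OF that]] c by simp
  have gkk: "ginner K (gmass n K (s k l)) (s k' l') =
      (if k = k' then real K * bloch_form n (mass_mat n) (\<theta> k) (p k l) (p k' l') else 0)"
    if "k \<in> {1..K - 1}" "l \<in> {1..n}" "k' \<in> {1..K - 1}" "l' \<in> {1..n}" for k l k' l'
    unfolding sk[OF that(1)] sk[OF that(3)] \<theta>_def
    by (rule ginner_gmass_eig_vec_k[OF n1 that(1,3) p_dim[OF that(1,2)] p_dim[OF that(3,4)]])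
  have gk0: "ginner K (gmass n K (s k l)) (s 0 l') = 0"
    if "k \<in> {1..K - 1}" "l \<in> {1..n}" "l' \<in> {1..n - 1}" for k l l'
    unfolding gsk[OF that(1,2)] s0
    by (rule ginner_wave_vec_eig_vec_0[OF K q[OF that(1,2)] e[OF that(3)]])
  have g00: "ginner K (gmass n K (s 0 l)) (s 0 l') = real K * ((Ct *\<^sub>v e l) \<bullet>\<^sub>v e l')"
    if "l \<in> {1..n - 1}" "l' \<in> {1..n - 1}" for l l'
    unfolding gs0[OF that(1)] unfolding s0
    by (rule ginner_eig_vec_0_eig_vec_0[OF Ce[OF that(1)] e[OF that(2)]])
  have orth: "ginner K (gmass n K (s k l)) (s k' l') = 0"
    if kl: "(k, l) \<in> idx n K" and kl': "(k', l') \<in> idx n K" and ne: "(k, l) \<noteq> (k', l')"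
    for k l k' l'
  proof -
    consider (zz) "k = 0" "k' = 0" "l \<in> {1..n - 1}" "l' \<in> {1..n - 1}"
      | (zk) "k = 0" "l \<in> {1..n - 1}" "k' \<in> {1..K - 1}" "l' \<in> {1..n}"
      | (kz) "k' = 0" "l' \<in> {1..n - 1}" "k \<in> {1..K - 1}" "l \<in> {1..n}"
      | (kk) "k \<in> {1..K - 1}" "l \<in> {1..n}" "k' \<in> {1..K - 1}" "l' \<in> {1..n}"
      using kl kl' unfolding idx_def by blast
    then show ?thesis
    proof cases
      \<comment> \<open>Injectivity of \<open>lam0\<close> makes the two interior eigenvalues
        distinct.\<close>
      case zz
      then have "lam0 l \<noteq> lam0 l'"
        using inj_on_eq_iff[OF bij_betw_imp_inj_on[OF lam0] zz(3,4)] ne by simp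
      then have "(Ct *\<^sub>v e l) \<bullet>\<^sub>v e l' = 0"
        unfolding Ct_def
        using gen_eigenvector_orthogonal[OF bisymmetric_blk_mat[OF stiff_mat_bisymmetric[OF n1]] B
            e_eig[OF zz(3)] e_eig[OF zz(4)]] by simp
      then show ?thesis using g00[OF zz(3,4)] zz by simp
    next
      case zk
      then show ?thesis
        using ginner_gmass_sym[OF n1 K s_in[OF kl] s_in[OF kl']] gk0[OF zk(3,4,2)] by simp
    next
      case kz
      then show ?thesis using gk0[OF kz(3,4,2)] by simp
    next
      case kk
      show ?thesis
      proof (cases "k = k'")
        \<comment> \<open>For equal \<open>k\<close> the sines give no orthogonality; it comes from
          two distinct roots of the same dispersion equation.\<close>
        case True
        then have "lam k l \<noteq> lam k l'"
          using inj_on_eq_iff[OF bij_betw_imp_inj_on[OF lam[OF kk(1)]] kk(2,4)] ne by simp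
        moreover have "lam k j \<notin> spec_int n" "disp_eq n (\<theta> k) (lam k j)" if "j \<in> {1..n}" for j
          using bij_betwE[OF lam[OF kk(1)]] that by blast+
        ultimately have "bloch_form n (mass_mat n) (\<theta> k) (p k l) (p k l') = 0"
          using kk True by (intro bloch_form_mass_orthogonal[OF n1, of "lam k l" "lam k l'"] p_dim p_eq)
        then show ?thesis using gkk[OF kk] True by simp
      next
        case False
        then show ?thesis using gkk[OF kk] by simp
      qed
    qed
  qed
  have norm_0: "gmass_norm2 n K (s 0 l) = real K" if "l \<in> {1..n - 1}" for l
    unfolding gmass_norm2_def using g00[OF that that] e_norm[OF that] by simp
  have norm_k: "gmass_norm2 n K (s k l) = real K * bloch_form n (mass_mat n) (\<theta> k) (p k l) (p k l)"
    if "k \<in> {1..K - 1}" "l \<in> {1..n}" for k l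
    unfolding gmass_norm2_def using gkk[OF that that] by simp
  have norm_pos: "gmass_norm2 n K (s k l) > 0" if "(k, l) \<in> idx n K" for k l
  proof -
    have "bloch_form n (mass_mat n) (\<theta> k) (p k l) (p k l) > 0" if "k \<in> {1..K - 1}" "l \<in> {1..n}"
      using p_dim[OF that] by (intro bloch_form_mass_pos[OF n1]) (simp_all add: \<theta>_def)
    then show ?thesis using that K norm_0 norm_k by (auto simp: idx_def)
  qed
  \<comment> \<open>Shared by both direct transforms: an expansion tested with the image of
    \<open>s k l\<close> retains only its own coefficient.\<close>
  have coeff: "(\<Sum>(k', l')\<in>idx n K. a k' l' * ginner K (gmass n K (s k l)) (s k' l'))
      = a k l * gmass_norm2 n K (s k l)" if "(k, l) \<in> idx n K" for a k l
  proof -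
    have "(\<Sum>(k', l')\<in>idx n K. a k' l' * ginner K (gmass n K (s k l)) (s k' l')) =
        (\<Sum>x\<in>idx n K. if x = (k, l) then a k l * gmass_norm2 n K (s k l) else 0)"
    proof (intro sum.cong refl, clarify)
      fix k' l' assume "(k', l') \<in> idx n K"
      then show "a k' l' * ginner K (gmass n K (s k l)) (s k' l') =
          (if (k', l') = (k, l) then a k l * gmass_norm2 n K (s k l) else 0)"
        using orth[OF that, of k' l'] by (cases "(k', l') = (k, l)") (auto simp: gmass_norm2_def)
    qed
    then show ?thesis using that by simp
  qed
  have ginner_sk: "ginner K y (s k l) = node_sum K y k + even_part (p k l) \<bullet>\<^sub>v even_sum n K y k
      + odd_part (p k l) \<bullet>\<^sub>v odd_sum n K y k"
    if "y \<in> gspace n K" "k \<in> {1..K - 1}" "l \<in> {1..n}" for y k l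
    using ginner_wave_vec[OF K that(1) p_dim[OF that(2,3)], of k 1] by (simp add: sk[OF that(2)] wave_vec_1)

  have inverse: "(\<forall>j\<in>{1..K - 1}. node w j =
           (\<Sum>k=1..K - 1. (\<Sum>l=1..n. a k l) * sin (pi * real k * real j / real K))) \<and>
        (\<forall>j\<in>{1..K}. cell w j =
           neg_refl_pow (j - 1) (vec_sum (n - 1) (\<lambda>l. a 0 l \<cdot>\<^sub>v e l) {1..n - 1})
           + 2 \<cdot>\<^sub>v vec_sum (n - 1) (\<lambda>k. (cos (pi * real k / (2 * real K))
                 * sin (pi * real k * (real j - 1/2) / real K)) \<cdot>\<^sub>v even_part (d a k)) {1..K - 1}
           - 2 \<cdot>\<^sub>v vec_sum (n - 1) (\<lambda>k. (sin (pi * real k / (2 * real K))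
                 * cos (pi * real k * (real j - 1/2) / real K)) \<cdot>\<^sub>v odd_part (d a k)) {1..K - 1})"
    if w: "w = gcomb n K a s" for w a
    unfolding w s_def d_def
    by (intro conjI ballI node_gcomb_eig_vec cell_gcomb_eig_vec e p_dim)
  have signs: "neg_refl_pow (j - 1) v = (if odd j then v else - refl_vec v)" if "j \<ge> 1" for v j
    using that by (auto simp: neg_refl_pow_eq)
  have direct_FC: "b k l = ginner K y (s k l) / gmass_norm2 n K (s k l)"
    if y: "y \<in> gspace n K" "y = gcomb n K b (\<lambda>k l. gmass n K (s k l))" and kl: "(k, l) \<in> idx n K"
    for y b k l
  proof -
    have "ginner K y (s k l) = ginner K (s k l) y"
      by (rule ginner_comm[OF y(1) s_in[OF kl]])
    also have "\<dots> = (\<Sum>(k', l')\<in>idx n K. b k' l' * ginner K (s k l) (gmass n K (s k' l')))"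
      unfolding y(2) by (rule ginner_gcomb[OF s_in[OF kl] gmass_in_gspace[OF s_in]])
    \<comment> \<open>Symmetry moves the mass operator from the expansion vectors to the test
      vector, which gives the form of \<open>coeff\<close>.\<close>
    also have "\<dots> = (\<Sum>(k', l')\<in>idx n K. b k' l' * ginner K (gmass n K (s k l)) (s k' l'))"
      using ginner_comm[OF s_in[OF kl] gmass_in_gspace[OF s_in]]
        ginner_gmass_sym[OF n1 K s_in s_in[OF kl]]
      by (intro sum.cong refl) auto
    also have "\<dots> = b k l * gmass_norm2 n K (s k l)" by (rule coeff[OF kl])
    finally show ?thesis using norm_pos[OF kl] by simp
  qed
  have direct_F: "a k l = ginner K (gmass n K w) (s k l) / gmass_norm2 n K (s k l)"
    if w: "w \<in> gspace n K" "w = gcomb n K a s" and kl: "(k, l) \<in> idx n K" for w a k l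
  proof -
    have "ginner K (gmass n K w) (s k l) = ginner K (gmass n K (s k l)) w"
      by (rule ginner_gmass_sym[OF n1 K w(1) s_in[OF kl]])
    also have "\<dots> = (\<Sum>(k', l')\<in>idx n K. a k' l' * ginner K (gmass n K (s k l)) (s k' l'))"
      unfolding w(2) by (rule ginner_gcomb[OF gmass_in_gspace[OF s_in[OF kl]] s_in])
    also have "\<dots> = a k l * gmass_norm2 n K (s k l)" by (rule coeff[OF kl])
    finally show ?thesis using norm_pos[OF kl] by simp
  qed
  have ginner_s0: "ginner K y (s 0 l) = alt_sum n K y \<bullet>\<^sub>v e l"
    if "y \<in> gspace n K" "l \<in> {1..n - 1}" for y l
    unfolding s0 by (rule ginner_eig_vec_0[OF that(1) e[OF that(2)]])
  have norm_formula: "gmass_norm2 n K (s k l) =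
      real K * (c0 + (Ct *\<^sub>v p k l + 2 \<cdot>\<^sub>v c) \<bullet>\<^sub>v p k l
        + \<theta> k * (cn + (Ct *\<^sub>v p k l + 2 \<cdot>\<^sub>v c) \<bullet>\<^sub>v refl_vec (p k l)))"
    if "k \<in> {1..K - 1}" "l \<in> {1..n}" for k l
  proof -
    have "(Ct *\<^sub>v p k l + 2 \<cdot>\<^sub>v c) \<bullet>\<^sub>v r = (Ct *\<^sub>v p k l) \<bullet>\<^sub>v r + 2 * (c \<bullet>\<^sub>v r)"
      if r: "r \<in> carrier_vec (n - 1)" for r
      using r c mult_mat_vec_carrier[OF Ct p_dim[OF \<open>k \<in> _\<close> \<open>l \<in> _\<close>]]
      by (simp add: add_scalar_prod_distrib[of _ "n - 1"] smult_scalar_prod_distrib[of _ "n - 1"])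
    from this[OF p_dim[OF that]] this[OF refl_vec_carrier[OF p_dim[OF that]]]
    show ?thesis unfolding norm_k[OF that] bloch_form_def
      by (simp add: c0_def cn_def c_def Ct_def add_ac)
  qed
  have mass_s0: "ginner K (gmass n K w) (s 0 l) = (Ct *\<^sub>v alt_sum n K w) \<bullet>\<^sub>v e l"
    if "w \<in> gspace n K" "l \<in> {1..n - 1}" for w l
  proof -
    have "(0, l) \<in> idx n K" using that by (simp add: idx_def)
    note s0_in = s_in[OF this]
    have "ginner K (gmass n K w) (s 0 l) = ginner K (gmass n K (s 0 l)) w"
      by (rule ginner_gmass_sym[OF n1 K that(1) s0_in])
    also have "\<dots> = ginner K w (gmass n K (s 0 l))"
      by (rule ginner_comm[OF gmass_in_gspace[OF s0_in] that(1)])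
    also have "\<dots> = alt_sum n K w \<bullet>\<^sub>v (Ct *\<^sub>v e l)"
      unfolding gs0[OF that(2)] by (rule ginner_eig_vec_0[OF that(1) Ce[OF that(2)]])
    also have "\<dots> = (Ct *\<^sub>v alt_sum n K w) \<bullet>\<^sub>v e l"
      unfolding Ct_def
      by (rule bisymmetric_scalar_prod[OF B alt_sum_carrier[OF that(1)] e[OF that(2)], symmetric])
    finally show ?thesis .
  qed
  \<comment> \<open>The alternative formula results from letting the mass operator act on
    \<open>s k l\<close> instead of \<open>w\<close>: its image is a wave with profile
    \<open>q k l\<close>, so the mesh sums are those of \<open>w\<close> itself.\<close>
  have mass_sk: "ginner K (gmass n K w) (s k l) =
      2 * (c0 + c \<bullet>\<^sub>v p k l + \<theta> k * (cn + c \<bullet>\<^sub>v refl_vec (p k l))) * node_sum K w k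
        + even_part (q k l) \<bullet>\<^sub>v even_sum n K w k + odd_part (q k l) \<bullet>\<^sub>v odd_sum n K w k"
    if "w \<in> gspace n K" "k \<in> {1..K - 1}" "l \<in> {1..n}" for w k l
  proof -
    have "(k, l) \<in> idx n K" using that by (simp add: idx_def)
    note sk_in = s_in[OF this]
    have "ginner K (gmass n K w) (s k l) = ginner K (gmass n K (s k l)) w"
      by (rule ginner_gmass_sym[OF n1 K that(1) sk_in])
    also have "\<dots> = ginner K w (gmass n K (s k l))"
      by (rule ginner_comm[OF gmass_in_gspace[OF sk_in] that(1)])
    finally show ?thesis
      unfolding gsk[OF that(2,3)] ginner_wave_vec[OF K that(1) q[OF that(2,3)]] .
  qed
  note mesh = mesh_sums_computable[OF n1, of K]
  have direct_FC_all: "\<forall>(k, l)\<in>idx n K. b k l = ginner K y (s k l) / gmass_norm2 n K (s k l)"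
    if "y \<in> gspace n K" "y = gcomb n K b (\<lambda>k l. gmass n K (s k l))" for y b
    by safe (rule direct_FC[OF that])
  have direct_F_all: "\<forall>(k, l)\<in>idx n K. a k l = ginner K (gmass n K w) (s k l) / gmass_norm2 n K (s k l)"
    if "w \<in> gspace n K" "w = gcomb n K a s" for w a
    by safe (rule direct_F[OF that])
  show ?thesis
    apply (intro conjI)
    subgoal by (intro ballI allI impI, rule inverse, assumption)
    subgoal by (intro ballI allI impI, rule signs, assumption)
    subgoal unfolding s_def by (rule node_gcomb_computable)
    subgoal by (rule half_add_half[OF n1])
    subgoal unfolding s_def by (intro cell_gcomb_computable n1 e p_dim)
    subgoal using direct_FC_all by blast
    subgoal by (intro ballI, rule ginner_s0, assumption, assumption)
    subgoal by (intro ballI, rule norm_0, assumption)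
    subgoal by (intro ballI, rule ginner_sk, assumption, assumption, assumption)
    subgoal by (intro ballI, rule norm_formula, assumption, assumption)
    subgoal by (rule mesh)
    subgoal using direct_F_all by blast
    subgoal by (intro ballI, rule mass_s0, assumption, assumption)
    subgoal by (intro ballI conjI ginner_sk gmass_in_gspace mass_sk)
    subgoal by (rule mesh)
    done
qed

end
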